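(* Let $(M,\pi)$ be a Poisson manifold integrated by a symplectic groupoid $(G,\omega_G)$ over $M$ with connected and simply connected source fibers, and let $B\in\Omega^2(M)$ be a closed $\pi$-admissible $2$-form, with $\pi_B$ the Poisson bivector such that $\tau_B(L_\pi)=L_{\pi_B}$. Identify $AG\cong (T^*M)_\pi$ via the Lie algebroid isomorphism $\sigma_{\omega_G}$, and put $B_G:=\mathsf{t}^*B-\mathsf{s}^*B$. Then the IM-$2$-form $\Phi_B=(\mathrm{Id}+B^\sharp\circ\pi^\sharp):(T^*M)_\pi\to (T^*M)_{\pi_B}$ integrates to the multiplicative closed $2$-form on $G$ given by $$\omega^B_G=\omega_G+B_G ,$$ i.e. $\sigma_{\omega^B_G}=\Phi_B\circ\sigma_{\omega_G}$. Moreover, since $\Phi_B$ is an isomorphism, the pair $(G,\omega^B_G)$ is a symplectic groupoid integrating the Poisson manifold $(M,\pi_B)$.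
   Context: $G$ has source and target $\mathsf{s},\mathsf{t}:G\to M$, composable pairs $G_{(2)}=\{(g,h):\mathsf{t}(h)=\mathsf{s}(g)\}$ and multiplication $m_G$. Its Lie algebroid is $AG=\ker(T\mathsf{s})|_M$ with anchor $\rho_{AG}=T\mathsf{t}|_{AG}$ and bracket from right-invariant vector fields. A $2$-form $\omega$ on $G$ is multiplicative if $m_G^*\omega=\mathrm{pr}_1^*\omega+\mathrm{pr}_2^*\omega$ on $G_{(2)}$. For such $\omega$ set $\sigma_\omega:AG\to T^*M$, $\sigma_\omega(a)=\omega(a,\cdot)|_{TM}$. An IM-$2$-form on a Lie algebroid $A\to M$ is a bundle map $\sigma:A\to T^*M$ with $\langle\sigma(a),\rho_A(b)\rangle=-\langle\sigma(b),\rho_A(a)\rangle$ and $\sigma([a,b]_A)=\mathcal{L}_{\rho_A(a)}\sigma(b)-\mathcal{L}_{\rho_A(b)}\sigma(a)+d\langle\sigma(a),\rho_A(b)\rangle$ for all $a,b\in\Gamma(A)$. If $\omega$ is closed and multiplicative, $\sigma_\omega$ is an IM-$2$-form; for $G$ with connected and simply connected source fibers, $\omega\mapsto\sigma_\omega$ is a bijection between closed multiplicative $2$-forms on $G$ and IM-$2$-forms on $AG$, and $\sigma_\omega$ is said to integrate to $\omega$. For a Poisson bivector $\pi$ on $M$, $\pi^\sharp:T^*M\to TM$ is given by $\beta(\pi^\sharp(\alpha))=\pi(\alpha,\beta)$, and $(T^*M)_\pi$ is the Lie algebroid $T^*M$ with anchor $\pi^\sharp$ and bracket $[\alpha,\beta]_\pi=\mathcal{L}_{\pi^\sharp(\alpha)}\beta-\mathcal{L}_{\pi^\sharp(\beta)}\alpha-d\pi(\alpha,\beta)$.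 For a $2$-form $B$, $B^\sharp(X)=B(X,\cdot)$. $L_\pi=\{(\pi^\sharp(\alpha),\alpha)\}\subseteq TM\oplus T^*M$ and $\tau_B(X,\alpha)=(X,\alpha+B^\sharp(X))$. A closed $2$-form $B$ is $\pi$-admissible if $\tau_B(L_\pi)$ is the graph $L_{\pi_B}$ of a Poisson bivector $\pi_B$; equivalently, $\mathrm{Id}+B^\sharp\circ\pi^\sharp$ is a vector bundle isomorphism. A symplectic groupoid is a Lie groupoid with a closed, nondegenerate, multiplicative $2$-form. A symplectic groupoid $(G,\omega_G)$ over $M$ integrates $(M,\pi)$ if $\sigma_{\omega_G}:AG\to(T^*M)_\pi$ is a Lie algebroid isomorphism. *)

theory Defs
  imports "HOL-Analysis.Analysis"
begin

section \<open>Smooth maps between open subsets of normed spaces\<close>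

text \<open>Only used for open \<open>S\<close> in finite-dimensional spaces, where continuity of all iterated
  directional derivatives is the usual notion.\<close>

primrec Ck_on :: "nat \<Rightarrow> 'a::real_normed_vector set \<Rightarrow> ('a \<Rightarrow> 'b::real_normed_vector) \<Rightarrow> bool" where
  "Ck_on 0 S f \<longleftrightarrow> continuous_on S f"
| "Ck_on (Suc k) S f \<longleftrightarrow>
     (\<forall>x\<in>S. f differentiable (at x)) \<and> (\<forall>v. Ck_on k S (\<lambda>x. frechet_derivative f (at x) v))"

definition smooth_on :: "'a::real_normed_vector set \<Rightarrow> ('a \<Rightarrow> 'b::real_normed_vector) \<Rightarrow> bool" where
  "smooth_on S f \<longleftrightarrow> (\<forall>k. Ck_on k S f)"

section \<open>Manifolds, tangent vectors and tangent maps\<close>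

text \<open>An atlas is given as a family of charts \<open>A p = (U, \<phi>)\<close> with \<open>p \<in> U\<close>, one chosen at each
  point; every atlas contains such a family, and it determines the same smooth structure. The
  choice of a chart at each point identifies the tangent space at \<open>p\<close> with the model space \<open>'e\<close>:
  the vector \<open>v :: 'e\<close> at \<open>p\<close> is the tangent vector with components \<open>v\<close> in the chart \<open>A p\<close>.
  The model space is a finite-dimensional real inner product space (the inner product plays no
  role); \<open>euclidean_space\<close> would exclude dimension \<open>0\<close>. Hausdorffness and second countability are
  left to the type of the points.\<close>

type_synonym ('m, 'e) atlas = "'m \<Rightarrow> 'm set \<times> ('m \<Rightarrow> 'e)"

abbreviation cdom :: "('m, 'e) atlas \<Rightarrow> 'm \<Rightarrow> 'm set" where
  "cdom A p \<equiv> fst (A p)"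

abbreviation chart :: "('m, 'e) atlas \<Rightarrow> 'm \<Rightarrow> 'm \<Rightarrow> 'e" where
  "chart A p \<equiv> snd (A p)"

definition ichart :: "('m, 'e) atlas \<Rightarrow> 'm \<Rightarrow> 'e \<Rightarrow> 'm" where
  "ichart A p = inv_into (cdom A p) (chart A p)"

definition smooth_atlas :: "('m::topological_space, 'e::real_inner) atlas \<Rightarrow> bool" where
  "smooth_atlas A \<longleftrightarrow>
     (\<exists>E::'e set. finite E \<and> span E = UNIV) \<and>
     (\<forall>p. p \<in> cdom A p \<and> open (cdom A p) \<and> open (chart A p ` cdom A p) \<and>
          homeomorphism (cdom A p) (chart A p ` cdom A p) (chart A p) (ichart A p)) \<and>
     (\<forall>p q. smooth_on (chart A p ` (cdom A p \<inter> cdom A q)) (chart A q \<circ> ichart A p))"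

definition prod_atlas :: "('m, 'e) atlas \<Rightarrow> ('n, 'f) atlas \<Rightarrow> ('m \<times> 'n, 'e \<times> 'f) atlas" where
  "prod_atlas A B = (\<lambda>(p, q). (cdom A p \<times> cdom B q, map_prod (chart A p) (chart B q)))"

definition smooth_map_on ::
  "('m::topological_space, 'e::real_inner) atlas \<Rightarrow> ('n::topological_space, 'f::real_inner) atlas
     \<Rightarrow> 'm set \<Rightarrow> ('m \<Rightarrow> 'n) \<Rightarrow> bool" where
  "smooth_map_on A B W f \<longleftrightarrow> open W \<and> continuous_on W f \<and>
     (\<forall>p q. smooth_on (chart A p ` (cdom A p \<inter> W \<inter> f -` cdom B q)) (chart B q \<circ> f \<circ> ichart A p))"

definition tangent_map ::
  "('m, 'e::real_normed_vector) atlas \<Rightarrow> ('n, 'f::real_normed_vector) atlas \<Rightarrow> ('m \<Rightarrow> 'n)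
     \<Rightarrow> 'm \<Rightarrow> 'e \<Rightarrow> 'f" where
  "tangent_map A B f p = frechet_derivative (chart B (f p) \<circ> f \<circ> ichart A p) (at (chart A p p))"

text \<open>Maps on an embedded submanifold \<open>S\<close> of a manifold: smoothness is local extendability, and the
  tangent map is that of any local extension. The value of \<open>tangent_map_on\<close> is independent of the
  extension on vectors tangent to \<open>S\<close>, and is only used on those.\<close>

definition smooth_extension ::
  "('m::topological_space, 'e::real_inner) atlas \<Rightarrow> ('n::topological_space, 'f::real_inner) atlas
     \<Rightarrow> 'm set \<Rightarrow> ('m \<Rightarrow> 'n) \<Rightarrow> 'm \<Rightarrow> ('m \<Rightarrow> 'n) \<Rightarrow> bool" where
  "smooth_extension A B S f p F \<longleftrightarrow>
     (\<exists>W. p \<in> W \<and> smooth_map_on A B W F \<and> (\<forall>q\<in>W \<inter> S. F q = f q))"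

definition smooth_map_on_sub ::
  "('m::topological_space, 'e::real_inner) atlas \<Rightarrow> ('n::topological_space, 'f::real_inner) atlas
     \<Rightarrow> 'm set \<Rightarrow> ('m \<Rightarrow> 'n) \<Rightarrow> bool" where
  "smooth_map_on_sub A B S f \<longleftrightarrow> (\<forall>p\<in>S. \<exists>F. smooth_extension A B S f p F)"

definition tangent_map_on ::
  "('m::topological_space, 'e::real_inner) atlas \<Rightarrow> ('n::topological_space, 'f::real_inner) atlas
     \<Rightarrow> 'm set \<Rightarrow> ('m \<Rightarrow> 'n) \<Rightarrow> 'm \<Rightarrow> 'e \<Rightarrow> 'f" where
  "tangent_map_on A B S f p = tangent_map A B (SOME F. smooth_extension A B S f p F) p"

section \<open>Tensor fields\<close>

text \<open>\<open>to_chart A p q\<close> sends a tangent vector at \<open>q\<close> (in components of the chart \<open>A q\<close>) to its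
  components in the chart \<open>A p\<close>; \<open>from_chart A p q\<close> is the inverse. Both need \<open>q \<in> cdom A p\<close>.\<close>

definition to_chart :: "('m, 'e::real_normed_vector) atlas \<Rightarrow> 'm \<Rightarrow> 'm \<Rightarrow> 'e \<Rightarrow> 'e" where
  "to_chart A p q = frechet_derivative (chart A p \<circ> ichart A q) (at (chart A q q))"

definition from_chart :: "('m, 'e::real_normed_vector) atlas \<Rightarrow> 'm \<Rightarrow> 'm \<Rightarrow> 'e \<Rightarrow> 'e" where
  "from_chart A p q = frechet_derivative (chart A q \<circ> ichart A p) (at (chart A p q))"

type_synonym 'e covector = "'e \<Rightarrow>\<^sub>L real"

definition field_in_chart ::
  "('m, 'e::real_normed_vector) atlas \<Rightarrow> ('m \<Rightarrow> 'e) \<Rightarrow> 'm \<Rightarrow> 'e \<Rightarrow> 'e" where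
  "field_in_chart A X p y = (let q = ichart A p y in to_chart A p q (X q))"

definition form1_in_chart ::
  "('m, 'e::real_normed_vector) atlas \<Rightarrow> ('m \<Rightarrow> 'e covector) \<Rightarrow> 'm \<Rightarrow> 'e \<Rightarrow> 'e \<Rightarrow> real" where
  "form1_in_chart A \<alpha> p y v =
     (let q = ichart A p y in blinfun_apply (\<alpha> q) (from_chart A p q v))"

definition form2_in_chart ::
  "('m, 'e::real_normed_vector) atlas \<Rightarrow> ('m \<Rightarrow> 'e \<Rightarrow> 'e \<Rightarrow> real)
     \<Rightarrow> 'm \<Rightarrow> 'e \<Rightarrow> 'e \<Rightarrow> 'e \<Rightarrow> real" where
  "form2_in_chart A \<omega> p y v w =
     (let q = ichart A p y in \<omega> q (from_chart A p q v) (from_chart A p q w))"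

definition bivector_in_chart ::
  "('m, 'e::real_normed_vector) atlas \<Rightarrow> ('m \<Rightarrow> 'e covector \<Rightarrow> 'e covector \<Rightarrow> real)
     \<Rightarrow> 'm \<Rightarrow> 'e \<Rightarrow> 'e covector \<Rightarrow> 'e covector \<Rightarrow> real" where
  "bivector_in_chart A \<pi> p y a b =
     (let q = ichart A p y; T = Blinfun (to_chart A p q) in \<pi> q (a o\<^sub>L T) (b o\<^sub>L T))"

definition smooth_fun :: "('m, 'e::real_normed_vector) atlas \<Rightarrow> ('m \<Rightarrow> real) \<Rightarrow> bool" where
  "smooth_fun A f \<longleftrightarrow> (\<forall>p. smooth_on (chart A p ` cdom A p) (f \<circ> ichart A p))"

text \<open>Smooth vector fields along a map \<open>f\<close>, i.e. sections of the pullback of the tangent bundle.\<close>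

definition smooth_along ::
  "('m, 'e::real_normed_vector) atlas \<Rightarrow> ('n, 'f::real_normed_vector) atlas \<Rightarrow> ('m \<Rightarrow> 'n)
     \<Rightarrow> ('m \<Rightarrow> 'f) \<Rightarrow> bool" where
  "smooth_along A B f X \<longleftrightarrow>
     (\<forall>p q. smooth_on (chart A p ` (cdom A p \<inter> f -` cdom B q))
        (\<lambda>y. let x = ichart A p y in to_chart B q (f x) (X x)))"

definition one_form :: "('m, 'e::real_normed_vector) atlas \<Rightarrow> ('m \<Rightarrow> 'e covector) \<Rightarrow> bool" where
  "one_form A \<alpha> \<longleftrightarrow> (\<forall>p v. smooth_on (chart A p ` cdom A p) (\<lambda>y. form1_in_chart A \<alpha> p y v))"

definition two_form ::
  "('m, 'e::real_normed_vector) atlas \<Rightarrow> ('m \<Rightarrow> 'e \<Rightarrow> 'e \<Rightarrow> real) \<Rightarrow> bool" where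
  "two_form A \<omega> \<longleftrightarrow>
     (\<forall>p. bounded_bilinear (\<omega> p) \<and> (\<forall>v. \<omega> p v v = 0)) \<and>
     (\<forall>p v w. smooth_on (chart A p ` cdom A p) (\<lambda>y. form2_in_chart A \<omega> p y v w))"

definition bivector_field ::
  "('m, 'e::real_normed_vector) atlas \<Rightarrow> ('m \<Rightarrow> 'e covector \<Rightarrow> 'e covector \<Rightarrow> real) \<Rightarrow> bool" where
  "bivector_field A \<pi> \<longleftrightarrow>
     (\<forall>p. bounded_bilinear (\<pi> p) \<and> (\<forall>a. \<pi> p a a = 0)) \<and>
     (\<forall>p a b. smooth_on (chart A p ` cdom A p) (\<lambda>y. bivector_in_chart A \<pi> p y a b))"

section \<open>Cartan calculus\<close>

text \<open>All operations are given at \<open>p\<close> by their coordinate expression in the chart \<open>A p\<close>, in which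
  the components of a vector or covector at \<open>p\<close> are the vector or covector itself.\<close>

definition d_fun :: "('m, 'e::real_normed_vector) atlas \<Rightarrow> ('m \<Rightarrow> real) \<Rightarrow> 'm \<Rightarrow> 'e covector" where
  "d_fun A f p = Blinfun (frechet_derivative (f \<circ> ichart A p) (at (chart A p p)))"

text \<open>\<open>[X, Y]\<close> has components \<open>X\<^sup>j \<partial>\<^sub>j Y\<^sup>i - Y\<^sup>j \<partial>\<^sub>j X\<^sup>i\<close>.\<close>

definition lie_bracket ::
  "('m, 'e::real_normed_vector) atlas \<Rightarrow> ('m \<Rightarrow> 'e) \<Rightarrow> ('m \<Rightarrow> 'e) \<Rightarrow> 'm \<Rightarrow> 'e" where
  "lie_bracket A X Y p =
     frechet_derivative (field_in_chart A Y p) (at (chart A p p)) (X p)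
     - frechet_derivative (field_in_chart A X p) (at (chart A p p)) (Y p)"

text \<open>The Lie derivative of \<open>\<beta>\<close> along \<open>X\<close> has components \<open>X\<^sup>j \<partial>\<^sub>j \<beta>\<^sub>i + \<beta>\<^sub>j \<partial>\<^sub>i X\<^sup>j\<close>.\<close>

definition lie_deriv ::
  "('m, 'e::real_normed_vector) atlas \<Rightarrow> ('m \<Rightarrow> 'e) \<Rightarrow> ('m \<Rightarrow> 'e covector) \<Rightarrow> 'm \<Rightarrow> 'e covector" where
  "lie_deriv A X \<beta> p = Blinfun (\<lambda>v.
     frechet_derivative (\<lambda>y. form1_in_chart A \<beta> p y v) (at (chart A p p)) (X p)
     + blinfun_apply (\<beta> p) (frechet_derivative (field_in_chart A X p) (at (chart A p p)) v))"

definition d_form2 ::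
  "('m, 'e::real_normed_vector) atlas \<Rightarrow> ('m \<Rightarrow> 'e \<Rightarrow> 'e \<Rightarrow> real) \<Rightarrow> 'm \<Rightarrow> 'e \<Rightarrow> 'e \<Rightarrow> 'e \<Rightarrow> real" where
  "d_form2 A \<omega> p u v w =
     frechet_derivative (\<lambda>y. form2_in_chart A \<omega> p y v w) (at (chart A p p)) u
     - frechet_derivative (\<lambda>y. form2_in_chart A \<omega> p y u w) (at (chart A p p)) v
     + frechet_derivative (\<lambda>y. form2_in_chart A \<omega> p y u v) (at (chart A p p)) w"

definition closed_form ::
  "('m, 'e::real_normed_vector) atlas \<Rightarrow> ('m \<Rightarrow> 'e \<Rightarrow> 'e \<Rightarrow> real) \<Rightarrow> bool" where
  "closed_form A \<omega> \<longleftrightarrow> (\<forall>p u v w. d_form2 A \<omega> p u v w = 0)"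

definition pullback2 ::
  "('m, 'e::real_normed_vector) atlas \<Rightarrow> ('n, 'f::real_normed_vector) atlas \<Rightarrow> ('m \<Rightarrow> 'n)
     \<Rightarrow> ('n \<Rightarrow> 'f \<Rightarrow> 'f \<Rightarrow> real) \<Rightarrow> 'm \<Rightarrow> 'e \<Rightarrow> 'e \<Rightarrow> real" where
  "pullback2 A B f \<omega> p v w = \<omega> (f p) (tangent_map A B f p v) (tangent_map A B f p w)"

definition nondegenerate :: "('m \<Rightarrow> 'e::real_vector \<Rightarrow> 'e \<Rightarrow> real) \<Rightarrow> bool" where
  "nondegenerate \<omega> \<longleftrightarrow> (\<forall>p v. (\<forall>w. \<omega> p v w = 0) \<longrightarrow> v = 0)"

section \<open>Vector bundles, Lie algebroids and IM-2-forms\<close>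

text \<open>A (sub)bundle is described by its fibres, subspaces of a fixed vector space, and its smooth
  global sections. A fibrewise linear map over the identity is smooth iff it preserves smooth
  sections, since the base is Hausdorff and second countable. The records only carry the structure
  maps; brackets are only meaningful on smooth sections.\<close>

record ('m, 'v) vbundle =
  fibre :: "'m \<Rightarrow> 'v set"
  sections :: "('m \<Rightarrow> 'v) set"

record ('m, 'v, 'e) lie_algebroid = "('m, 'v) vbundle" +
  anchor :: "'m \<Rightarrow> 'v \<Rightarrow> 'e"
  bracket :: "('m \<Rightarrow> 'v) \<Rightarrow> ('m \<Rightarrow> 'v) \<Rightarrow> 'm \<Rightarrow> 'v"

definition bundle_map ::
  "('m, 'v::real_vector, 'x) vbundle_scheme \<Rightarrow> ('m, 'w::real_vector, 'y) vbundle_scheme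
     \<Rightarrow> ('m \<Rightarrow> 'v \<Rightarrow> 'w) \<Rightarrow> bool" where
  "bundle_map P Q \<Phi> \<longleftrightarrow>
     (\<forall>x. \<forall>a\<in>fibre P x. \<Phi> x a \<in> fibre Q x) \<and>
     (\<forall>x. \<forall>a\<in>fibre P x. \<forall>b\<in>fibre P x. \<Phi> x (a + b) = \<Phi> x a + \<Phi> x b) \<and>
     (\<forall>x r. \<forall>a\<in>fibre P x. \<Phi> x (r *\<^sub>R a) = r *\<^sub>R \<Phi> x a) \<and>
     (\<forall>a\<in>sections P. (\<lambda>x. \<Phi> x (a x)) \<in> sections Q)"

definition bundle_iso ::
  "('m, 'v::real_vector, 'x) vbundle_scheme \<Rightarrow> ('m, 'w::real_vector, 'y) vbundle_scheme
     \<Rightarrow> ('m \<Rightarrow> 'v \<Rightarrow> 'w) \<Rightarrow> bool" where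
  "bundle_iso P Q \<Phi> \<longleftrightarrow> bundle_map P Q \<Phi> \<and>
     (\<forall>x. bij_betw (\<Phi> x) (fibre P x) (fibre Q x)) \<and>
     bundle_map Q P (\<lambda>x. inv_into (fibre P x) (\<Phi> x))"

definition algebroid_iso ::
  "('m, 'v::real_vector, 'e) lie_algebroid \<Rightarrow> ('m, 'w::real_vector, 'e) lie_algebroid
     \<Rightarrow> ('m \<Rightarrow> 'v \<Rightarrow> 'w) \<Rightarrow> bool" where
  "algebroid_iso P Q \<Phi> \<longleftrightarrow> bundle_iso P Q \<Phi> \<and>
     (\<forall>x. \<forall>a\<in>fibre P x. anchor Q x (\<Phi> x a) = anchor P x a) \<and>
     (\<forall>a\<in>sections P. \<forall>b\<in>sections P. \<forall>x.
        \<Phi> x (bracket P a b x) = bracket Q (\<lambda>x. \<Phi> x (a x)) (\<lambda>x. \<Phi> x (b x)) x)"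

definition cotangent_bundle ::
  "('m, 'e::real_normed_vector) atlas \<Rightarrow> ('m, 'e covector) vbundle" where
  "cotangent_bundle M = \<lparr>fibre = (\<lambda>_. UNIV), sections = {\<alpha>. one_form M \<alpha>}\<rparr>"

definition IM_2_form ::
  "('m, 'e::real_normed_vector) atlas \<Rightarrow> ('m, 'v::real_vector, 'e) lie_algebroid
     \<Rightarrow> ('m \<Rightarrow> 'v \<Rightarrow> 'e covector) \<Rightarrow> bool" where
  "IM_2_form M P \<sigma> \<longleftrightarrow> bundle_map P (cotangent_bundle M) \<sigma> \<and>
     (\<forall>a\<in>sections P. \<forall>b\<in>sections P. \<forall>x.
        blinfun_apply (\<sigma> x (a x)) (anchor P x (b x)) =
        - blinfun_apply (\<sigma> x (b x)) (anchor P x (a x))) \<and>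
     (\<forall>a\<in>sections P. \<forall>b\<in>sections P. \<forall>x.
        \<sigma> x (bracket P a b x) =
          lie_deriv M (\<lambda>x. anchor P x (a x)) (\<lambda>x. \<sigma> x (b x)) x
          - lie_deriv M (\<lambda>x. anchor P x (b x)) (\<lambda>x. \<sigma> x (a x)) x
          + d_fun M (\<lambda>x. blinfun_apply (\<sigma> x (a x)) (anchor P x (b x))) x)"

section \<open>Poisson structures and gauge transformations\<close>

definition poisson ::
  "('m, 'e::real_normed_vector) atlas \<Rightarrow> ('m \<Rightarrow> 'e covector \<Rightarrow> 'e covector \<Rightarrow> real) \<Rightarrow> bool" where
  "poisson M \<pi> \<longleftrightarrow> bivector_field M \<pi> \<and>
     (let br = (\<lambda>f g x. \<pi> x (d_fun M f x) (d_fun M g x)) in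
      \<forall>f g h. smooth_fun M f \<and> smooth_fun M g \<and> smooth_fun M h \<longrightarrow>
        (\<forall>x. br f (br g h) x + br g (br h f) x + br h (br f g) x = 0))"

definition sharp ::
  "('m \<Rightarrow> 'e::real_normed_vector covector \<Rightarrow> 'e covector \<Rightarrow> real) \<Rightarrow> 'm \<Rightarrow> 'e covector \<Rightarrow> 'e" where
  "sharp \<pi> x \<alpha> = (THE X. \<forall>\<beta>. blinfun_apply \<beta> X = \<pi> x \<alpha> \<beta>)"

definition form_sharp ::
  "('m \<Rightarrow> 'e::real_normed_vector \<Rightarrow> 'e \<Rightarrow> real) \<Rightarrow> 'm \<Rightarrow> 'e \<Rightarrow> 'e covector" where
  "form_sharp B x X = Blinfun (B x X)"

definition cotangent_algebroid ::
  "('m, 'e::real_normed_vector) atlas \<Rightarrow> ('m \<Rightarrow> 'e covector \<Rightarrow> 'e covector \<Rightarrow> real)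
     \<Rightarrow> ('m, 'e covector, 'e) lie_algebroid" where
  "cotangent_algebroid M \<pi> =
     \<lparr>fibre = (\<lambda>_. UNIV), sections = {\<alpha>. one_form M \<alpha>},
      anchor = sharp \<pi>,
      bracket = (\<lambda>\<alpha> \<beta> x.
        lie_deriv M (\<lambda>x. sharp \<pi> x (\<alpha> x)) \<beta> x - lie_deriv M (\<lambda>x. sharp \<pi> x (\<beta> x)) \<alpha> x
        - d_fun M (\<lambda>x. \<pi> x (\<alpha> x) (\<beta> x)) x)\<rparr>"

text \<open>Elements \<open>(x, X, \<alpha>)\<close> of \<open>TM \<oplus> T\<^sup>*M\<close> carry their base point \<open>x\<close>.\<close>

definition poisson_graph ::
  "('m \<Rightarrow> 'e::real_normed_vector covector \<Rightarrow> 'e covector \<Rightarrow> real) \<Rightarrow> ('m \<times> 'e \<times> 'e covector) set" where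
  "poisson_graph \<pi> = {(x, sharp \<pi> x \<alpha>, \<alpha>) | x \<alpha>. True}"

definition gauge_transf ::
  "('m \<Rightarrow> 'e::real_normed_vector \<Rightarrow> 'e \<Rightarrow> real) \<Rightarrow> 'm \<times> 'e \<times> 'e covector \<Rightarrow> 'm \<times> 'e \<times> 'e covector" where
  "gauge_transf B = (\<lambda>(x, X, \<alpha>). (x, X, \<alpha> + form_sharp B x X))"

definition admissible ::
  "('m, 'e::real_normed_vector) atlas \<Rightarrow> ('m \<Rightarrow> 'e covector \<Rightarrow> 'e covector \<Rightarrow> real)
     \<Rightarrow> ('m \<Rightarrow> 'e \<Rightarrow> 'e \<Rightarrow> real) \<Rightarrow> bool" where
  "admissible M \<pi> B \<longleftrightarrow> two_form M B \<and> closed_form M B \<and>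
     (\<exists>\<pi>'. poisson M \<pi>' \<and> gauge_transf B ` poisson_graph \<pi> = poisson_graph \<pi>')"

definition gauge_map ::
  "('m \<Rightarrow> 'e::real_normed_vector covector \<Rightarrow> 'e covector \<Rightarrow> real) \<Rightarrow> ('m \<Rightarrow> 'e \<Rightarrow> 'e \<Rightarrow> real)
     \<Rightarrow> 'm \<Rightarrow> 'e covector \<Rightarrow> 'e covector" where
  "gauge_map \<pi> B x \<alpha> = \<alpha> + form_sharp B x (sharp \<pi> x \<alpha>)"

section \<open>Lie groupoids\<close>

record ('g, 'm) groupoid =
  src :: "'g \<Rightarrow> 'm"
  tgt :: "'g \<Rightarrow> 'm"
  mult :: "'g \<Rightarrow> 'g \<Rightarrow> 'g"
  ident :: "'m \<Rightarrow> 'g"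
  ginv :: "'g \<Rightarrow> 'g"

definition composable :: "('g, 'm) groupoid \<Rightarrow> ('g \<times> 'g) set" where
  "composable G = {(g, h). tgt G h = src G g}"

definition groupoid :: "('g, 'm) groupoid \<Rightarrow> bool" where
  "groupoid G \<longleftrightarrow>
     (\<forall>x. src G (ident G x) = x \<and> tgt G (ident G x) = x) \<and>
     (\<forall>(g, h) \<in> composable G. src G (mult G g h) = src G h \<and> tgt G (mult G g h) = tgt G g) \<and>
     (\<forall>g h k. (g, h) \<in> composable G \<and> (h, k) \<in> composable G \<longrightarrow>
        mult G (mult G g h) k = mult G g (mult G h k)) \<and>
     (\<forall>g. mult G g (ident G (src G g)) = g \<and> mult G (ident G (tgt G g)) g = g) \<and>
     (\<forall>g. src G (ginv G g) = tgt G g \<and> tgt G (ginv G g) = src G g \<and>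
        mult G g (ginv G g) = ident G (tgt G g) \<and> mult G (ginv G g) g = ident G (src G g))"

text \<open>As usual, the manifold of arrows (with atlas \<open>C\<close>) is not required to be Hausdorff.
  Surjectivity of source and target follows from the existence of units.\<close>

definition lie_groupoid ::
  "('m::{t2_space,second_countable_topology}, 'e::real_inner) atlas
     \<Rightarrow> ('g::topological_space, 'f::real_inner) atlas \<Rightarrow> ('g, 'm) groupoid \<Rightarrow> bool" where
  "lie_groupoid M C G \<longleftrightarrow> smooth_atlas M \<and> smooth_atlas C \<and> groupoid G \<and>
     smooth_map_on C M UNIV (src G) \<and> (\<forall>g. surj (tangent_map C M (src G) g)) \<and>
     smooth_map_on C M UNIV (tgt G) \<and> (\<forall>g. surj (tangent_map C M (tgt G) g)) \<and>
     smooth_map_on M C UNIV (ident G) \<and>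
     smooth_map_on C C UNIV (ginv G) \<and>
     smooth_map_on_sub (prod_atlas C C) C (composable G) (\<lambda>(g, h). mult G g h)"

text \<open>Vectors tangent to \<open>composable G\<close> at \<open>(g, h)\<close> are the pairs \<open>(v, w)\<close> with \<open>Ts v = Tt w\<close>.\<close>

definition multiplicative_form ::
  "('m::topological_space, 'e::real_inner) atlas \<Rightarrow> ('g::topological_space, 'f::real_inner) atlas
     \<Rightarrow> ('g, 'm) groupoid \<Rightarrow> ('g \<Rightarrow> 'f \<Rightarrow> 'f \<Rightarrow> real) \<Rightarrow> bool" where
  "multiplicative_form M C G \<omega> \<longleftrightarrow>
     (\<forall>g h. (g, h) \<in> composable G \<longrightarrow>
       (let Ts = tangent_map C M (src G) g; Tt = tangent_map C M (tgt G) h;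
            Tm = tangent_map_on (prod_atlas C C) C (composable G) (\<lambda>(g, h). mult G g h) (g, h)
        in \<forall>v w v' w'. Ts v = Tt w \<and> Ts v' = Tt w' \<longrightarrow>
             \<omega> (mult G g h) (Tm (v, w)) (Tm (v', w')) = \<omega> g v v' + \<omega> h w w'))"

text \<open>The right-invariant vector field of a section \<open>a\<close> takes at \<open>g\<close> the value \<open>TR\<^sub>g (a (t g))\<close>, where
  right translation \<open>R\<^sub>g\<close> is defined on the source fibre over \<open>t g\<close>.\<close>

definition right_invariant ::
  "('g::topological_space, 'f::real_inner) atlas \<Rightarrow> ('g, 'm) groupoid \<Rightarrow> ('m \<Rightarrow> 'f) \<Rightarrow> 'g \<Rightarrow> 'f" where
  "right_invariant C G a g =
     tangent_map_on C C {h. src G h = tgt G g} (\<lambda>h. mult G h g) (ident G (tgt G g)) (a (tgt G g))"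

definition groupoid_algebroid ::
  "('m::topological_space, 'e::real_inner) atlas \<Rightarrow> ('g::topological_space, 'f::real_inner) atlas
     \<Rightarrow> ('g, 'm) groupoid \<Rightarrow> ('m, 'f, 'e) lie_algebroid" where
  "groupoid_algebroid M C G =
     (let ker = (\<lambda>x. {v. tangent_map C M (src G) (ident G x) v = 0}) in
      \<lparr>fibre = ker,
       sections = {a. smooth_along M C (ident G) a \<and> (\<forall>x. a x \<in> ker x)},
       anchor = (\<lambda>x. tangent_map C M (tgt G) (ident G x)),
       bracket = (\<lambda>a b x.
         lie_bracket C (right_invariant C G a) (right_invariant C G b) (ident G x))\<rparr>)"

text \<open>\<open>TM\<close> sits in \<open>TG\<close> along the units via the tangent map of the unit embedding.\<close>

definition form_to_IM ::
  "('m, 'e::real_normed_vector) atlas \<Rightarrow> ('g, 'f::real_normed_vector) atlas \<Rightarrow> ('g, 'm) groupoid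
     \<Rightarrow> ('g \<Rightarrow> 'f \<Rightarrow> 'f \<Rightarrow> real) \<Rightarrow> 'm \<Rightarrow> 'f \<Rightarrow> 'e covector" where
  "form_to_IM M C G \<omega> x a =
     Blinfun (\<lambda>v. \<omega> (ident G x) a (tangent_map M C (ident G) x v))"

definition symplectic_groupoid ::
  "('m::{t2_space,second_countable_topology}, 'e::real_inner) atlas
     \<Rightarrow> ('g::topological_space, 'f::real_inner) atlas \<Rightarrow> ('g, 'm) groupoid
     \<Rightarrow> ('g \<Rightarrow> 'f \<Rightarrow> 'f \<Rightarrow> real) \<Rightarrow> bool" where
  "symplectic_groupoid M C G \<omega> \<longleftrightarrow> lie_groupoid M C G \<and>
     two_form C \<omega> \<and> closed_form C \<omega> \<and> nondegenerate \<omega> \<and> multiplicative_form M C G \<omega>"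

definition integrates ::
  "('m::{t2_space,second_countable_topology}, 'e::real_inner) atlas
     \<Rightarrow> ('g::topological_space, 'f::real_inner) atlas \<Rightarrow> ('g, 'm) groupoid
     \<Rightarrow> ('g \<Rightarrow> 'f \<Rightarrow> 'f \<Rightarrow> real) \<Rightarrow> ('m \<Rightarrow> 'e covector \<Rightarrow> 'e covector \<Rightarrow> real) \<Rightarrow> bool" where
  "integrates M C G \<omega> \<pi> \<longleftrightarrow> symplectic_groupoid M C G \<omega> \<and>
     algebroid_iso (groupoid_algebroid M C G) (cotangent_algebroid M \<pi>) (form_to_IM M C G \<omega>)"

end

theory Submission
  imports Defs "HOL-Real_Asymp.Real_Asymp"
begin

text \<open>Multiplicativity and closedness of \<open>\<omega>\<^sub>G + t\<^sup>*B - s\<^sup>*B\<close> are formal: a pullback of a closed form is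
  closed, and \<open>t\<close>, \<open>s\<close> of a product are \<open>t\<close> of the first and \<open>s\<close> of the second factor. On \<open>ker Ts\<close> along the
  units its IM-form is \<open>\<sigma> + B\<^sup>\<sharp> \<circ> \<rho>\<close>, which is \<open>\<Phi>\<^sub>B \<circ> \<sigma>\<close> because \<open>\<sigma>\<close> preserves anchors.
  That \<open>\<Phi>\<^sub>B\<close> respects brackets reduces to \<open>[\<pi>\<^sup>\<sharp>\<alpha>, \<pi>\<^sup>\<sharp>\<beta>] = \<pi>\<^sup>\<sharp>[\<alpha>, \<beta>]\<close> and, for closed \<open>B\<close>, to Cartan's formula
  \<open>L\<^sub>X i\<^sub>Y B - L\<^sub>Y i\<^sub>X B + d(B(X, Y)) = i\<^bsub>[X, Y]\<^esub> B\<close>; its inverse is the gauge map of \<open>-B\<close> over \<open>\<pi>\<^sub>B\<close>.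
  For nondegeneracy at \<open>g\<close>, translates of vectors at the units represent every covector \<open>t\<^sup>*\<beta>\<close> and
  \<open>s\<^sup>*\<beta>\<close> through \<open>\<omega>\<^sub>G\<close>; hence if \<open>v\<close> is in the kernel, both \<open>u = Tt v\<close> and \<open>u = Ts v\<close> satisfy
  \<open>u = -\<pi>\<^sup>\<sharp> B\<^sup>\<sharp> u\<close>, so they vanish by injectivity of \<open>\<Phi>\<^sub>B\<close>, and then \<open>v = 0\<close>.\<close>

section \<open>Calculus in finite-dimensional spaces\<close>

text \<open>Multiplication lives only on the composable pairs, so its tangent map, like that of
  right translation on a source fibre, is the derivative of an extension picked by
  \<open>SOME\<close>. Every identity between such derivatives rests on one fact: maps that agree on
  a level set of a submersion have equal derivatives on vectors tangent to it. Instead of an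
  implicit function theorem, a Newton-type contraction provides, for each tangent vector, a curve
  inside the level set that is differentiable at its starting point. The second obstacle is
  algebraic. The new IM-form is known to be \<open>\<Phi>\<^sub>B \<circ> \<sigma>\<close> only on
  \<open>ker Ts\<close>, so respecting brackets requires that the bracket of two right-invariant
  fields lies in \<open>ker Ts\<close> at the units. That argument differentiates these fields,
  hence their smoothness near the units has to be established. Finally, the inverse of
  \<open>\<Phi>\<^sub>B\<close> is never computed by inverting a matrix: it is read off the equality
  of graphs, so its smoothness comes from that of \<open>\<pi>\<^sub>B\<close>.\<close>

text \<open>The model spaces are not of class \<open>euclidean_space\<close>, so finite dimension is carried as a
  hypothesis: a finite basis expansion with bounded coordinate functionals.\<close>

definition fin_dim :: "'a::real_normed_vector itself \<Rightarrow> bool" where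
  "fin_dim _ \<longleftrightarrow> (\<exists>n (b :: nat \<Rightarrow> 'a) c. (\<forall>i. bounded_linear (c i)) \<and> (\<forall>x. x = (\<Sum>i<n. c i x *\<^sub>R b i)))"

lemma fin_dimE:
  assumes "fin_dim TYPE('a::real_normed_vector)"
  obtains n :: nat and b :: "nat \<Rightarrow> 'a::real_normed_vector" and c :: "nat \<Rightarrow> 'a \<Rightarrow> real"
  where "\<And>i. bounded_linear (c i)" "\<And>x. x = (\<Sum>i<n. c i x *\<^sub>R b i)"
  using assms unfolding fin_dim_def by blast

lemma fin_dim_inner:
  fixes E :: "'a::real_inner set"
  assumes "finite E" "span E = UNIV"
  shows "fin_dim TYPE('a)"
proof -
  obtain C where C: "finite C" "span C = (UNIV::'a set)" "pairwise orthogonal C"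
    using basis_orthogonal[OF assms(1)] assms(2) by metis
  \<comment> \<open>Orthogonal expansion along \<open>C\<close>. If \<open>C\<close> contains the
    zero vector, its term is a multiple of zero and does no harm.\<close>
  have exp: "x = (\<Sum>e\<in>C. (x \<bullet> e / (e \<bullet> e)) *\<^sub>R e)" for x
  proof -
    have "x \<in> span C" using C by simp
    then show ?thesis
    proof (induction rule: span_induct_alt)
      case base
      then show ?case by simp
    next
      case (step r x y)
      have "(\<Sum>e\<in>C. (x \<bullet> e / (e \<bullet> e)) *\<^sub>R e) = (\<Sum>e\<in>C. if e = x then x else 0)"
        using C(3) step(1) by (intro sum.cong) (auto simp: pairwise_def orthogonal_def)
      also have "\<dots> = x" using C(1) step(1) by (simp add: sum.delta)
      finally have "x = (\<Sum>e\<in>C. (x \<bullet> e / (e \<bullet> e)) *\<^sub>R e)" by (rule sym)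
      then have "r *\<^sub>R x + y = r *\<^sub>R (\<Sum>e\<in>C. (x \<bullet> e / (e \<bullet> e)) *\<^sub>R e) + (\<Sum>e\<in>C. (y \<bullet> e / (e \<bullet> e)) *\<^sub>R e)"
        using step(2) by metis
      also have "\<dots> = (\<Sum>e\<in>C. ((r *\<^sub>R x + y) \<bullet> e / (e \<bullet> e)) *\<^sub>R e)"
        by (simp add: sum.distrib[symmetric] inner_simps add_divide_distrib scaleR_sum_right scaleR_add_left)
      finally show ?case .
    qed
  qed
  obtain h where h: "bij_betw h {..<card C} C"
    using ex_bij_betw_nat_finite[OF C(1)] by (auto simp: lessThan_atLeast0)
  have "x = (\<Sum>i<card C. (x \<bullet> h i / (h i \<bullet> h i)) *\<^sub>R h i)" for x
    using exp[of x] sum.reindex_bij_betw[OF h, of "\<lambda>e. (x \<bullet> e / (e \<bullet> e)) *\<^sub>R e"] by (rule trans[OF _ sym])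
  moreover have "bounded_linear (\<lambda>x. x \<bullet> h i / (h i \<bullet> h i))" for i
    by (simp add: bounded_linear_inner_left bounded_linear_compose[OF bounded_linear_divide])
  ultimately show ?thesis unfolding fin_dim_def
    by (intro exI[of _ "card C"] exI[of _ h] exI[of _ "\<lambda>i x. x \<bullet> h i / (h i \<bullet> h i)"] conjI allI)
qed

lemma linear_bounded_linear:
  fixes f :: "'a::real_normed_vector \<Rightarrow> 'b::real_normed_vector"
  assumes "fin_dim TYPE('a)" "linear f"
  shows "bounded_linear f"
proof -
  obtain n :: nat and b c where c: "\<And>i. bounded_linear (c i)" "\<And>x::'a. x = (\<Sum>i<n. c i x *\<^sub>R b i)"
    by (rule fin_dimE[OF assms(1)]) (rule that)
  have "f = (\<lambda>x. \<Sum>i<n. c i x *\<^sub>R f (b i))"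
  proof
    fix x
    show "f x = (\<Sum>i<n. c i x *\<^sub>R f (b i))"
      by (subst c(2)[of x]) (simp add: linear_sum[OF assms(2)] linear_scale[OF assms(2)])
  qed
  moreover have "bounded_linear (\<lambda>x. \<Sum>i<n. c i x *\<^sub>R f (b i))"
    by (intro bounded_linear_sum bounded_linear_scaleR_const c)
  ultimately show ?thesis by simp
qed

text \<open>The coordinates of a covector are its values on the \<open>b i\<close>, and the
  \<open>c i\<close> act as dual frame; this follows by applying \<alpha> to the expansion of a
  vector, even when the \<open>b i\<close> are dependent.\<close>

lemma covector_expansion:
  fixes \<alpha> :: "'a::real_normed_vector covector"
  assumes "\<And>i. bounded_linear (c i)" "\<And>x. x = (\<Sum>i<n. c i x *\<^sub>R b i)"
  shows "\<alpha> = (\<Sum>i<n. blinfun_apply \<alpha> (b i) *\<^sub>R Blinfun (c i))"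
proof (rule blinfun_eqI)
  fix x
  have "blinfun_apply \<alpha> x = (\<Sum>i<n. c i x * blinfun_apply \<alpha> (b i))"
    by (subst assms(2)[of x]) (simp add: blinfun.bilinear_simps)
  then show "blinfun_apply \<alpha> x = blinfun_apply (\<Sum>i<n. blinfun_apply \<alpha> (b i) *\<^sub>R Blinfun (c i)) x"
    by (simp add: blinfun.bilinear_simps bounded_linear_Blinfun_apply assms(1) mult.commute)
qed

lemma fin_dim_covector:
  assumes "fin_dim TYPE('a::real_normed_vector)"
  shows "fin_dim TYPE('a::real_normed_vector covector)"
proof -
  obtain n :: nat and b c where c: "\<And>i. bounded_linear (c i)" "\<And>x::'a. x = (\<Sum>i<n. c i x *\<^sub>R b i)"
    by (rule fin_dimE[OF assms(1)]) (rule that)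
  have "bounded_linear (\<lambda>\<alpha>. blinfun_apply \<alpha> (b i))" for i
    by (rule blinfun.bounded_linear_left)
  with covector_expansion[OF c] show ?thesis unfolding fin_dim_def
    by (intro exI[of _ n] exI[of _ "\<lambda>i. Blinfun (c i)"] exI[of _ "\<lambda>i \<alpha>. blinfun_apply \<alpha> (b i)"]) blast
qed

text \<open>Coordinates of a Cauchy sequence are Cauchy in the reals, and their limits reassemble.
  The balls serve as the complete metric spaces on which Banach's fixed point theorem is
  applied.\<close>

lemma fin_dim_complete_cball:
  fixes a :: "'a::real_normed_vector"
  assumes "fin_dim TYPE('a)"
  shows "complete (cball a r)"
proof (rule completeI)
  obtain n :: nat and b c where c: "\<And>i. bounded_linear (c i)" "\<And>x::'a. x = (\<Sum>i<n. c i x *\<^sub>R b i)"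
    by (rule fin_dimE[OF assms(1)]) (rule that)
  fix X :: "nat \<Rightarrow> 'a" assume X: "\<forall>n. X n \<in> cball a r" "Cauchy X"
  have "convergent (\<lambda>k. c i (X k))" for i
    by (intro real_Cauchy_convergent bounded_linear.Cauchy[OF c(1)] X)
  then obtain l where l: "\<And>i. (\<lambda>k. c i (X k)) \<longlonglongrightarrow> l i"
    unfolding convergent_def by metis
  have "(\<lambda>k. \<Sum>i<n. c i (X k) *\<^sub>R b i) \<longlonglongrightarrow> (\<Sum>i<n. l i *\<^sub>R b i)"
    by (intro tendsto_intros l)
  then have "X \<longlonglongrightarrow> (\<Sum>i<n. l i *\<^sub>R b i)" by (simp add: c(2)[symmetric])
  moreover have "(\<Sum>i<n. l i *\<^sub>R b i) \<in> cball a r"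
    using closed_sequentially[OF closed_cball] X(1) calculation by blast
  ultimately show "\<exists>l\<in>cball a r. X \<longlonglongrightarrow> l" by blast
qed

lemma compact_box_image:
  fixes b :: "nat \<Rightarrow> 'a::real_normed_vector"
  shows "compact {\<Sum>i<n. t i *\<^sub>R b i |t. \<forall>i. \<bar>t i\<bar> \<le> (R::real)}"
\<comment> \<open>The bound is imposed on every index, so a negative \<open>R\<close> gives the
  empty set even for \<open>n = 0\<close>; otherwise that set is \<open>{0}\<close>, the base of the
  induction.\<close>
proof (cases "R < 0")
  case True
  have "{\<Sum>i<n. t i *\<^sub>R b i |t. \<forall>i. \<bar>t i\<bar> \<le> R} = {}"
    using True by (auto dest!: spec[where x=0])
  then show ?thesis by (simp only: compact_empty)
next
  case False
  show ?thesis
  proof (induction n)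
    case 0
    have "{\<Sum>i<0. t i *\<^sub>R b i |t. \<forall>i. \<bar>t i\<bar> \<le> R} = {0}"
      using False by (auto intro!: exI[of _ "\<lambda>_. 0"])
    then show ?case by (simp only: compact_sing)
  next
    case (Suc n)
    let ?K = "{\<Sum>i<n. t i *\<^sub>R b i |t. \<forall>i. \<bar>t i\<bar> \<le> R}"
    have "{\<Sum>i<Suc n. t i *\<^sub>R b i |t. \<forall>i. \<bar>t i\<bar> \<le> R} = (\<lambda>(s, x). x + s *\<^sub>R b n) ` ({-R..R} \<times> ?K)"
    proof (intro equalityI subsetI)
      fix x assume "x \<in> {\<Sum>i<Suc n. t i *\<^sub>R b i |t. \<forall>i. \<bar>t i\<bar> \<le> R}"
      then obtain t where t: "x = (\<Sum>i<Suc n. t i *\<^sub>R b i)" "\<And>i. \<bar>t i\<bar> \<le> R" by blast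
      have "t n \<in> {-R..R}" using t(2)[of n] by auto
      then show "x \<in> (\<lambda>(s, x). x + s *\<^sub>R b n) ` ({-R..R} \<times> ?K)"
        using t by (intro image_eqI[where x="(t n, \<Sum>i<n. t i *\<^sub>R b i)"]) auto
    next
      fix x assume "x \<in> (\<lambda>(s, x). x + s *\<^sub>R b n) ` ({-R..R} \<times> ?K)"
      then obtain s t where t: "x = (\<Sum>i<n. t i *\<^sub>R b i) + s *\<^sub>R b n" "\<And>i. \<bar>t i\<bar> \<le> R" "\<bar>s\<bar> \<le> R" by auto
      then show "x \<in> {\<Sum>i<Suc n. t i *\<^sub>R b i |t. \<forall>i. \<bar>t i\<bar> \<le> R}"
        by (auto intro!: exI[of _ "\<lambda>i. if i = n then s else t i"] sum.cong)
    qed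
    moreover have "compact ((\<lambda>(s, x). x + s *\<^sub>R b n) ` ({-R..R} \<times> ?K))"
      by (intro compact_continuous_image compact_Times Suc compact_Icc)
         (auto simp: split_def intro!: continuous_intros)
    ultimately show ?case by simp
  qed
qed

text \<open>The ball is a closed subset of the compact set of combinations with bounded coordinates.
  This stands in for the Heine-Borel property and later gives functions with closed support.\<close>

lemma fin_dim_compact_cball:
  fixes a :: "'a::real_normed_vector"
  assumes "fin_dim TYPE('a)"
  shows "compact (cball a r)"
proof -
  obtain n :: nat and b c where c: "\<And>i. bounded_linear (c i)" "\<And>x::'a. x = (\<Sum>i<n. c i x *\<^sub>R b i)"
    by (rule fin_dimE[OF assms(1)]) (rule that)
  obtain K where K: "\<And>i x. \<bar>c i x\<bar> \<le> norm x * K i" 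
    using bounded_linear.bounded[OF c(1)] unfolding real_norm_def by metis
  define R where "R = (\<Sum>i<n. (norm a + \<bar>r\<bar>) * \<bar>K i\<bar>)"
  have "cball a r \<subseteq> {\<Sum>i<n. t i *\<^sub>R b i |t. \<forall>i. \<bar>t i\<bar> \<le> R}"
  proof
    fix x assume x: "x \<in> cball a r"
    have "norm x \<le> norm a + norm (x - a)" by (metis norm_triangle_sub add.commute)
    then have nx: "norm x \<le> norm a + \<bar>r\<bar>" using x by (auto simp: dist_norm norm_minus_commute)
    have "\<bar>c i x\<bar> \<le> R" if "i < n" for i
    proof -
      have "\<bar>c i x\<bar> \<le> norm x * \<bar>K i\<bar>"
        by (rule order_trans[OF K]) (simp add: mult_left_mono)
      also have "\<dots> \<le> (norm a + \<bar>r\<bar>) * \<bar>K i\<bar>" by (simp add: mult_right_mono nx)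
      also have "\<dots> \<le> R" unfolding R_def using that
        by (intro member_le_sum) auto
      finally show ?thesis .
    qed
    moreover have "0 \<le> R" unfolding R_def by (intro sum_nonneg) auto
    \<comment> \<open>The box constrains every index, so the witness is padded by 0 from
      \<open>n\<close> on.\<close>
    ultimately show "x \<in> {\<Sum>i<n. t i *\<^sub>R b i |t. \<forall>i. \<bar>t i\<bar> \<le> R}"
      by (intro CollectI exI[of _ "\<lambda>i. if i < n then c i x else 0"]) (simp add: c(2)[symmetric])
  qed
  then have "cball a r = {\<Sum>i<n. t i *\<^sub>R b i |t. \<forall>i. \<bar>t i\<bar> \<le> R} \<inter> cball a r" by blast
  then show ?thesis
    by (rule ssubst) (rule compact_Int_closed[OF compact_box_image closed_cball])
qed

section \<open>Closure properties of C^k and smooth maps\<close>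

lemma Ck_on_cong:
  assumes "open S" "\<And>x. x \<in> S \<Longrightarrow> f x = g x" "Ck_on k S f"
  shows "Ck_on k S g"
  using assms(2,3)
proof (induction k arbitrary: f g)
  case 0
  then show ?case using continuous_on_cong[of S S f g] by simp
next
  case (Suc k)
  have d: "(g has_derivative frechet_derivative f (at x)) (at x)" if "x \<in> S" for x
    using Suc.prems that assms(1)
    by (intro has_derivative_transform_within_open[of f _ x UNIV S g]) (auto simp: frechet_derivative_works)
  then have e: "frechet_derivative f (at x) = frechet_derivative g (at x)" if "x \<in> S" for x
    using that frechet_derivative_at by blast
  have "g differentiable at x" if "x \<in> S" for x
    using d[OF that] by (auto simp: differentiable_def)
  moreover have "Ck_on k S (\<lambda>x. frechet_derivative g (at x) v)" for v
    by (rule Suc.IH[where f="\<lambda>x. frechet_derivative f (at x) v"]) (use Suc.prems(2) e in simp_all)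
  ultimately show ?case by simp
qed

lemma Ck_on_subset: "Ck_on k S f \<Longrightarrow> T \<subseteq> S \<Longrightarrow> Ck_on k T f"
  by (induction k arbitrary: f) (auto intro: continuous_on_subset)

lemma Ck_on_SucD: "Ck_on (Suc k) S f \<Longrightarrow> Ck_on k S f"
proof (induction k arbitrary: f)
  case 0
  then show ?case by (auto intro!: continuous_at_imp_continuous_on differentiable_imp_continuous_within)
next
  case (Suc k)
  then show ?case by (metis Ck_on.simps(2))
qed

lemma Ck_on_local:
  assumes "\<And>x. x \<in> S \<Longrightarrow> \<exists>T. open T \<and> x \<in> T \<and> Ck_on k T f"
  shows "Ck_on k S f"
  using assms
proof (induction k arbitrary: f)
  case 0
  have "isCont f x" if "x \<in> S" for x
    using 0[OF that] by (auto simp: continuous_on_eq_continuous_at)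
  then show ?case by (simp add: continuous_at_imp_continuous_on)
next
  case (Suc k)
  have "f differentiable at x" if "x \<in> S" for x
    using Suc.prems[OF that] by auto
  moreover have "Ck_on k S (\<lambda>x. frechet_derivative f (at x) v)" for v
    by (rule Suc.IH) (use Suc.prems in fastforce)
  ultimately show ?case by simp
qed

lemma Ck_on_const: "Ck_on k S (\<lambda>x. c)"
  by (induction k arbitrary: c) auto

lemma Ck_on_ident: "Ck_on k S (\<lambda>x. x)"
  by (cases k) (auto simp: Ck_on_const)

lemma Ck_on_bounded_linear:
  assumes L: "bounded_linear L" and S: "open S" and "Ck_on k S f"
  shows "Ck_on k S (\<lambda>x. L (f x))"
  using assms(3)
proof (induction k arbitrary: f)
  case 0
  then show ?case by (simp add: bounded_linear.continuous_on[OF L])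
next
  case (Suc k)
  have d: "((\<lambda>x. L (f x)) has_derivative (\<lambda>v. L (frechet_derivative f (at x) v))) (at x)" if "x \<in> S" for x
    using Suc.prems that by (intro bounded_linear.has_derivative[OF L]) (auto simp: frechet_derivative_works)
  have e: "frechet_derivative (\<lambda>x. L (f x)) (at x) = (\<lambda>v. L (frechet_derivative f (at x) v))" if "x \<in> S" for x
    using frechet_derivative_at[OF d[OF that]] by (rule sym)
  have "Ck_on k S (\<lambda>x. frechet_derivative (\<lambda>x. L (f x)) (at x) v)" for v
    by (rule Ck_on_cong[OF S _ Suc.IH[of "\<lambda>x. frechet_derivative f (at x) v"]]) (use e Suc.prems in auto)
  then show ?case using d by (auto simp: differentiable_def)
qed

lemma Ck_on_add:
  assumes S: "open S" and "Ck_on k S f" "Ck_on k S g"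
  shows "Ck_on k S (\<lambda>x. f x + g x)"
  using assms(2,3)
proof (induction k arbitrary: f g)
  case 0
  then show ?case by (simp add: continuous_on_add)
next
  case (Suc k)
  have d: "((\<lambda>x. f x + g x) has_derivative (\<lambda>v. frechet_derivative f (at x) v + frechet_derivative g (at x) v)) (at x)" if "x \<in> S" for x
    using Suc.prems that by (intro has_derivative_add) (auto simp: frechet_derivative_works)
  have e: "frechet_derivative (\<lambda>x. f x + g x) (at x) = (\<lambda>v. frechet_derivative f (at x) v + frechet_derivative g (at x) v)" if "x \<in> S" for x
    using frechet_derivative_at[OF d[OF that]] by (rule sym)
  have "Ck_on k S (\<lambda>x. frechet_derivative (\<lambda>x. f x + g x) (at x) v)" for v
    by (rule Ck_on_cong[OF S _ Suc.IH[of "\<lambda>x. frechet_derivative f (at x) v" "\<lambda>x. frechet_derivative g (at x) v"]])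
       (use e Suc.prems in auto)
  then show ?case using d by (auto simp: differentiable_def)
qed

lemma Ck_on_bilinear:
  assumes h: "bounded_bilinear h" and S: "open S" and "Ck_on k S f" "Ck_on k S g"
  shows "Ck_on k S (\<lambda>x. h (f x) (g x))"
  using assms(3,4)
proof (induction k arbitrary: f g)
  case 0
  then show ?case by (simp add: bounded_bilinear.continuous_on[OF h])
next
  case (Suc k)
  have d: "((\<lambda>x. h (f x) (g x)) has_derivative (\<lambda>v. h (f x) (frechet_derivative g (at x) v) + h (frechet_derivative f (at x) v) (g x))) (at x)" if "x \<in> S" for x
    using Suc.prems that by (intro bounded_bilinear.FDERIV[OF h]) (auto simp: frechet_derivative_works)
  have e: "frechet_derivative (\<lambda>x. h (f x) (g x)) (at x) = (\<lambda>v. h (f x) (frechet_derivative g (at x) v) + h (frechet_derivative f (at x) v) (g x))" if "x \<in> S" for x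
    using frechet_derivative_at[OF d[OF that]] by (rule sym)
  have "Ck_on k S (\<lambda>x. h (f x) (frechet_derivative g (at x) v) + h (frechet_derivative f (at x) v) (g x))" for v
    by (intro Ck_on_add[OF S] Suc.IH) (use Suc.prems Ck_on_SucD in auto)
  then have "Ck_on k S (\<lambda>x. frechet_derivative (\<lambda>x. h (f x) (g x)) (at x) v)" for v
    by (rule Ck_on_cong[OF S, rotated]) (use e in auto)
  then show ?case using d by (auto simp: differentiable_def)
qed

lemma Ck_on_sum:
  assumes "open S" "\<And>i. i \<in> I \<Longrightarrow> Ck_on k S (f i)"
  shows "Ck_on k S (\<lambda>x. \<Sum>i\<in>I. f i x)"
  using assms(2) by (induction I rule: infinite_finite_induct) (auto intro: Ck_on_const Ck_on_add assms(1))

text \<open>In the chain rule the vector fed to the derivative of \<open>g\<close> varies with the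
  point, while \<open>Ck_on\<close> speaks of fixed directions. Expanding that vector in a basis of
  the middle space turns the derivative into a finite sum of products, to which the induction
  hypothesis applies.\<close>

lemma Ck_on_compose:
  fixes f :: "'a::real_normed_vector \<Rightarrow> 'b::real_normed_vector"
  assumes fd: "fin_dim TYPE('b)" and S: "open S" and T: "open T" and fT: "\<And>x. x \<in> S \<Longrightarrow> f x \<in> T"
    and "Ck_on k S f" "Ck_on k T g"
  shows "Ck_on k S (\<lambda>x. g (f x))"
proof -
  obtain n :: nat and b c where c: "\<And>i. bounded_linear (c i)" "\<And>x::'b. x = (\<Sum>i<n. c i x *\<^sub>R b i)"
    by (rule fin_dimE[OF fd]) (rule that)
  show ?thesis using assms(5,6)
  proof (induction k arbitrary: g)
    case 0
    then show ?case using continuous_on_compose2[of T g S f] fT by auto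
  next
    case (Suc k)
    have dg: "(g has_derivative frechet_derivative g (at (f x))) (at (f x))" if "x \<in> S" for x
      using Suc.prems fT[OF that] by (auto simp: frechet_derivative_works)
    have d: "((\<lambda>x. g (f x)) has_derivative (\<lambda>v. frechet_derivative g (at (f x)) (frechet_derivative f (at x) v))) (at x)" if "x \<in> S" for x
      using Suc.prems that by (intro has_derivative_compose[of f _ x UNIV g, OF _ dg[OF that]]) (auto simp: frechet_derivative_works)
    have e: "frechet_derivative (\<lambda>x. g (f x)) (at x) v = (\<Sum>i<n. c i (frechet_derivative f (at x) v) *\<^sub>R frechet_derivative g (at (f x)) (b i))" if "x \<in> S" for x v
    proof -
      have l: "linear (frechet_derivative g (at (f x)))" using dg[OF that] has_derivative_linear by blast
      have "frechet_derivative (\<lambda>x. g (f x)) (at x) v = frechet_derivative g (at (f x)) (frechet_derivative f (at x) v)"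
        by (simp add: frechet_derivative_at[OF d[OF that], symmetric])
      also have "\<dots> = (\<Sum>i<n. c i (frechet_derivative f (at x) v) *\<^sub>R frechet_derivative g (at (f x)) (b i))"
        by (subst c(2)[of "frechet_derivative f (at x) v"]) (simp add: linear_sum[OF l] linear_scale[OF l])
      finally show ?thesis .
    qed
    have "Ck_on k S (\<lambda>x. \<Sum>i<n. c i (frechet_derivative f (at x) v) *\<^sub>R frechet_derivative g (at (f x)) (b i))" for v
      using Suc.prems Ck_on_SucD[OF Suc.prems(1)]
      by (intro Ck_on_sum[OF S] Ck_on_bilinear[OF bounded_bilinear_scaleR S] Ck_on_bounded_linear[OF c(1) S] Suc.IH) auto
    then have "Ck_on k S (\<lambda>x. frechet_derivative (\<lambda>x. g (f x)) (at x) v)" for v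
      by (rule Ck_on_cong[OF S, rotated]) (use e in auto)
    then show ?case using d by (auto simp: differentiable_def)
  qed
qed

lemma smooth_on_cong: "open S \<Longrightarrow> (\<And>x. x \<in> S \<Longrightarrow> f x = g x) \<Longrightarrow> smooth_on S f \<Longrightarrow> smooth_on S g"
  unfolding smooth_on_def using Ck_on_cong by blast

lemma smooth_on_subset: "smooth_on S f \<Longrightarrow> T \<subseteq> S \<Longrightarrow> smooth_on T f"
  unfolding smooth_on_def using Ck_on_subset by blast

lemma smooth_on_local: "(\<And>x. x \<in> S \<Longrightarrow> \<exists>T. open T \<and> x \<in> T \<and> smooth_on T f) \<Longrightarrow> smooth_on S f"
  unfolding smooth_on_def using Ck_on_local by metis

lemma smooth_on_const: "smooth_on S (\<lambda>x. c)"
  by (simp add: smooth_on_def Ck_on_const)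

lemma smooth_on_ident: "smooth_on S (\<lambda>x. x)"
  by (simp add: smooth_on_def Ck_on_ident)

lemma smooth_on_bounded_linear: "bounded_linear L \<Longrightarrow> open S \<Longrightarrow> smooth_on S f \<Longrightarrow> smooth_on S (\<lambda>x. L (f x))"
  by (simp add: smooth_on_def Ck_on_bounded_linear)

lemma smooth_on_add: "open S \<Longrightarrow> smooth_on S f \<Longrightarrow> smooth_on S g \<Longrightarrow> smooth_on S (\<lambda>x. f x + g x)"
  by (simp add: smooth_on_def Ck_on_add)

lemma smooth_on_minus: "open S \<Longrightarrow> smooth_on S f \<Longrightarrow> smooth_on S (\<lambda>x. - f x)"
  using smooth_on_bounded_linear[OF bounded_linear_minus[OF bounded_linear_ident]] by blast

lemma smooth_on_diff: "open S \<Longrightarrow> smooth_on S f \<Longrightarrow> smooth_on S g \<Longrightarrow> smooth_on S (\<lambda>x. f x - g x)"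
  using smooth_on_add[of S f "\<lambda>x. - g x"] smooth_on_minus by auto

lemma smooth_on_sum: "open S \<Longrightarrow> (\<And>i. i \<in> I \<Longrightarrow> smooth_on S (f i)) \<Longrightarrow> smooth_on S (\<lambda>x. \<Sum>i\<in>I. f i x)"
  by (simp add: smooth_on_def Ck_on_sum)

lemma smooth_on_bilinear: "bounded_bilinear h \<Longrightarrow> open S \<Longrightarrow> smooth_on S f \<Longrightarrow> smooth_on S g \<Longrightarrow> smooth_on S (\<lambda>x. h (f x) (g x))"
  by (simp add: smooth_on_def Ck_on_bilinear)

lemma smooth_on_compose:
  fixes f :: "'a::real_normed_vector \<Rightarrow> 'b::real_normed_vector"
  shows "fin_dim TYPE('b) \<Longrightarrow> open S \<Longrightarrow> open T \<Longrightarrow> (\<And>x. x \<in> S \<Longrightarrow> f x \<in> T) \<Longrightarrow>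
    smooth_on S f \<Longrightarrow> smooth_on T g \<Longrightarrow> smooth_on S (\<lambda>x. g (f x))"
  by (simp add: smooth_on_def Ck_on_compose)

lemma smooth_on_Pair:
  assumes "open S" "smooth_on S f" "smooth_on S g"
  shows "smooth_on S (\<lambda>x. (f x, g x))"
proof -
  have "smooth_on S (\<lambda>x. (f x, 0) + (0, g x))"
    using assms by (intro smooth_on_add smooth_on_bounded_linear[of "\<lambda>x. (x, 0)"] smooth_on_bounded_linear[of "\<lambda>x. (0, x)"]
        bounded_linear_intros) auto
  then show ?thesis by simp
qed

lemma smooth_on_differentiable: "smooth_on S f \<Longrightarrow> x \<in> S \<Longrightarrow> f differentiable at x"
  unfolding smooth_on_def by (metis Ck_on.simps(2))

lemma smooth_on_has_derivative: "smooth_on S f \<Longrightarrow> x \<in> S \<Longrightarrow> (f has_derivative frechet_derivative f (at x)) (at x)"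
  using smooth_on_differentiable frechet_derivative_works by blast

lemma smooth_on_frechet: "smooth_on S f \<Longrightarrow> smooth_on S (\<lambda>x. frechet_derivative f (at x) v)"
  unfolding smooth_on_def by (metis Ck_on.simps(2))

lemma smooth_on_continuous: "smooth_on S f \<Longrightarrow> continuous_on S f"
  unfolding smooth_on_def by (metis Ck_on.simps(1))

text \<open>The basis expansion again: \<open>g x\<close> is a finite combination of fixed vectors
  with smooth coefficients, and \<open>F x\<close> is linear, so smoothness for each fixed argument
  is enough.\<close>

lemma smooth_on_apply:
  fixes F :: "'a::real_normed_vector \<Rightarrow> 'b::real_normed_vector \<Rightarrow> 'c::real_normed_vector"
  assumes fd: "fin_dim TYPE('b)" and S: "open S" and F: "\<And>x. x \<in> S \<Longrightarrow> linear (F x)"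
    and "\<And>v. smooth_on S (\<lambda>x. F x v)" "smooth_on S g"
  shows "smooth_on S (\<lambda>x. F x (g x))"
proof -
  obtain n :: nat and b c where c: "\<And>i. bounded_linear (c i)" "\<And>x::'b. x = (\<Sum>i<n. c i x *\<^sub>R b i)"
    by (rule fin_dimE[OF fd]) (rule that)
  have "smooth_on S (\<lambda>x. \<Sum>i<n. c i (g x) *\<^sub>R F x (b i))"
    using assms by (intro smooth_on_sum[OF S] smooth_on_bilinear[OF bounded_bilinear_scaleR S] smooth_on_bounded_linear[OF c(1) S])
  then show ?thesis
  proof (rule smooth_on_cong[OF S, rotated])
    fix x assume "x \<in> S"
    then have l: "linear (F x)" by (rule F)
    show "(\<Sum>i<n. c i (g x) *\<^sub>R F x (b i)) = F x (g x)"
      by (subst (2) c(2)[of "g x"]) (simp add: linear_sum[OF l] linear_scale[OF l])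
  qed
qed

lemma smooth_on_blinfun:
  fixes f :: "'a::real_normed_vector \<Rightarrow> 'b::real_normed_vector covector"
  assumes fd: "fin_dim TYPE('b)" and S: "open S" and "\<And>v. smooth_on S (\<lambda>x. blinfun_apply (f x) v)"
  shows "smooth_on S f"
proof -
  obtain n :: nat and b c where c: "\<And>i. bounded_linear (c i)" "\<And>x::'b. x = (\<Sum>i<n. c i x *\<^sub>R b i)"
    by (rule fin_dimE[OF fd]) (rule that)
  have "smooth_on S (\<lambda>x. \<Sum>i<n. blinfun_apply (f x) (b i) *\<^sub>R Blinfun (c i))"
    using assms by (intro smooth_on_sum[OF S] smooth_on_bilinear[OF bounded_bilinear_scaleR S] smooth_on_const)
  then show ?thesis by (simp add: covector_expansion[OF c, symmetric])
qed

section \<open>Product rule and symmetry of second derivatives\<close>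

lemma has_derivative_apply:
  fixes F :: "'a::real_normed_vector \<Rightarrow> 'b::real_normed_vector \<Rightarrow> 'c::real_normed_vector"
  assumes fd: "fin_dim TYPE('b)" and S: "open S" "x \<in> S" and F: "\<And>y. y \<in> S \<Longrightarrow> linear (F y)"
    and F': "\<And>v. ((\<lambda>y. F y v) has_derivative F' v) (at x)" and g: "(g has_derivative g') (at x)"
  shows "((\<lambda>y. F y (g y)) has_derivative (\<lambda>u. F' (g x) u + F x (g' u))) (at x)"
proof -
  obtain n :: nat and b c where c: "\<And>i. bounded_linear (c i)" "\<And>x::'b. x = (\<Sum>i<n. c i x *\<^sub>R b i)"
    by (rule fin_dimE[OF fd]) (rule that)
  have e: "F y v = (\<Sum>i<n. c i v *\<^sub>R F y (b i))" if "y \<in> S" for y v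
    by (subst c(2)[of v]) (simp add: linear_sum[OF F[OF that]] linear_scale[OF F[OF that]])
  have "((\<lambda>y. \<Sum>i<n. c i v *\<^sub>R F y (b i)) has_derivative (\<lambda>u. \<Sum>i<n. c i v *\<^sub>R F' (b i) u)) (at x)" for v
    by (intro has_derivative_sum has_derivative_scaleR_right F')
  then have "((\<lambda>y. F y v) has_derivative (\<lambda>u. \<Sum>i<n. c i v *\<^sub>R F' (b i) u)) (at x)" for v
    by (rule has_derivative_transform_within_open[OF _ S]) (simp add: e)
  \<comment> \<open>The assumptions do not mention linearity of \<open>F'\<close> in
    \<open>v\<close>; it is forced by uniqueness of derivatives.\<close>
  then have e': "F' v = (\<lambda>u. \<Sum>i<n. c i v *\<^sub>R F' (b i) u)" for v
    using has_derivative_unique[OF F'] by blast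
  have "((\<lambda>y. \<Sum>i<n. c i (g y) *\<^sub>R F y (b i)) has_derivative
     (\<lambda>u. \<Sum>i<n. c i (g x) *\<^sub>R F' (b i) u + c i (g' u) *\<^sub>R F x (b i))) (at x)"
    by (intro has_derivative_sum has_derivative_scaleR bounded_linear.has_derivative[OF c(1)] F' g)
  then have "((\<lambda>y. F y (g y)) has_derivative (\<lambda>u. \<Sum>i<n. c i (g x) *\<^sub>R F' (b i) u + c i (g' u) *\<^sub>R F x (b i))) (at x)"
    by (rule has_derivative_transform_within_open[OF _ S]) (simp add: e[of _ "g _"])
  moreover have "(\<Sum>i<n. c i (g x) *\<^sub>R F' (b i) u + c i (g' u) *\<^sub>R F x (b i)) = F' (g x) u + F x (g' u)" for u
    by (simp add: e[OF S(2), of "g' u"] e'[of "g x"] sum.distrib)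
  ultimately show ?thesis by simp
qed

text \<open>Mean value theorem for \<open>f (x + s u + h v) - f (x + s u)\<close> as a function of
  \<open>s\<close>, followed by differentiability of the \<open>u\<close>-derivative at
  \<open>x\<close>. The two remainders, at increments \<open>\<xi> u + h v\<close> and
  \<open>\<xi> u\<close>, produce the factor \<open>2 * norm u + norm v\<close>.\<close>

lemma second_difference_bound:
  fixes f :: "'a::real_normed_vector \<Rightarrow> real"
  assumes S: "open S" "x \<in> S" and df: "\<And>y. y \<in> S \<Longrightarrow> f differentiable (at y)"
    and d: "((\<lambda>y. frechet_derivative f (at y) u) has_derivative D) (at x)" and "\<epsilon> > 0"
  shows "\<exists>\<delta>>0. \<forall>h. 0 < h \<and> h < \<delta> \<longrightarrow>
    \<bar>(f (x + h *\<^sub>R u + h *\<^sub>R v) - f (x + h *\<^sub>R u) - f (x + h *\<^sub>R v) + f x) - h^2 * D v\<bar> \<le> h^2 * (\<epsilon> * (2 * norm u + norm v))"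
proof -
  let ?g = "\<lambda>y. frechet_derivative f (at y) u"
  obtain r where r: "r > 0" "ball x r \<subseteq> S" using S open_contains_ball by blast
  obtain d1 where d1: "d1 > 0" "\<And>y. norm (y - x) < d1 \<Longrightarrow> norm (?g y - ?g x - D (y - x)) \<le> \<epsilon> * norm (y - x)"
    using d \<open>\<epsilon> > 0\<close> unfolding has_derivative_at_alt by blast
  have lin: "linear D" using d has_derivative_linear by blast
  define N where "N = norm u + norm v + 1"
  have N: "N > 0" unfolding N_def by (intro add_nonneg_pos add_nonneg_nonneg) auto
  define \<delta> where "\<delta> = min r d1 / N"
  have "\<delta> > 0" using r d1 N by (simp add: \<delta>_def)
  moreover have "\<bar>(f (x + h *\<^sub>R u + h *\<^sub>R v) - f (x + h *\<^sub>R u) - f (x + h *\<^sub>R v) + f x) - h^2 * D v\<bar> \<le> h^2 * (\<epsilon> * (2 * norm u + norm v))"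
    if h: "0 < h" "h < \<delta>" for h
  proof -
    have hN: "h * N < min r d1" using h N by (simp add: \<delta>_def pos_less_divide_eq)
    have nb: "norm (s *\<^sub>R u + t *\<^sub>R v) < min r d1" if "0 \<le> s" "s \<le> h" "0 \<le> t" "t \<le> h" for s t
    proof -
      have "norm (s *\<^sub>R u + t *\<^sub>R v) \<le> s * norm u + t * norm v"
        using norm_triangle_ineq[of "s *\<^sub>R u" "t *\<^sub>R v"] that by simp
      also have "\<dots> \<le> h * norm u + h * norm v" using that by (intro add_mono mult_right_mono) auto
      also have "\<dots> \<le> h * N" using h by (simp add: N_def algebra_simps)
      finally show ?thesis using hN by linarith
    qed
    have inS: "x + (s *\<^sub>R u + t *\<^sub>R v) \<in> S" if "0 \<le> s" "s \<le> h" "0 \<le> t" "t \<le> h" for s t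
    proof (rule subsetD[OF r(2)])
      have "dist x (x + w) = norm w" for w by (simp add: dist_norm)
      then show "x + (s *\<^sub>R u + t *\<^sub>R v) \<in> ball x r" using nb[OF that] by simp
    qed
    define \<phi> where "\<phi> s = f (x + (s *\<^sub>R u + h *\<^sub>R v)) - f (x + (s *\<^sub>R u + 0 *\<^sub>R v))" for s
    have der: "((\<lambda>s. f (x + (s *\<^sub>R u + t *\<^sub>R v))) has_derivative (\<lambda>k. k * ?g (x + (s *\<^sub>R u + t *\<^sub>R v)))) (at s)"
      if "0 \<le> s" "s \<le> h" "0 \<le> t" "t \<le> h" for s t
    proof -
      have f1: "(f has_derivative frechet_derivative f (at (x + (s *\<^sub>R u + t *\<^sub>R v)))) (at (x + (s *\<^sub>R u + t *\<^sub>R v)))"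
        using df[OF inS[OF that]] frechet_derivative_works by blast
      have "((\<lambda>s. x + (s *\<^sub>R u + t *\<^sub>R v)) has_derivative (\<lambda>k. k *\<^sub>R u)) (at s)"
        by (auto intro!: derivative_eq_intros)
      from has_derivative_compose[OF this f1] show ?thesis
        using linear_scale[OF has_derivative_linear[OF f1]] by simp
    qed
    have der\<phi>: "(\<phi> has_derivative (\<lambda>k. k * (?g (x + (s *\<^sub>R u + h *\<^sub>R v)) - ?g (x + (s *\<^sub>R u + 0 *\<^sub>R v))))) (at s)" if "0 \<le> s" "s \<le> h" for s
      unfolding \<phi>_def right_diff_distrib using that h by (intro has_derivative_diff der) auto
    obtain \<xi> where \<xi>: "0 < \<xi>" "\<xi> < h" "\<phi> h - \<phi> 0 = h * (?g (x + (\<xi> *\<^sub>R u + h *\<^sub>R v)) - ?g (x + (\<xi> *\<^sub>R u + 0 *\<^sub>R v)))"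
    proof -
      have "\<exists>\<xi>\<in>{0<..<h}. \<phi> h - \<phi> 0 = (h - 0) * (?g (x + (\<xi> *\<^sub>R u + h *\<^sub>R v)) - ?g (x + (\<xi> *\<^sub>R u + 0 *\<^sub>R v)))"
        by (rule mvt_simple[OF h(1)]) (use der\<phi> in \<open>auto intro: has_derivative_at_withinI\<close>)
      then show ?thesis using that by auto
    qed
    let ?R = "\<lambda>k. ?g (x + k) - ?g x - D k"
    have R: "\<bar>?R (s *\<^sub>R u + t *\<^sub>R v)\<bar> \<le> \<epsilon> * (h * norm u + t * norm v)" if "0 \<le> s" "s \<le> h" "0 \<le> t" "t \<le> h" for s t
    proof -
      have "\<bar>?R (s *\<^sub>R u + t *\<^sub>R v)\<bar> \<le> \<epsilon> * norm (s *\<^sub>R u + t *\<^sub>R v)"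
        using d1(2)[of "x + (s *\<^sub>R u + t *\<^sub>R v)"] nb[OF that] by simp
      also have "norm (s *\<^sub>R u + t *\<^sub>R v) \<le> s * norm u + t * norm v"
        using norm_triangle_ineq[of "s *\<^sub>R u" "t *\<^sub>R v"] that by simp
      also have "\<dots> \<le> h * norm u + t * norm v" using that by (intro add_mono mult_right_mono) auto
      finally show ?thesis using \<open>\<epsilon> > 0\<close> by simp
    qed
    have "\<phi> h - \<phi> 0 - h^2 * D v = h * (?R (\<xi> *\<^sub>R u + h *\<^sub>R v) - ?R (\<xi> *\<^sub>R u + 0 *\<^sub>R v))"
      unfolding \<xi>(3) by (simp add: linear_add[OF lin] linear_scale[OF lin] algebra_simps power2_eq_square)
    also have "\<bar>\<dots>\<bar> \<le> h * (\<epsilon> * (h * norm u + h * norm v) + \<epsilon> * (h * norm u + 0 * norm v))"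
      unfolding abs_mult using \<xi> h
      by (intro mult_mono order_trans[OF abs_triangle_ineq4] add_mono R) auto
    also have "\<dots> = h^2 * (\<epsilon> * (2 * norm u + norm v))" by (simp add: algebra_simps power2_eq_square)
    finally show ?thesis by (simp add: \<phi>_def algebra_simps)
  qed
  ultimately show ?thesis by blast
qed

text \<open>The second difference is symmetric in \<open>u\<close> and \<open>v\<close>, so
  \<open>h^2 * Du v\<close> and \<open>h^2 * Dv u\<close> approximate the same number up to an error
  that is small compared with \<open>h^2\<close>.\<close>

lemma symmetric_second_derivative_real:
  fixes f :: "'a::real_normed_vector \<Rightarrow> real"
  assumes S: "open S" "x \<in> S" and df: "\<And>y. y \<in> S \<Longrightarrow> f differentiable (at y)"
    and du: "((\<lambda>y. frechet_derivative f (at y) u) has_derivative Du) (at x)"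
    and dv: "((\<lambda>y. frechet_derivative f (at y) v) has_derivative Dv) (at x)"
  shows "Du v = Dv u"
proof (rule ccontr)
  assume ne: "Du v \<noteq> Dv u"
  define K where "K = 3 * norm u + 3 * norm v + 1"
  have K: "K > 0" unfolding K_def by (intro add_nonneg_pos add_nonneg_nonneg) auto
  \<comment> \<open>The two errors add up to
    \<open>h^2 * \<epsilon> * (3 * norm u + 3 * norm v)\<close>, which is less than
    \<open>h^2 * \<epsilon> * K\<close>, that is, \<open>h^2\<close> times half of the supposed
    gap.\<close>
  define \<epsilon> where "\<epsilon> = \<bar>Du v - Dv u\<bar> / (2 * K)"
  have \<epsilon>: "\<epsilon> > 0" using ne K by (simp add: \<epsilon>_def)
  obtain d1 where d1: "d1 > 0" "\<And>h. 0 < h \<and> h < d1 \<Longrightarrow> \<bar>(f (x + h *\<^sub>R u + h *\<^sub>R v) - f (x + h *\<^sub>R u) - f (x + h *\<^sub>R v) + f x) - h^2 * Du v\<bar> \<le> h^2 * (\<epsilon> * (2 * norm u + norm v))"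
    using second_difference_bound[OF S df du \<epsilon>, of v] by blast
  obtain d2 where d2: "d2 > 0" "\<And>h. 0 < h \<and> h < d2 \<Longrightarrow> \<bar>(f (x + h *\<^sub>R v + h *\<^sub>R u) - f (x + h *\<^sub>R v) - f (x + h *\<^sub>R u) + f x) - h^2 * Dv u\<bar> \<le> h^2 * (\<epsilon> * (2 * norm v + norm u))"
    using second_difference_bound[OF S df dv \<epsilon>, of u] by blast
  define h where "h = min d1 d2 / 2"
  have h: "h > 0" "h < d1" "h < d2" using d1 d2 by (auto simp: h_def)
  have sw: "x + h *\<^sub>R v + h *\<^sub>R u = x + h *\<^sub>R u + h *\<^sub>R v" by simp
  have "\<bar>h^2 * Du v - h^2 * Dv u\<bar> \<le> h^2 * (\<epsilon> * (2 * norm u + norm v)) + h^2 * (\<epsilon> * (2 * norm v + norm u))"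
    using d1(2)[of h] d2(2)[of h] h unfolding sw by linarith
  also have "\<dots> = h^2 * (\<epsilon> * (3 * norm u + 3 * norm v))" by (simp add: algebra_simps)
  also have "\<dots> < h^2 * (\<epsilon> * K)" using h \<epsilon> by (simp add: K_def)
  also have "\<epsilon> * K = \<bar>Du v - Dv u\<bar> / 2" using K by (simp add: \<epsilon>_def)
  finally have "h^2 * \<bar>Du v - Dv u\<bar> < h^2 * (\<bar>Du v - Dv u\<bar> / 2)"
    by (simp add: abs_mult right_diff_distrib[symmetric] del: times_divide_eq_right)
  then show False using h by (simp add: mult_less_cancel_left)
qed

lemma symmetric_second_derivative:
  fixes f :: "'a::real_normed_vector \<Rightarrow> 'b::real_normed_vector"
  assumes fd: "fin_dim TYPE('b)" and S: "open S" "x \<in> S" and f: "smooth_on S f"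
  shows "frechet_derivative (\<lambda>y. frechet_derivative f (at y) u) (at x) v =
    frechet_derivative (\<lambda>y. frechet_derivative f (at y) v) (at x) u"
proof -
  obtain n :: nat and b c where c: "\<And>i. bounded_linear (c i)" "\<And>x::'b. x = (\<Sum>i<n. c i x *\<^sub>R b i)"
    by (rule fin_dimE[OF fd]) (rule that)
  have cf: "frechet_derivative (\<lambda>y. c i (f y)) (at y) w = c i (frechet_derivative f (at y) w)" if "y \<in> S" for i y w
    using frechet_derivative_at[OF bounded_linear.has_derivative[OF c(1) smooth_on_has_derivative[OF f that]]]
    by metis
  have d: "((\<lambda>y. frechet_derivative (\<lambda>y. c i (f y)) (at y) w) has_derivative
     (\<lambda>k. c i (frechet_derivative (\<lambda>y. frechet_derivative f (at y) w) (at x) k))) (at x)" for i w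
    by (rule has_derivative_transform_within_open[OF
          bounded_linear.has_derivative[OF c(1) smooth_on_has_derivative[OF smooth_on_frechet[OF f] S(2)]] S])
       (simp add: cf)
  have "c i (frechet_derivative (\<lambda>y. frechet_derivative f (at y) u) (at x) v) =
    c i (frechet_derivative (\<lambda>y. frechet_derivative f (at y) v) (at x) u)" for i
    by (rule symmetric_second_derivative_real[OF S _ d d])
      (intro smooth_on_differentiable[OF smooth_on_bounded_linear[OF c(1) S(1) f]])
  then show ?thesis by (subst (1 2) c(2)) simp
qed

section \<open>Bump functions on the real line\<close>

definition flat_exp :: "nat \<Rightarrow> real \<Rightarrow> real" where
  "flat_exp n t = (if t > 0 then (1 / t) ^ n * exp (- (1 / t)) else 0)"

text \<open>Carrying all powers of \<open>1 / t\<close> makes the family closed under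
  differentiation up to linear combinations, so smoothness follows by induction for all
  \<open>n\<close> at once. At 0 the right difference quotient tends to 0 because the exponential
  beats every power; the left one is zero.\<close>

lemma flat_exp_has_derivative:
  "(flat_exp n has_real_derivative (flat_exp (n + 2) t - n * flat_exp (n + 1) t)) (at t)"
proof -
  consider "t > 0" | "t < 0" | "t = 0" by linarith
  then show ?thesis
  proof cases
    case 1
    have "((\<lambda>t. (1 / t) ^ n * exp (- (1 / t))) has_real_derivative (flat_exp (n + 2) t - n * flat_exp (n + 1) t)) (at t)"
    proof (rule DERIV_cong)
      have a: "((\<lambda>t. 1 / t) has_real_derivative - ((1 / t)^2)) (at t)"
        using 1 by (auto intro!: derivative_eq_intros simp: power2_eq_square)
      show "((\<lambda>t. (1 / t) ^ n * exp (- (1 / t))) has_real_derivative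
          (of_nat n * (- ((1 / t)^2) * (1 / t) ^ (n - Suc 0))) * exp (- (1 / t)) + (exp (- (1 / t)) * - (- ((1 / t)^2))) * (1 / t) ^ n) (at t)"
        by (intro DERIV_mult DERIV_power DERIV_fun_exp DERIV_minus a)
      \<comment> \<open>For \<open>n = 0\<close> the exponent \<open>n - Suc 0\<close> is truncated,
        but its term carries the factor \<open>n\<close>; hence the case distinction.\<close>
      have "of_nat n * (- (u^2) * u ^ (n - Suc 0)) * e + e * - (- (u^2)) * u ^ n
          = u ^ (n + 2) * e - n * (u ^ (n + 1) * e)" for u e :: real
        by (cases n) (simp_all add: algebra_simps power2_eq_square)
      from this[of "1 / t" "exp (- (1 / t))"]
      show "(of_nat n * (- ((1 / t)^2) * (1 / t) ^ (n - Suc 0))) * exp (- (1 / t)) + (exp (- (1 / t)) * - (- ((1 / t)^2))) * (1 / t) ^ n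
          = flat_exp (n + 2) t - n * flat_exp (n + 1) t"
        using 1 by (simp only: flat_exp_def if_True)
    qed
    then show ?thesis
      by (rule has_field_derivative_transform_within_open[where S="{0<..}"]) (use 1 in \<open>auto simp: flat_exp_def\<close>)
  next
    case 2
    have "((\<lambda>t. 0) has_real_derivative (flat_exp (n + 2) t - n * flat_exp (n + 1) t)) (at t)"
      using 2 by (auto simp: flat_exp_def)
    then show ?thesis
      by (rule has_field_derivative_transform_within_open[where S="{..<0}"]) (use 2 in \<open>auto simp: flat_exp_def\<close>)
  next
    case 3
    have "((\<lambda>h. (1 / h) ^ n * exp (- (1 / h)) / h) \<longlongrightarrow> 0) (at_right (0::real))"
      by real_asymp
    then have "((\<lambda>h. (flat_exp n (0 + h) - flat_exp n 0) / h) \<longlongrightarrow> 0) (at_right 0)"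
      by (rule Lim_transform_eventually) (auto simp: flat_exp_def eventually_at_filter)
    moreover have "((\<lambda>h. (flat_exp n (0 + h) - flat_exp n 0) / h) \<longlongrightarrow> 0) (at_left 0)"
      by (rule Lim_transform_eventually[of "\<lambda>_. 0"]) (auto simp: flat_exp_def eventually_at_filter)
    ultimately show ?thesis
      unfolding 3 DERIV_def by (simp add: flat_exp_def filterlim_split_at_real)
  qed
qed

lemma smooth_on_flat_exp: "smooth_on S (flat_exp n)"
proof -
  have "Ck_on k UNIV (flat_exp n)" for k
  proof (induction k arbitrary: n)
    case 0
    show ?case
      using flat_exp_has_derivative[THEN DERIV_isCont] by (simp add: continuous_on_eq_continuous_at)
  next
    case (Suc k)
    have hd: "(flat_exp n has_derivative (\<lambda>v. (flat_exp (n + 2) t - n * flat_exp (n + 1) t) * v)) (at t)" for t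
      using flat_exp_has_derivative[of n t] by (simp add: has_field_derivative_def)
    have e: "frechet_derivative (flat_exp n) (at t) v = v * flat_exp (n + 2) t + (- n * v) * flat_exp (n + 1) t" for t v :: real
      by (simp add: frechet_derivative_at[OF hd, symmetric] algebra_simps)
    have "Ck_on k UNIV (\<lambda>t. frechet_derivative (flat_exp n) (at t) v)" for v
      unfolding e by (intro Ck_on_add Ck_on_bilinear[OF bounded_bilinear_mult] Ck_on_const Suc) auto
    then show ?case using hd by (auto simp: differentiable_def)
  qed
  then show ?thesis using smooth_on_subset[of UNIV] by (auto simp: smooth_on_def)
qed

lemma fin_dim_real: "fin_dim TYPE(real)"
  by (rule fin_dim_inner[of "{1}"]) (auto simp: span_singleton image_iff)

lemma bump_exists:
  fixes r R :: real
  assumes "r < R"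
  obtains \<theta> :: "real \<Rightarrow> real" where "smooth_on UNIV \<theta>" "\<And>t. t \<le> r \<Longrightarrow> \<theta> t = 1" "\<And>t. t \<ge> R \<Longrightarrow> \<theta> t = 0"
proof -
  \<comment> \<open>Up to \<open>r\<close> the inner \<open>flat_exp\<close> is 0 and the outer one
    is \<open>exp (-1)\<close>, which the factor \<open>exp 1\<close> normalises to 1. From
    \<open>R\<close> on, \<open>C\<close> scales the increasing inner term to at least 1, so the
    outer argument is nonpositive.\<close>
  define C where "C = 1 / flat_exp 0 (R - r)"
  define \<theta> where "\<theta> t = exp 1 * flat_exp 0 (1 - C * flat_exp 0 (t - r))" for t
  have "smooth_on UNIV (\<lambda>t. exp 1 * flat_exp 0 (1 - C * flat_exp 0 (t - r)))"
    by (intro smooth_on_bilinear[OF bounded_bilinear_mult] smooth_on_const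
        smooth_on_compose[OF fin_dim_real _ open_UNIV _ _ smooth_on_flat_exp] smooth_on_diff smooth_on_ident) auto
  then have "smooth_on UNIV \<theta>" by (simp add: \<theta>_def[abs_def])
  moreover have "\<theta> t = 1" if "t \<le> r" for t
    using that by (simp add: \<theta>_def flat_exp_def mult_exp_exp)
  moreover have "\<theta> t = 0" if "t \<ge> R" for t
  proof -
    have "exp (- (1 / (R - r))) \<le> exp (- (1 / (t - r)))"
      using that assms by (simp add: frac_le)
    then have "flat_exp 0 (R - r) \<le> flat_exp 0 (t - r)" "flat_exp 0 (R - r) > 0"
      using that assms by (simp_all add: flat_exp_def)
    then have "1 - C * flat_exp 0 (t - r) \<le> 0" by (simp add: C_def)
    then show ?thesis by (simp add: \<theta>_def flat_exp_def)
  qed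
  ultimately show ?thesis by (rule that)
qed

section \<open>Curves in level sets of submersions\<close>

lemma strict_derivative:
  fixes f :: "'a::real_normed_vector \<Rightarrow> 'b::real_normed_vector"
  assumes fd: "fin_dim TYPE('a)" and S: "open S" "x \<in> S" and f: "smooth_on S f" and \<epsilon>: "\<epsilon> > 0"
  shows "\<exists>\<delta>>0. ball x \<delta> \<subseteq> S \<and> (\<forall>y\<in>ball x \<delta>. \<forall>z\<in>ball x \<delta>.
    norm (f y - f z - frechet_derivative f (at x) (y - z)) \<le> \<epsilon> * norm (y - z))"
proof -
  obtain n :: nat and b c where c: "\<And>i. bounded_linear (c i)" "\<And>x::'a. x = (\<Sum>i<n. c i x *\<^sub>R b i)"
    by (rule fin_dimE[OF fd]) (rule that)
  let ?D = "\<lambda>y. frechet_derivative f (at y)"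
  obtain K where K: "\<And>i x. \<bar>c i x\<bar> \<le> norm x * K i" 
    using bounded_linear.bounded[OF c(1)] unfolding real_norm_def by metis
  \<comment> \<open>Continuity of the derivative is known one direction at a time. Tolerance
    \<open>\<epsilon> / KK\<close> on the finitely many \<open>b i\<close> yields the operator norm
    bound \<epsilon>; the summand 1 keeps \<open>KK\<close> positive.\<close>
  define KK where "KK = (\<Sum>i<n. \<bar>K i\<bar>) + 1"
  have KK: "KK > 0" unfolding KK_def by (smt (verit) sum_nonneg abs_ge_zero)
  have "isCont (\<lambda>y. ?D y (b i)) x" for i
    using smooth_on_continuous[OF smooth_on_frechet[OF f]] S by (simp add: continuous_on_eq_continuous_at)
  then have "\<forall>\<^sub>F y in at x. dist (?D y (b i)) (?D x (b i)) < \<epsilon> / KK" for i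
    using tendstoD[of "\<lambda>y. ?D y (b i)" "?D x (b i)" "at x" "\<epsilon> / KK"] \<epsilon> KK by (simp add: isCont_def)
  then have "\<forall>\<^sub>F y in at x. \<forall>i\<in>{..<n}. dist (?D y (b i)) (?D x (b i)) < \<epsilon> / KK"
    by (intro eventually_ball_finite) auto
  then obtain d where d: "d > 0" "\<And>y i. y \<noteq> x \<Longrightarrow> dist y x < d \<Longrightarrow> i < n \<Longrightarrow> dist (?D y (b i)) (?D x (b i)) < \<epsilon> / KK"
    unfolding eventually_at by (auto simp: lessThan_iff)
  obtain r where r: "r > 0" "ball x r \<subseteq> S" using S open_contains_ball by blast
  define \<delta> where "\<delta> = min d r"
  have \<delta>: "\<delta> > 0" "ball x \<delta> \<subseteq> S" using d r by (auto simp: \<delta>_def)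
  have lin: "linear (?D y)" if "y \<in> S" for y
    using smooth_on_has_derivative[OF f that] has_derivative_linear by blast
  have on: "onorm (\<lambda>v. ?D y v - ?D x v) \<le> \<epsilon>" if y: "y \<in> ball x \<delta>" for y
  proof (rule onorm_bound)
    show "0 \<le> \<epsilon>" using \<epsilon> by simp
  next
    fix v
    have yS: "y \<in> S" using y \<delta> by blast
    have "?D y v - ?D x v = (\<Sum>i<n. c i v *\<^sub>R (?D y (b i) - ?D x (b i)))"
      by (subst (1 2) c(2)[of v]) (simp add: linear_sum lin yS S linear_scale scaleR_diff_right sum_subtractf)
    also have "norm \<dots> \<le> (\<Sum>i<n. (norm v * \<bar>K i\<bar>) * (\<epsilon> / KK))"
    proof (intro sum_norm_le)
      fix i assume i: "i \<in> {..<n}"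
      have "\<bar>c i v\<bar> \<le> norm v * \<bar>K i\<bar>" by (rule order_trans[OF K]) (simp add: mult_left_mono)
      moreover have "norm (?D y (b i) - ?D x (b i)) \<le> \<epsilon> / KK"
        using d(2)[of y i] y i \<epsilon> KK by (cases "y = x") (auto simp: \<delta>_def dist_norm norm_minus_commute)
      ultimately show "norm (c i v *\<^sub>R (?D y (b i) - ?D x (b i))) \<le> (norm v * \<bar>K i\<bar>) * (\<epsilon> / KK)"
        unfolding norm_scaleR by (intro mult_mono) auto
    qed
    also have "\<dots> = norm v * (\<epsilon> / KK) * (\<Sum>i<n. \<bar>K i\<bar>)" by (simp add: sum_distrib_left mult_ac)
    also have "\<dots> \<le> norm v * (\<epsilon> / KK) * KK" using \<epsilon> KK by (intro mult_left_mono) (auto simp: KK_def)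
    finally show "norm (?D y v - ?D x v) \<le> \<epsilon> * norm v" using KK by (simp add: mult.commute)
  qed
  have "norm (f y - f z - ?D x (y - z)) \<le> \<epsilon> * norm (y - z)" if yz: "y \<in> ball x \<delta>" "z \<in> ball x \<delta>" for y z
  proof -
    have bl: "bounded_linear (?D x)" using smooth_on_has_derivative[OF f S(2)] has_derivative_bounded_linear by blast
    \<comment> \<open>Mean value inequality for \<open>f\<close> minus its linearisation at
      \<open>x\<close>, whose derivative has operator norm at most \<epsilon> on the ball.\<close>
    have "norm ((f y - ?D x y) - (f z - ?D x z)) \<le> \<epsilon> * norm (y - z)"
    proof (rule differentiable_bound[OF convex_ball _ _ yz(1) yz(2)])
      show "((\<lambda>y. f y - ?D x y) has_derivative (\<lambda>v. ?D w v - ?D x v)) (at w within ball x \<delta>)" if "w \<in> ball x \<delta>" for w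
        using smooth_on_has_derivative[OF f subsetD[OF \<delta>(2) that]]
        by (intro has_derivative_diff bounded_linear_imp_has_derivative[OF bl]) (auto intro: has_derivative_at_withinI)
    qed (rule on)
    then show ?thesis by (simp add: linear_diff[OF lin[OF S(2)]] algebra_simps)
  qed
  then show ?thesis using \<delta> by blast
qed

text \<open>The point \<open>x + t v\<close> misses the level set by o(t). It is corrected by
  \<open>R u\<close>, where \<open>R\<close> is a linear right inverse of the derivative and
  \<open>u\<close> a fixed point of the simplified Newton map \<open>u - H (a + R u)\<close>. The
  correction is o(t) as well, so the velocity at 0 is still \<open>v\<close>.\<close>

lemma level_set_curve:
  fixes H :: "'a::real_normed_vector \<Rightarrow> 'b::real_normed_vector"
  assumes fd: "fin_dim TYPE('a)" "fin_dim TYPE('b)" and S: "open S" "x \<in> S" and H: "smooth_on S H" "H x = 0"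
    and surj: "surj (frechet_derivative H (at x))" and v: "frechet_derivative H (at x) v = 0"
  obtains \<gamma> :: "real \<Rightarrow> 'a" and \<tau> where "\<gamma> 0 = x" "(\<gamma> has_derivative (\<lambda>t. t *\<^sub>R v)) (at 0)"
    "\<tau> > 0" "\<And>t. \<bar>t\<bar> < \<tau> \<Longrightarrow> \<gamma> t \<in> S \<and> H (\<gamma> t) = 0"
proof -
  define D where "D = frechet_derivative H (at x)"
  have HD: "(H has_derivative D) (at x)" unfolding D_def by (rule smooth_on_has_derivative[OF H(1) S(2)])
  have linD: "linear D" using HD has_derivative_linear by blast
  obtain R where R: "linear R" "D \<circ> R = id"
    using linear_surjective_right_inverse[OF linD] surj unfolding D_def by blast
  have DR: "D (R u) = u" for u using R(2) by (metis comp_apply id_apply)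
  obtain K where K: "K > 0" "\<And>u. norm (R u) \<le> norm u * K"
    using bounded_linear.pos_bounded[OF linear_bounded_linear[OF fd(2) R(1)]] by blast
  \<comment> \<open>With \<open>e * K = 1/2\<close>, strict differentiability makes the Newton map a
    contraction with constant \<open>1/2\<close>.\<close>
  define e where "e = 1 / (2 * K)"
  have e: "e > 0" "e * K = 1/2" using K by (auto simp: e_def)
  obtain \<delta> where \<delta>: "\<delta> > 0" "ball x \<delta> \<subseteq> S"
    "\<And>y z. y \<in> ball x \<delta> \<Longrightarrow> z \<in> ball x \<delta> \<Longrightarrow> norm (H y - H z - D (y - z)) \<le> e * norm (y - z)"
    using strict_derivative[OF fd(1) S H(1) e(1)] unfolding D_def by blast
  \<comment> \<open>Ensures that \<open>t v\<close> has norm below \<open>\<delta> / 2\<close>. The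
    correction turns out to have norm at most that of \<open>t v\<close>, so the corrected point
    stays in the ball of radius \<delta>.\<close>
  define \<tau> where "\<tau> = \<delta> / (2 * (norm v + 1))"
  have \<tau>: "\<tau> > 0" using \<delta> by (simp add: \<tau>_def add_nonneg_pos)
  have ex: "\<exists>u. norm u \<le> 2 * norm (H (x + t *\<^sub>R v)) \<and> x + t *\<^sub>R v + R u \<in> S \<and> H (x + t *\<^sub>R v + R u) = 0"
    if t: "\<bar>t\<bar> < \<tau>" for t
  proof -
    define a where "a = x + t *\<^sub>R v"
    define m where "m = norm (H a)"
    have tv: "norm (t *\<^sub>R v) < \<delta> / 2"
    proof -
      have "\<bar>t\<bar> * norm v \<le> \<bar>t\<bar> * (norm v + 1)" by (simp add: mult_left_mono)
      also have "\<dots> < \<tau> * (norm v + 1)" using t by (intro mult_strict_right_mono) (auto simp: add_nonneg_pos)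
      also have "\<dots> = \<delta> / 2"
      proof -
        have "norm v + 1 \<noteq> 0" using norm_ge_zero[of v] by linarith
        then show ?thesis by (simp add: \<tau>_def field_simps)
      qed
      finally show ?thesis by simp
    qed
    have d: "dist x (x + w) = norm w" for w by (simp add: dist_norm)
    have aB: "a \<in> ball x \<delta>" unfolding a_def mem_ball d using tv \<delta>(1) by linarith
    have "norm (H a - H x - D (a - x)) \<le> e * norm (a - x)"
      by (rule \<delta>(3)) (use aB \<delta>(1) in auto)
    then have m: "m \<le> e * norm (t *\<^sub>R v)"
      using v by (simp add: m_def a_def H(2) linear_scale[OF linD] D_def[symmetric])
    have inB: "a + R u \<in> ball x \<delta>" if "norm u \<le> 2 * m" for u
    proof -
      have "norm (R u) \<le> 2 * m * K" using K(2)[of u] that K(1) by (meson mult_right_mono order_trans less_imp_le)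
      also have "\<dots> \<le> 2 * (e * norm (t *\<^sub>R v)) * K" using m K(1) by (intro mult_right_mono mult_left_mono) auto
      also have "\<dots> = 2 * (e * K) * norm (t *\<^sub>R v)" by (simp only: mult_ac)
      also have "\<dots> = norm (t *\<^sub>R v)" unfolding e(2) by simp
      finally have "norm (t *\<^sub>R v + R u) < \<delta>" using norm_triangle_ineq[of "t *\<^sub>R v" "R u"] tv by linarith
      then show ?thesis unfolding mem_ball a_def add.assoc d .
    qed
    define k where "k u = u - H (a + R u)" for u
    have lip: "norm (k u - k w) \<le> 1/2 * norm (u - w)" if "norm u \<le> 2 * m" "norm w \<le> 2 * m" for u w
    proof -
      have eq: "D ((a + R u) - (a + R w)) = u - w" by (simp add: linear_diff[OF linD] DR)
      have "norm (H (a + R u) - H (a + R w) - D ((a + R u) - (a + R w))) \<le> e * norm ((a + R u) - (a + R w))"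
        by (rule \<delta>(3)[OF inB[OF that(1)] inB[OF that(2)]])
      moreover have "k u - k w = - (H (a + R u) - H (a + R w) - D ((a + R u) - (a + R w)))"
        unfolding eq by (simp add: k_def)
      ultimately have "norm (k u - k w) \<le> e * norm (R (u - w))"
        by (simp add: linear_diff[OF R(1)] norm_minus_commute)
      also have "\<dots> \<le> e * (norm (u - w) * K)" using e K(2) by (intro mult_left_mono) auto
      also have "\<dots> = (e * K) * norm (u - w)" by (simp only: mult_ac)
      finally show ?thesis unfolding e(2) .
    qed
    have m0: "m \<ge> 0" by (simp add: m_def)
    have k0: "norm (k 0) = m" by (simp add: k_def linear_0[OF R(1)] m_def)
    \<comment> \<open>The ball of radius \<open>2 * m\<close> is mapped into itself because
      \<open>k 0\<close> has norm \<open>m\<close> and \<open>k\<close> halves distances.\<close>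
    have "\<exists>!u\<in>cball 0 (2 * m). k u = u"
    proof (rule Banach_fix[where c="1/2"])
      show "complete (cball (0::'b) (2 * m))" by (rule fin_dim_complete_cball[OF fd(2)])
      show "cball (0::'b) (2 * m) \<noteq> {}" using m0 by simp
      show "k ` cball 0 (2 * m) \<subseteq> cball 0 (2 * m)"
      proof
        fix y assume "y \<in> k ` cball 0 (2 * m)"
        then obtain u where u: "norm u \<le> 2 * m" "y = k u" by auto
        have "norm (k u) \<le> norm (k u - k 0) + norm (k 0)" by (metis add_diff_cancel_right' diff_add_cancel norm_triangle_ineq)
        also have "norm (k u - k 0) \<le> 1/2 * norm u" using lip[OF u(1), of 0] m0 by simp
        finally show "y \<in> cball 0 (2 * m)" using u k0 by simp
      qed
    qed (use lip in \<open>auto simp: dist_norm\<close>)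
    then obtain u where u: "norm u \<le> 2 * m" "k u = u" by auto
    have "H (a + R u) = 0" using u(2) by (simp add: k_def)
    then show ?thesis using u(1) inB[OF u(1)] \<delta>(2) by (auto simp: m_def a_def)
  qed
  \<comment> \<open>The corrections are chosen independently for each \<open>t\<close>. Their bound
    by twice the norm of \<open>H\<close> at the uncorrected point is what gives the derivative at
    0.\<close>
  define u where "u t = (SOME u. norm u \<le> 2 * norm (H (x + t *\<^sub>R v)) \<and> x + t *\<^sub>R v + R u \<in> S \<and> H (x + t *\<^sub>R v + R u) = 0)" for t
  have u: "norm (u t) \<le> 2 * norm (H (x + t *\<^sub>R v))" "x + t *\<^sub>R v + R (u t) \<in> S" "H (x + t *\<^sub>R v + R (u t)) = 0" if "\<bar>t\<bar> < \<tau>" for t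
    using someI_ex[OF ex[OF that]] unfolding u_def by auto
  define \<gamma> where "\<gamma> t = x + t *\<^sub>R v + R (u t)" for t
  have u0: "u 0 = 0" using u(1)[of 0] \<tau> by (simp add: H)
  have "((\<lambda>t. x + t *\<^sub>R v) has_derivative (\<lambda>t. t *\<^sub>R v)) (at 0)"
    by (auto intro!: derivative_eq_intros)
  moreover have "(H has_derivative D) (at (x + 0 *\<^sub>R v))" using HD by simp
  ultimately have "((\<lambda>t. H (x + t *\<^sub>R v)) has_derivative (\<lambda>t. D (t *\<^sub>R v))) (at 0)"
    by (rule has_derivative_compose)
  then have H0: "((\<lambda>t. H (x + t *\<^sub>R v)) has_derivative (\<lambda>t. 0)) (at 0)"
    using v by (simp add: linear_scale[OF linD] D_def[symmetric])
  have "((\<lambda>t. R (u t)) has_derivative (\<lambda>t. 0)) (at 0)"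
    unfolding has_derivative_at_alt
  proof (intro conjI allI impI)
    fix \<epsilon> :: real assume "\<epsilon> > 0"
    then have "\<epsilon> / (2 * K) > 0" using K by simp
    then obtain d where d: "d > 0" "\<And>t. norm (t - 0) < d \<Longrightarrow> norm (H (x + t *\<^sub>R v) - H (x + 0 *\<^sub>R v) - 0) \<le> \<epsilon> / (2 * K) * norm (t - 0)"
      using H0 unfolding has_derivative_at_alt by blast
    have "norm (R (u t) - R (u 0) - 0) \<le> \<epsilon> * norm (t - 0)" if t: "norm (t - 0) < min d \<tau>" for t
    proof -
      have "norm (R (u t)) \<le> norm (u t) * K" by (rule K)
      also have "\<dots> \<le> 2 * (\<epsilon> / (2 * K) * \<bar>t\<bar>) * K"
        using u(1)[of t] d(2)[of t] t K by (intro mult_right_mono) (auto simp: H)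
      also have "\<dots> = \<epsilon> * \<bar>t\<bar>" using K by simp
      finally show ?thesis by (simp add: u0 linear_0[OF R(1)])
    qed
    then show "\<exists>d>0. \<forall>y. norm (y - 0) < d \<longrightarrow> norm (R (u y) - R (u 0) - 0) \<le> \<epsilon> * norm (y - 0)"
      using d(1) \<tau> by (intro exI[of _ "min d \<tau>"]) auto
  qed simp
  from has_derivative_add[OF _ this, of "\<lambda>t. x + t *\<^sub>R v" "\<lambda>t. t *\<^sub>R v"]
  have "(\<gamma> has_derivative (\<lambda>t. t *\<^sub>R v)) (at 0)"
    using \<open>((\<lambda>t. x + t *\<^sub>R v) has_derivative (\<lambda>t. t *\<^sub>R v)) (at 0)\<close> unfolding \<gamma>_def by simp
  moreover have "\<gamma> 0 = x" by (simp add: \<gamma>_def u0 linear_0[OF R(1)])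
  ultimately show ?thesis using that[of \<gamma> \<tau>] \<tau> u by (simp add: \<gamma>_def)
qed

text \<open>Both maps coincide along a curve in the level set with velocity \<open>v\<close>, and
  the chain rule at parameter 0 evaluates either derivative on \<open>v\<close>.\<close>

lemma derivative_eq_along_level_set:
  fixes H :: "'a::real_normed_vector \<Rightarrow> 'b::real_normed_vector" and f g :: "'a \<Rightarrow> 'c::real_normed_vector"
  assumes fd: "fin_dim TYPE('a)" "fin_dim TYPE('b)" and S: "open S" "x \<in> S" and H: "smooth_on S H" "H x = 0"
    and surj: "surj (frechet_derivative H (at x))" and v: "frechet_derivative H (at x) v = 0"
    and f: "f differentiable (at x)" and g: "g differentiable (at x)"
    and eq: "\<And>y. y \<in> S \<Longrightarrow> H y = 0 \<Longrightarrow> f y = g y"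
  shows "frechet_derivative f (at x) v = frechet_derivative g (at x) v"
proof -
  obtain \<gamma> \<tau> where \<gamma>: "\<gamma> 0 = x" "(\<gamma> has_derivative (\<lambda>t. t *\<^sub>R v)) (at 0)"
    "\<tau> > 0" "\<And>t. \<bar>t\<bar> < \<tau> \<Longrightarrow> \<gamma> t \<in> S \<and> H (\<gamma> t) = 0"
    by (rule level_set_curve[OF fd S H surj v]) (rule that)
  have f': "(f has_derivative frechet_derivative f (at x)) (at (\<gamma> 0))"
    and g': "(g has_derivative frechet_derivative g (at x)) (at (\<gamma> 0))"
    using f g \<gamma>(1) frechet_derivative_works by auto
  have "((\<lambda>t. f (\<gamma> t)) has_derivative (\<lambda>t. frechet_derivative g (at x) (t *\<^sub>R v))) (at 0)"
    by (rule has_derivative_transform_within_open[OF has_derivative_compose[OF \<gamma>(2) g'], of "{-\<tau><..<\<tau>}"])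
       (use \<gamma> eq in auto)
  from has_derivative_unique[OF this has_derivative_compose[OF \<gamma>(2) f']]
  show ?thesis by (metis scaleR_one)
qed

section \<open>Tangent maps in charts\<close>

lemma atlas_fin_dim: "smooth_atlas (A :: ('m::topological_space, 'e::real_inner) atlas) \<Longrightarrow> fin_dim TYPE('e)"
  unfolding smooth_atlas_def using fin_dim_inner by blast

lemma atlas_homeo: "smooth_atlas A \<Longrightarrow> homeomorphism (cdom A p) (chart A p ` cdom A p) (chart A p) (ichart A p)"
  unfolding smooth_atlas_def by blast

lemma atlas_mem: "smooth_atlas A \<Longrightarrow> p \<in> cdom A p"
  unfolding smooth_atlas_def by blast

lemma atlas_open: "smooth_atlas A \<Longrightarrow> open (cdom A p)"
  unfolding smooth_atlas_def by blast

lemma atlas_open_image: "smooth_atlas A \<Longrightarrow> open (chart A p ` cdom A p)"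
  unfolding smooth_atlas_def by blast

lemma ichart_chart: "smooth_atlas A \<Longrightarrow> q \<in> cdom A p \<Longrightarrow> ichart A p (chart A p q) = q"
  using homeomorphism_apply1[OF atlas_homeo] by blast

lemma chart_ichart: "smooth_atlas A \<Longrightarrow> y \<in> chart A p ` cdom A p \<Longrightarrow> chart A p (ichart A p y) = y"
  using homeomorphism_apply2[OF atlas_homeo] by blast

lemma ichart_mem: "smooth_atlas A \<Longrightarrow> y \<in> chart A p ` cdom A p \<Longrightarrow> ichart A p y \<in> cdom A p"
  by (auto simp: ichart_chart)

lemma open_chart_image:
  assumes A: "smooth_atlas A" and V: "open V" "V \<subseteq> cdom A p"
  shows "open (chart A p ` V)"
proof -
  have "chart A p ` V = chart A p ` cdom A p \<inter> ichart A p -` V"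
    using V by (auto simp: ichart_chart[OF A] subset_iff intro!: image_eqI)
  moreover have "open (chart A p ` cdom A p \<inter> ichart A p -` V)"
    by (rule continuous_open_preimage[OF homeomorphism_cont2[OF atlas_homeo[OF A]] atlas_open_image[OF A] V(1)])
  ultimately show ?thesis by simp
qed

section \<open>Differentiability at a point and the chain rule in arbitrary charts\<close>

lemma eventually_ichart:
  assumes A: "smooth_atlas A" and x: "x \<in> cdom A p" and ev: "\<forall>\<^sub>F z in nhds x. P z"
  shows "\<forall>\<^sub>F y in nhds (chart A p x). y \<in> chart A p ` cdom A p \<and> P (ichart A p y)"
proof -
  obtain V where V: "open V" "x \<in> V" "\<And>z. z \<in> V \<Longrightarrow> P z" using ev unfolding eventually_nhds by blast
  have "open (chart A p ` (cdom A p \<inter> V))"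
    by (rule open_chart_image[OF A]) (use V atlas_open[OF A] in auto)
  then show ?thesis unfolding eventually_nhds
    using V x by (intro exI[of _ "chart A p ` (cdom A p \<inter> V)"]) (auto simp: ichart_chart[OF A])
qed

text \<open>\<open>chart B q\<close> is a total function, so differentiability of the
  representatives does not force \<open>f\<close> to stay in the chart domain near \<open>x\<close>.
  Continuity is therefore a clause of its own, phrased with \<open>nhds\<close> so that it
  composes.\<close>

definition mdiff :: "('m::topological_space, 'e::real_normed_vector) atlas \<Rightarrow>
    ('n::topological_space, 'f::real_normed_vector) atlas \<Rightarrow> ('m \<Rightarrow> 'n) \<Rightarrow> 'm \<Rightarrow> bool" where
  "mdiff A B f x \<longleftrightarrow> filterlim f (nhds (f x)) (nhds x) \<and> (\<forall>p q. x \<in> cdom A p \<longrightarrow> f x \<in> cdom B q \<longrightarrow>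
     (chart B q \<circ> f \<circ> ichart A p) differentiable (at (chart A p x)))"

text \<open>\<open>tangent_map\<close>, \<open>to_chart\<close> and \<open>from_chart\<close> are
  all instances, so one chain rule serves all three.\<close>

definition Drep :: "('m, 'e::real_normed_vector) atlas \<Rightarrow> ('n, 'f::real_normed_vector) atlas \<Rightarrow>
    ('m \<Rightarrow> 'n) \<Rightarrow> 'm \<Rightarrow> 'n \<Rightarrow> 'm \<Rightarrow> 'e \<Rightarrow> 'f" where
  "Drep A B f p q x = frechet_derivative (chart B q \<circ> f \<circ> ichart A p) (at (chart A p x))"

lemma mdiff_tendsto: "mdiff A B f x \<Longrightarrow> filterlim f (nhds (f x)) (nhds x)"
  by (simp add: mdiff_def)

lemma mdiff_has_derivative:
  "mdiff A B f x \<Longrightarrow> x \<in> cdom A p \<Longrightarrow> f x \<in> cdom B q \<Longrightarrow>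
    (chart B q \<circ> f \<circ> ichart A p has_derivative Drep A B f p q x) (at (chart A p x))"
  unfolding mdiff_def Drep_def using frechet_derivative_works by blast

lemma Drep_linear: "mdiff A B f x \<Longrightarrow> x \<in> cdom A p \<Longrightarrow> f x \<in> cdom B q \<Longrightarrow> linear (Drep A B f p q x)"
  using mdiff_has_derivative has_derivative_linear by blast

lemma Drep_eqI:
  "(chart B q \<circ> f \<circ> ichart A p has_derivative D) (at (chart A p x)) \<Longrightarrow> Drep A B f p q x = D"
  unfolding Drep_def using frechet_derivative_at by metis

lemma tangent_map_eq_Drep: "tangent_map A B f x = Drep A B f x (f x) x"
  by (simp add: tangent_map_def Drep_def)

lemma tangent_map_linear: "smooth_atlas A \<Longrightarrow> smooth_atlas B \<Longrightarrow> mdiff A B f x \<Longrightarrow> linear (tangent_map A B f x)"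
  unfolding tangent_map_eq_Drep by (intro Drep_linear atlas_mem)

lemma has_derivative_transform_nhds:
  assumes "(f has_derivative D) (at x)" "\<forall>\<^sub>F y in nhds x. f y = g y"
  shows "(g has_derivative D) (at x)"
proof -
  obtain V where "open V" "x \<in> V" "\<And>y. y \<in> V \<Longrightarrow> f y = g y" using assms(2) unfolding eventually_nhds by blast
  then show ?thesis using has_derivative_transform_within_open[OF assms(1)] by blast
qed

text \<open>\<open>frechet_derivative\<close> is a choice among the derivatives at the point, and
  that set depends only on the germ; the equality thus also covers germs that are not
  differentiable.\<close>

lemma frechet_derivative_cong_nhds:
  assumes "\<forall>\<^sub>F y in nhds x. f y = g y"
  shows "frechet_derivative f (at x) = frechet_derivative g (at x)"
proof -
  have "(f has_derivative D) (at x) \<longleftrightarrow> (g has_derivative D) (at x)" for D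
    using has_derivative_transform_nhds[OF _ assms] has_derivative_transform_nhds[of g D x f] assms
    by (auto simp: eq_commute)
  then show ?thesis unfolding frechet_derivative_def by simp
qed

lemma Drep_cong:
  assumes A: "smooth_atlas A" and x: "x \<in> cdom A p" and ev: "\<forall>\<^sub>F z in nhds x. f z = g z"
  shows "Drep A B f p q x = Drep A B g p q x"
  unfolding Drep_def
  by (rule frechet_derivative_cong_nhds, rule eventually_mono[OF eventually_ichart[OF A x ev]]) auto

lemma tangent_map_cong:
  assumes A: "smooth_atlas A" and ev: "\<forall>\<^sub>F z in nhds x. f z = g z"
  shows "tangent_map A B f x = tangent_map A B g x"
  using Drep_cong[OF A atlas_mem[OF A] ev] eventually_nhds_x_imp_x[OF ev]
  by (simp add: tangent_map_eq_Drep)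

text \<open>The two middle charts cancel only where \<open>f\<close> stays in
  \<open>cdom B q\<close>; continuity of \<open>f\<close> at \<open>x\<close> provides a
  neighbourhood of this kind.\<close>

lemma has_derivative_rep_compose:
  assumes A: "smooth_atlas A" and B: "smooth_atlas B"
    and f: "mdiff A B f x" and g: "mdiff B C g (f x)"
    and x: "x \<in> cdom A p" "f x \<in> cdom B q" "g (f x) \<in> cdom C r"
  shows "(chart C r \<circ> (\<lambda>x. g (f x)) \<circ> ichart A p has_derivative (\<lambda>v. Drep B C g q r (f x) (Drep A B f p q x v))) (at (chart A p x))"
proof -
  have "\<forall>\<^sub>F z in nhds x. f z \<in> cdom B q"
    by (rule eventually_compose_filterlim[OF _ mdiff_tendsto[OF f]])
      (rule eventually_nhds_in_open[OF atlas_open[OF B] x(2)])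
  then have ev: "\<forall>\<^sub>F y in nhds (chart A p x). f (ichart A p y) \<in> cdom B q"
    using eventually_ichart[OF A x(1), of "\<lambda>z. f z \<in> cdom B q"] by (auto elim: eventually_mono)
  have "(chart B q \<circ> f \<circ> ichart A p) (chart A p x) = chart B q (f x)"
    by (simp add: ichart_chart[OF A x(1)])
  then have "((\<lambda>y. (chart C r \<circ> g \<circ> ichart B q) ((chart B q \<circ> f \<circ> ichart A p) y)) has_derivative
      (\<lambda>v. Drep B C g q r (f x) (Drep A B f p q x v))) (at (chart A p x))"
    using has_derivative_compose[OF mdiff_has_derivative[OF f x(1,2)], of "chart C r \<circ> g \<circ> ichart B q" "Drep B C g q r (f x)"]
      mdiff_has_derivative[OF g x(2,3)] by simp
  then show ?thesis
    by (rule has_derivative_transform_nhds) (use ev in \<open>auto elim!: eventually_mono simp: ichart_chart[OF B]\<close>)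
qed

lemma mdiff_compose:
  assumes A: "smooth_atlas A" and B: "smooth_atlas B"
    and f: "mdiff A B f x" and g: "mdiff B C g (f x)"
  shows "mdiff A C (\<lambda>x. g (f x)) x"
  unfolding mdiff_def
proof (intro conjI allI impI)
  show "filterlim (\<lambda>x. g (f x)) (nhds (g (f x))) (nhds x)"
    by (rule filterlim_compose[OF mdiff_tendsto[OF g] mdiff_tendsto[OF f]])
  show "chart C r \<circ> (\<lambda>x. g (f x)) \<circ> ichart A p differentiable at (chart A p x)"
    if "x \<in> cdom A p" "g (f x) \<in> cdom C r" for p r
    using has_derivative_rep_compose[OF A B f g that(1) atlas_mem[OF B] that(2)] differentiable_def by blast
qed

lemma Drep_compose:
  assumes "smooth_atlas A" "smooth_atlas B" "mdiff A B f x" "mdiff B C g (f x)"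
    "x \<in> cdom A p" "f x \<in> cdom B q" "g (f x) \<in> cdom C r"
  shows "Drep A C (\<lambda>x. g (f x)) p r x v = Drep B C g q r (f x) (Drep A B f p q x v)"
  using Drep_eqI[of C r "\<lambda>x. g (f x)" A p _ x, OF has_derivative_rep_compose[OF assms]] by simp

lemma tangent_map_compose:
  assumes "smooth_atlas A" "smooth_atlas B" "smooth_atlas C" "mdiff A B f x" "mdiff B C g (f x)"
  shows "tangent_map A C (\<lambda>x. g (f x)) x v = tangent_map B C g (f x) (tangent_map A B f x v)"
  unfolding tangent_map_eq_Drep using assms by (intro Drep_compose atlas_mem)

lemma smooth_map_mdiff:
  assumes f: "smooth_map_on A B W f" and x: "x \<in> W"
  shows "mdiff A B f x"
  unfolding mdiff_def
proof (intro conjI allI impI)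
  have W: "open W" and cont: "continuous_on W f" using f unfolding smooth_map_on_def by auto
  show "filterlim f (nhds (f x)) (nhds x)"
    unfolding filterlim_def le_filter_def eventually_filtermap
  proof (intro allI impI)
    fix P assume "\<forall>\<^sub>F z in nhds (f x). P z"
    then obtain V where V: "open V" "f x \<in> V" "\<And>z. z \<in> V \<Longrightarrow> P z" unfolding eventually_nhds by blast
    then show "\<forall>\<^sub>F z in nhds x. P (f z)"
      unfolding eventually_nhds using x continuous_open_preimage[OF cont W V(1)]
      by (intro exI[of _ "W \<inter> f -` V"]) auto
  qed
  fix p q assume "x \<in> cdom A p" "f x \<in> cdom B q"
  then show "chart B q \<circ> f \<circ> ichart A p differentiable at (chart A p x)"
    using f x unfolding smooth_map_on_def by (intro smooth_on_differentiable) auto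
qed

lemma mdiff_ident: assumes A: "smooth_atlas A" shows "mdiff A A (\<lambda>x. x) x"
  unfolding mdiff_def
proof (intro conjI allI impI)
  fix p q assume "x \<in> cdom A p" "x \<in> cdom A q"
  moreover have "smooth_on (chart A p ` (cdom A p \<inter> cdom A q)) (chart A q \<circ> ichart A p)"
    using A unfolding smooth_atlas_def by blast
  ultimately show "chart A q \<circ> (\<lambda>x. x) \<circ> ichart A p differentiable at (chart A p x)"
    using smooth_on_differentiable by (fastforce simp: comp_def)
qed (simp add: filterlim_ident)

lemma Drep_ident: assumes A: "smooth_atlas A" and x: "x \<in> cdom A p" shows "Drep A A (\<lambda>x. x) p p x v = v"
proof -
  have "(chart A p \<circ> (\<lambda>x. x) \<circ> ichart A p has_derivative (\<lambda>v. v)) (at (chart A p x))"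
    by (rule has_derivative_transform_within_open[OF has_derivative_ident atlas_open_image[OF A]])
      (use x in \<open>auto simp: ichart_chart[OF A]\<close>)
  from Drep_eqI[of A p "\<lambda>x. x" A p _ x, OF this] show ?thesis by simp
qed

lemma tangent_map_ident: "smooth_atlas A \<Longrightarrow> tangent_map A A (\<lambda>x. x) x v = v"
  unfolding tangent_map_eq_Drep by (intro Drep_ident atlas_mem)

lemma tangent_map_const: "tangent_map A B (\<lambda>x. c) x v = 0"
  by (simp add: tangent_map_def comp_def)

section \<open>Changes of chart and their compatibility with tangent maps\<close>

lemma to_chart_eq_Drep: "to_chart A p q = Drep A A (\<lambda>x. x) q p q"
  by (simp add: to_chart_def Drep_def comp_def)

lemma from_chart_eq_Drep: "from_chart A p q = Drep A A (\<lambda>x. x) p q q"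
  by (simp add: from_chart_def Drep_def comp_def)

lemma to_chart_self: "smooth_atlas A \<Longrightarrow> to_chart A p p v = v"
  unfolding to_chart_eq_Drep by (intro Drep_ident atlas_mem)

lemma from_chart_self: "smooth_atlas A \<Longrightarrow> from_chart A p p v = v"
  unfolding from_chart_eq_Drep by (intro Drep_ident atlas_mem)

lemma to_chart_from_chart: "smooth_atlas A \<Longrightarrow> q \<in> cdom A p \<Longrightarrow> to_chart A p q (from_chart A p q v) = v"
  unfolding to_chart_eq_Drep from_chart_eq_Drep
  using Drep_compose[of A A "\<lambda>x. x" q A "\<lambda>x. x" p q p v] mdiff_ident atlas_mem Drep_ident by metis

lemma from_chart_to_chart: "smooth_atlas A \<Longrightarrow> q \<in> cdom A p \<Longrightarrow> from_chart A p q (to_chart A p q v) = v"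
  unfolding to_chart_eq_Drep from_chart_eq_Drep
  using Drep_compose[of A A "\<lambda>x. x" q A "\<lambda>x. x" q p q v] mdiff_ident atlas_mem Drep_ident by metis

lemma to_chart_linear: "smooth_atlas A \<Longrightarrow> q \<in> cdom A p \<Longrightarrow> linear (to_chart A p q)"
  unfolding to_chart_eq_Drep using Drep_linear[OF mdiff_ident[of A q], of q p] atlas_mem[of A q] by simp

lemma from_chart_linear: "smooth_atlas A \<Longrightarrow> q \<in> cdom A p \<Longrightarrow> linear (from_chart A p q)"
  unfolding from_chart_eq_Drep using Drep_linear[OF mdiff_ident[of A q], of p q] atlas_mem[of A q] by simp

lemma to_chart_bounded: "smooth_atlas (A :: ('m::topological_space, 'e::real_inner) atlas) \<Longrightarrow> q \<in> cdom A p \<Longrightarrow> bounded_linear (to_chart A p q)"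
  using linear_bounded_linear[OF atlas_fin_dim to_chart_linear] by blast

lemma from_chart_bounded: "smooth_atlas (A :: ('m::topological_space, 'e::real_inner) atlas) \<Longrightarrow> q \<in> cdom A p \<Longrightarrow> bounded_linear (from_chart A p q)"
  using linear_bounded_linear[OF atlas_fin_dim from_chart_linear] by blast

lemma tangent_map_from_chart:
  assumes "smooth_atlas A" "smooth_atlas B" "mdiff A B f x" "x \<in> cdom A p"
  shows "tangent_map A B f x (from_chart A p x v) = Drep A B f p (f x) x v"
  unfolding tangent_map_eq_Drep from_chart_eq_Drep
  using Drep_compose[of A A "\<lambda>x. x" x B f p x "f x" v] assms mdiff_ident atlas_mem by metis

text \<open>Both sides are the derivative of \<open>f\<close> from chart \<open>p\<close> to the
  chart attached to \<open>f x\<close> itself.\<close>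

lemma from_chart_Drep:
  assumes "smooth_atlas A" "smooth_atlas B" "mdiff A B f x" "x \<in> cdom A p" "f x \<in> cdom B q"
  shows "from_chart B q (f x) (Drep A B f p q x v) = tangent_map A B f x (from_chart A p x v)"
  unfolding tangent_map_from_chart[OF assms(1-4)] unfolding from_chart_eq_Drep
  using Drep_compose[of A B f x B "\<lambda>x. x" p q "f x" v] assms mdiff_ident atlas_mem by metis

lemma to_chart_tangent_map:
  assumes "smooth_atlas A" "smooth_atlas B" "mdiff A B f x" "x \<in> cdom A p" "f x \<in> cdom B q"
  shows "to_chart B q (f x) (tangent_map A B f x v) = Drep A B f p q x (to_chart A p x v)"
  using from_chart_Drep[OF assms, of "to_chart A p x v"] to_chart_from_chart[OF assms(2,5)]
    from_chart_to_chart[OF assms(1,4)] by metis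

lemma smooth_map_open:
  assumes A: "smooth_atlas A" and B: "smooth_atlas B" and f: "smooth_map_on A B W f"
  shows "open (chart A p ` (cdom A p \<inter> W \<inter> f -` cdom B q))"
proof (rule open_chart_image[OF A])
  have "open (W \<inter> f -` cdom B q)"
    using f atlas_open[OF B] unfolding smooth_map_on_def by (intro continuous_open_preimage) auto
  then show "open (cdom A p \<inter> W \<inter> f -` cdom B q)" using atlas_open[OF A] by (simp add: Int_assoc open_Int)
qed auto

lemma smooth_map_rep: "smooth_map_on A B W f \<Longrightarrow>
    smooth_on (chart A p ` (cdom A p \<inter> W \<inter> f -` cdom B q)) (chart B q \<circ> f \<circ> ichart A p)"
  unfolding smooth_map_on_def by blast

section \<open>Two-forms and their pullbacks\<close>

lemma two_form_bilinear: "two_form A \<omega> \<Longrightarrow> bounded_bilinear (\<omega> x)"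
  unfolding two_form_def by blast

lemma two_form_antisym: assumes "two_form A \<omega>" shows "\<omega> x v w = - \<omega> x w v"
proof -
  interpret bounded_bilinear "\<omega> x" by (rule two_form_bilinear[OF assms])
  have "\<omega> x (v + w) (v + w) = 0" "\<omega> x v v = 0" "\<omega> x w w = 0" using assms unfolding two_form_def by auto
  then show ?thesis by (simp add: add_left add_right)
qed

lemma form2_linear_left:
  assumes A: "smooth_atlas A" and \<omega>: "two_form A \<omega>" and y: "y \<in> chart A p ` cdom A p"
  shows "linear (\<lambda>v. form2_in_chart A \<omega> p y v w)"
proof -
  interpret bounded_bilinear "\<omega> (ichart A p y)" by (rule two_form_bilinear[OF \<omega>])
  note l = from_chart_linear[OF A ichart_mem[OF A y]]
  show ?thesis unfolding form2_in_chart_def Let_def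
    by (rule linearI) (simp_all add: linear_add[OF l] linear_scale[OF l] add_left scaleR_left)
qed

lemma form2_antisym: "two_form A \<omega> \<Longrightarrow> form2_in_chart A \<omega> p y v w = - form2_in_chart A \<omega> p y w v"
  unfolding form2_in_chart_def Let_def by (rule two_form_antisym)

lemma form2_linear_right:
  assumes A: "smooth_atlas A" and \<omega>: "two_form A \<omega>" and y: "y \<in> chart A p ` cdom A p"
  shows "linear (\<lambda>w. form2_in_chart A \<omega> p y v w)"
  unfolding form2_antisym[OF \<omega>, of _ _ v]
  using linear_compose_neg[OF form2_linear_left[OF A \<omega> y]] .

lemma form2_in_chart_self: "smooth_atlas A \<Longrightarrow> form2_in_chart A \<omega> p (chart A p p) v w = \<omega> p v w"
  by (simp add: form2_in_chart_def Let_def ichart_chart atlas_mem from_chart_self)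

lemma smooth_form2:
  "two_form A \<omega> \<Longrightarrow> smooth_on (chart A p ` cdom A p) (\<lambda>y. form2_in_chart A \<omega> p y v w)"
  unfolding two_form_def by blast

text \<open>\<open>two_form\<close> controls components on constant vectors; the two linear slots
  are filled with varying vectors one after the other by \<open>smooth_on_apply\<close>.\<close>

lemma smooth_form2_apply:
  fixes B :: "('n::topological_space, 'f::real_inner) atlas"
  assumes B: "smooth_atlas B" and \<omega>: "two_form B \<omega>" and U: "open U"
    and F: "smooth_on U F" "\<And>y. y \<in> U \<Longrightarrow> F y \<in> chart B q ` cdom B q"
    and V: "smooth_on U V" and W: "smooth_on U W"
  shows "smooth_on U (\<lambda>y. form2_in_chart B \<omega> q (F y) (V y) (W y))"
proof -
  note fd = atlas_fin_dim[OF B]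
  have "smooth_on U (\<lambda>y. form2_in_chart B \<omega> q (F y) v w)" for v w
    by (rule smooth_on_compose[OF fd U atlas_open_image[OF B] F(2,1) smooth_form2[OF \<omega>]])
  then have "smooth_on U (\<lambda>y. form2_in_chart B \<omega> q (F y) (V y) w)" for w
    by (rule smooth_on_apply[where F="\<lambda>y v. form2_in_chart B \<omega> q (F y) v w" for w, OF fd U _ _ V, rotated])
      (rule form2_linear_left[OF B \<omega> F(2)])
  then show ?thesis
    by (rule smooth_on_apply[where F="\<lambda>y w. form2_in_chart B \<omega> q (F y) (V y) w", OF fd U _ _ W, rotated])
      (rule form2_linear_right[OF B \<omega> F(2)])
qed

lemma form2_pullback_in_chart:
  assumes A: "smooth_atlas A" and B: "smooth_atlas B" and y: "y \<in> chart A p ` cdom A p"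
    and f: "mdiff A B f (ichart A p y)" and q: "f (ichart A p y) \<in> cdom B q"
  shows "form2_in_chart A (pullback2 A B f \<omega>) p y v w =
    form2_in_chart B \<omega> q ((chart B q \<circ> f \<circ> ichart A p) y)
      (frechet_derivative (chart B q \<circ> f \<circ> ichart A p) (at y) v)
      (frechet_derivative (chart B q \<circ> f \<circ> ichart A p) (at y) w)"
proof -
  have "frechet_derivative (chart B q \<circ> f \<circ> ichart A p) (at y) = Drep A B f p q (ichart A p y)"
    by (simp add: Drep_def chart_ichart[OF A y])
  then show ?thesis
    by (simp add: form2_in_chart_def pullback2_def Let_def ichart_chart[OF B q] from_chart_Drep[OF A B f ichart_mem[OF A y] q])
qed

lemma two_form_pullback:
  fixes A :: "('m::topological_space, 'e::real_inner) atlas" and B :: "('n::topological_space, 'f::real_inner) atlas"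
  assumes A: "smooth_atlas A" and B: "smooth_atlas B" and f: "smooth_map_on A B UNIV f" and \<omega>: "two_form B \<omega>"
  shows "two_form A (pullback2 A B f \<omega>)"
  unfolding two_form_def
proof (intro conjI allI)
  fix p v w
  have "bounded_linear (tangent_map A B f p)"
    by (intro linear_bounded_linear[OF atlas_fin_dim[OF A]] tangent_map_linear A B smooth_map_mdiff[OF f] UNIV_I)
  from bounded_bilinear.comp[OF two_form_bilinear[OF \<omega>] this this]
  show "bounded_bilinear (pullback2 A B f \<omega> p)" by (simp add: pullback2_def[abs_def])
  show "pullback2 A B f \<omega> p v v = 0" using \<omega> by (simp add: pullback2_def two_form_def)
  show "smooth_on (chart A p ` cdom A p) (\<lambda>y. form2_in_chart A (pullback2 A B f \<omega>) p y v w)"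
  proof (rule smooth_on_local)
    fix y assume y: "y \<in> chart A p ` cdom A p"
    \<comment> \<open>Smoothness is a local matter, so near \<open>y\<close> the target chart
      attached to the image point can be used.\<close>
    define q where "q = f (ichart A p y)"
    define U where "U = chart A p ` (cdom A p \<inter> UNIV \<inter> f -` cdom B q)"
    define F where "F = chart B q \<circ> f \<circ> ichart A p"
    have U: "open U" unfolding U_def by (rule smooth_map_open[OF A B f])
    have yU: "y \<in> U" unfolding U_def using y atlas_mem[OF B, of q]
      by (auto simp: q_def intro!: image_eqI[of _ _ "ichart A p y"] simp: chart_ichart[OF A] ichart_mem[OF A])
    have F: "smooth_on U F" unfolding U_def F_def by (rule smooth_map_rep[OF f])
    have Uy: "z \<in> chart A p ` cdom A p" "f (ichart A p z) \<in> cdom B q" "F z \<in> chart B q ` cdom B q" if "z \<in> U" for z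
      using that by (auto simp: U_def F_def ichart_chart[OF A])
    have "smooth_on U (\<lambda>y. form2_in_chart B \<omega> q (F y) (frechet_derivative F (at y) v) (frechet_derivative F (at y) w))"
      by (intro smooth_form2_apply[OF B \<omega> U F] Uy smooth_on_frechet F)
    then have "smooth_on U (\<lambda>y. form2_in_chart A (pullback2 A B f \<omega>) p y v w)"
      by (rule smooth_on_cong[OF U, rotated])
        (simp add: form2_pullback_in_chart[OF A B Uy(1) smooth_map_mdiff[OF f UNIV_I] Uy(2)] F_def)
    then show "\<exists>T. open T \<and> y \<in> T \<and> smooth_on T (\<lambda>y. form2_in_chart A (pullback2 A B f \<omega>) p y v w)"
      using U yU by blast
  qed
qed

text \<open>Differentiating the coordinate expression gives \<open>d_form2\<close> of \<omega> on
  the images of \<open>u\<close>, \<open>v\<close>, \<open>w\<close>, plus six terms containing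
  second derivatives of \<open>F\<close>, which cancel.\<close>

lemma closed_form_pullback:
  fixes A :: "('m::topological_space, 'e::real_inner) atlas" and B :: "('n::topological_space, 'f::real_inner) atlas"
  assumes A: "smooth_atlas A" and B: "smooth_atlas B" and f: "smooth_map_on A B UNIV f" and \<omega>: "two_form B \<omega>"
    and closed: "closed_form B \<omega>"
  shows "closed_form A (pullback2 A B f \<omega>)"
  unfolding closed_form_def
proof (intro allI)
  fix p u v w
  define q where "q = f p"
  define U where "U = chart A p ` (cdom A p \<inter> UNIV \<inter> f -` cdom B q)"
  define F where "F = chart B q \<circ> f \<circ> ichart A p"
  define y where "y = chart A p p"
  let ?D = "\<lambda>z. frechet_derivative F (at z)"
  let ?W = "form2_in_chart B \<omega> q"
  let ?W' = "\<lambda>a b. frechet_derivative (\<lambda>z. ?W z a b) (at (chart B q q))"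
  let ?DD = "\<lambda>a. frechet_derivative (\<lambda>z. ?D z a) (at y)"
  note fdA = atlas_fin_dim[OF A] and fdB = atlas_fin_dim[OF B]
  have U: "open U" unfolding U_def by (rule smooth_map_open[OF A B f])
  have yU: "y \<in> U" unfolding U_def y_def using atlas_mem[OF A, of p] atlas_mem[OF B, of q] by (auto simp: q_def)
  have F: "smooth_on U F" unfolding U_def F_def by (rule smooth_map_rep[OF f])
  have Uy: "z \<in> chart A p ` cdom A p" "f (ichart A p z) \<in> cdom B q" "F z \<in> chart B q ` cdom B q" if "z \<in> U" for z
    using that by (auto simp: U_def F_def ichart_chart[OF A])
  have Fy: "F y = chart B q q" by (simp add: F_def y_def q_def ichart_chart[OF A] atlas_mem[OF A])
  have der: "frechet_derivative (\<lambda>z. form2_in_chart A (pullback2 A B f \<omega>) p z a b) (at y) c =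
     ?W' (?D y a) (?D y b) (?D y c) + ?W (F y) (?DD a c) (?D y b) + ?W (F y) (?D y a) (?DD b c)" for a b c
  proof -
    have 1: "((\<lambda>z. ?W (F z) k l) has_derivative (\<lambda>c. ?W' k l (?D y c))) (at y)" for k l
      by (rule has_derivative_compose[OF smooth_on_has_derivative[OF F yU]])
        (use smooth_on_has_derivative[OF smooth_form2[OF \<omega>] Uy(3)[OF yU]] Fy in simp)
    have 2: "((\<lambda>z. ?D z a) has_derivative ?DD a) (at y)" for a
      by (rule smooth_on_has_derivative[OF smooth_on_frechet[OF F] yU])
    have 3: "((\<lambda>z. ?W (F z) (?D z a) l) has_derivative (\<lambda>c. ?W' (?D y a) l (?D y c) + ?W (F y) (?DD a c) l)) (at y)" for l
      by (rule has_derivative_apply[OF fdB U yU _ 1 2]) (rule form2_linear_left[OF B \<omega> Uy(3)])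
    have "((\<lambda>z. ?W (F z) (?D z a) (?D z b)) has_derivative
        (\<lambda>c. (?W' (?D y a) (?D y b) (?D y c) + ?W (F y) (?DD a c) (?D y b)) + ?W (F y) (?D y a) (?DD b c))) (at y)"
      by (rule has_derivative_apply[OF fdB U yU _ 3 2]) (rule form2_linear_right[OF B \<omega> Uy(3)])
    then have "((\<lambda>z. form2_in_chart A (pullback2 A B f \<omega>) p z a b) has_derivative
        (\<lambda>c. (?W' (?D y a) (?D y b) (?D y c) + ?W (F y) (?DD a c) (?D y b)) + ?W (F y) (?D y a) (?DD b c))) (at y)"
      by (rule has_derivative_transform_within_open[OF _ U yU])
        (simp add: form2_pullback_in_chart[OF A B Uy(1) smooth_map_mdiff[OF f UNIV_I] Uy(2)] F_def)
    from frechet_derivative_at[OF this, symmetric] show ?thesis by simp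
  qed
  have sym: "?DD a b = ?DD b a" for a b by (rule symmetric_second_derivative[OF fdB U yU F])
  have "d_form2 B \<omega> q (?D y u) (?D y v) (?D y w) = 0" using closed unfolding closed_form_def by blast
  \<comment> \<open>Symmetry of second derivatives cancels four of the six terms; the remaining two
    contain the mixed derivative in \<open>u\<close> and \<open>w\<close> in opposite slots next to
    \<open>?D y v\<close> and cancel by antisymmetry.\<close>
  then show "d_form2 A (pullback2 A B f \<omega>) p u v w = 0"
    unfolding d_form2_def y_def[symmetric] der sym[of v u] sym[of w u] sym[of w v]
    using form2_antisym[OF \<omega>, of q "F y" "?D y v" "?DD u w"] form2_antisym[OF \<omega>, of q "F y" "?D y u" "?DD v w"]
    by linarith
qed

section \<open>Tangent maps along an equalizer of two smooth maps\<close>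

lemma chart_inj: "smooth_atlas A \<Longrightarrow> inj_on (chart A p) (cdom A p)"
  by (rule inj_on_inverseI[of _ "ichart A p"]) (rule ichart_chart)

lemma ichart_image_mem: "smooth_atlas A \<Longrightarrow> y \<in> chart A p ` X \<Longrightarrow> X \<subseteq> cdom A p \<Longrightarrow> ichart A p y \<in> X"
  by (auto simp: ichart_chart subset_iff)

text \<open>The tangent map of a map given on the submanifold \<open>{f = g}\<close> only depends on its values there.\<close>

lemma tangent_map_eq_on_equalizer:
  fixes A :: "('m::topological_space, 'e::real_inner) atlas" and B :: "('n::topological_space, 'f::real_inner) atlas"
    and Q :: "('q::topological_space, 'h::real_inner) atlas"
  assumes A: "smooth_atlas A" and B: "smooth_atlas B" and Q: "smooth_atlas Q"
    and f: "smooth_map_on A B W f" and g: "smooth_map_on A B W g" and p: "p \<in> W" "f p = g p"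
    and surj: "surj (\<lambda>v. tangent_map A B f p v - tangent_map A B g p v)"
    and v: "tangent_map A B f p v = tangent_map A B g p v"
    and F: "mdiff A Q F p" and K: "mdiff A Q K p"
    and ev: "\<forall>\<^sub>F z in nhds p. f z = g z \<longrightarrow> F z = K z"
  shows "tangent_map A Q F p v = tangent_map A Q K p v"
proof -
  obtain V where V: "open V" "p \<in> V" "\<And>z. z \<in> V \<Longrightarrow> f z = g z \<Longrightarrow> F z = K z"
    using ev unfolding eventually_nhds by blast
  define q where "q = f p"
  define U1 where "U1 = chart A p ` (cdom A p \<inter> W \<inter> f -` cdom B q)"
  define U2 where "U2 = chart A p ` (cdom A p \<inter> W \<inter> g -` cdom B q)"
  define U where "U = U1 \<inter> U2 \<inter> chart A p ` (cdom A p \<inter> V)"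
  \<comment> \<open>In charts the equalizer is the zero set of \<open>H\<close>, whose derivative is
    the difference of the tangent maps; \<open>surj\<close> says that \<open>H\<close> is a
    submersion at the point.\<close>
  define H where "H y = (chart B q \<circ> f \<circ> ichart A p) y - (chart B q \<circ> g \<circ> ichart A p) y" for y
  have U: "open U" unfolding U_def U1_def U2_def
    by (intro open_Int smooth_map_open[OF A B] f g open_chart_image[OF A] V atlas_open[OF A]) auto
  have pU: "chart A p p \<in> U" unfolding U_def U1_def U2_def
    using V p atlas_mem[OF A, of p] atlas_mem[OF B, of q] by (auto simp: q_def)
  have sf: "smooth_on U (chart B q \<circ> f \<circ> ichart A p)" and sg: "smooth_on U (chart B q \<circ> g \<circ> ichart A p)"
    using smooth_on_subset[OF smooth_map_rep[OF f, of p q], of U] smooth_on_subset[OF smooth_map_rep[OF g, of p q], of U]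
    unfolding U_def U1_def U2_def by auto
  have H: "smooth_on U H" unfolding H_def by (rule smooth_on_diff[OF U sf sg])
  have H0: "H (chart A p p) = 0" using p by (simp add: H_def ichart_chart[OF A] atlas_mem[OF A])
  have "(H has_derivative (\<lambda>v. tangent_map A B f p v - tangent_map A B g p v)) (at (chart A p p))"
    unfolding H_def tangent_map_def p(2)[symmetric] q_def[symmetric]
    by (intro has_derivative_diff smooth_on_has_derivative[OF sf pU] smooth_on_has_derivative[OF sg pU])
  then have DH: "frechet_derivative H (at (chart A p p)) = (\<lambda>v. tangent_map A B f p v - tangent_map A B g p v)"
    using frechet_derivative_at by metis
  have FK: "F p = K p" using V p by blast
  show ?thesis unfolding tangent_map_def FK[symmetric]
  proof (rule derivative_eq_along_level_set[OF atlas_fin_dim[OF A] atlas_fin_dim[OF B] U pU H H0])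
    show "surj (frechet_derivative H (at (chart A p p)))" using surj by (simp add: DH)
    show "frechet_derivative H (at (chart A p p)) v = 0" using v by (simp add: DH)
    show "chart Q (F p) \<circ> F \<circ> ichart A p differentiable at (chart A p p)"
      using F atlas_mem[OF A] atlas_mem[OF Q] unfolding mdiff_def by blast
    show "chart Q (F p) \<circ> K \<circ> ichart A p differentiable at (chart A p p)"
      using K atlas_mem[OF A] atlas_mem[OF Q] unfolding mdiff_def FK by blast
    fix y assume y: "y \<in> U" "H y = 0"
    define z where "z = ichart A p y"
    have z: "z \<in> V" "f z \<in> cdom B q" "g z \<in> cdom B q"
      using y(1) ichart_image_mem[OF A, of y p "cdom A p \<inter> V"] ichart_image_mem[OF A, of y p "cdom A p \<inter> W \<inter> f -` cdom B q"]
        ichart_image_mem[OF A, of y p "cdom A p \<inter> W \<inter> g -` cdom B q"]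
      by (auto simp: z_def U_def U1_def U2_def)
    have "chart B q (f z) = chart B q (g z)" using y(2) by (simp add: H_def z_def)
    then have "f z = g z" using z ichart_chart[OF B] by metis
    then show "(chart Q (F p) \<circ> F \<circ> ichart A p) y = (chart Q (F p) \<circ> K \<circ> ichart A p) y"
      using V(3) z by (simp add: z_def)
  qed
qed

section \<open>Constructions with smooth maps and product manifolds\<close>

lemma smooth_map_ident: assumes A: "smooth_atlas A" shows "smooth_map_on A A UNIV (\<lambda>x. x)"
  using A unfolding smooth_map_on_def smooth_atlas_def by (simp add: vimage_def comp_def)

lemma smooth_map_const: "smooth_map_on A B UNIV (\<lambda>x. c)"
  unfolding smooth_map_on_def by (simp add: comp_def smooth_on_const)

lemma smooth_map_compose:
  fixes A :: "('m::topological_space, 'e::real_inner) atlas" and B :: "('n::topological_space, 'f::real_inner) atlas"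
    and C :: "('q::topological_space, 'h::real_inner) atlas"
  assumes A: "smooth_atlas A" and B: "smooth_atlas B" and C: "smooth_atlas C"
    and f: "smooth_map_on A B W f" and g: "smooth_map_on B C V g"
  shows "smooth_map_on A C (W \<inter> f -` V) (\<lambda>x. g (f x))"
proof -
  have W: "open (W \<inter> f -` V)" using f g unfolding smooth_map_on_def by (auto intro: continuous_open_preimage)
  have co: "continuous_on (W \<inter> f -` V) (\<lambda>x. g (f x))"
    by (rule continuous_on_compose2[of V g]) (use f g in \<open>auto simp: smooth_map_on_def intro: continuous_on_subset\<close>)
  have "smooth_on (chart A p ` (cdom A p \<inter> (W \<inter> f -` V) \<inter> (\<lambda>x. g (f x)) -` cdom C r)) (chart C r \<circ> (\<lambda>x. g (f x)) \<circ> ichart A p)" for p r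
  proof (rule smooth_on_local)
    fix y assume y: "y \<in> chart A p ` (cdom A p \<inter> (W \<inter> f -` V) \<inter> (\<lambda>x. g (f x)) -` cdom C r)"
    then obtain x where x: "y = chart A p x" "x \<in> cdom A p" "x \<in> W" "f x \<in> V" "g (f x) \<in> cdom C r" by auto
    define q where "q = f x"
    define U where "U = chart A p ` (cdom A p \<inter> W \<inter> f -` cdom B q)"
    define T where "T = chart B q ` (cdom B q \<inter> V \<inter> g -` cdom C r)"
    define F where "F = chart B q \<circ> f \<circ> ichart A p"
    have U: "open U" unfolding U_def by (rule smooth_map_open[OF A B f])
    have T: "open T" unfolding T_def by (rule smooth_map_open[OF B C g])
    have F: "smooth_on U F" unfolding U_def F_def by (rule smooth_map_rep[OF f])
    have S: "open (U \<inter> F -` T)" by (rule continuous_open_preimage[OF smooth_on_continuous[OF F] U T])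
    have "smooth_on (U \<inter> F -` T) (\<lambda>y. (chart C r \<circ> g \<circ> ichart B q) (F y))"
      by (rule smooth_on_compose[OF atlas_fin_dim[OF B] S T _ smooth_on_subset[OF F] smooth_map_rep[OF g, of q r, folded T_def]]) auto
    then have "smooth_on (U \<inter> F -` T) (chart C r \<circ> (\<lambda>x. g (f x)) \<circ> ichart A p)"
      by (rule smooth_on_cong[OF S, rotated]) (auto simp: U_def F_def ichart_chart[OF A] ichart_chart[OF B])
    moreover have "y \<in> U \<inter> F -` T"
      using x atlas_mem[OF B, of q] unfolding U_def T_def F_def by (auto simp: ichart_chart[OF A] q_def)
    ultimately show "\<exists>T. open T \<and> y \<in> T \<and> smooth_on T (chart C r \<circ> (\<lambda>x. g (f x)) \<circ> ichart A p)"
      using S by blast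
  qed
  then show ?thesis using W co unfolding smooth_map_on_def by blast
qed

lemma cdom_prod: "cdom (prod_atlas A B) (p, q) = cdom A p \<times> cdom B q"
  by (simp add: prod_atlas_def)

lemma chart_prod: "chart (prod_atlas A B) (p, q) (x, y) = (chart A p x, chart B q y)"
  by (simp add: prod_atlas_def)

lemma chart_prod_image: "chart (prod_atlas A B) (p, q) ` (X \<times> Y) = (chart A p ` X) \<times> (chart B q ` Y)"
  by (auto simp: chart_prod image_iff)

text \<open>\<open>ichart\<close> is an \<open>inv_into\<close>, so its value on a pair is
  identified through injectivity of the product chart, on the product of the chart images.\<close>

lemma ichart_prod:
  assumes A: "smooth_atlas A" and B: "smooth_atlas B"
    and y: "y \<in> chart A p ` cdom A p" and z: "z \<in> chart B q ` cdom B q"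
  shows "ichart (prod_atlas A B) (p, q) (y, z) = (ichart A p y, ichart B q z)"
proof -
  have "inj_on (chart (prod_atlas A B) (p, q)) (cdom A p \<times> cdom B q)"
    using chart_inj[OF A, of p] chart_inj[OF B, of q] by (auto simp: inj_on_def chart_prod)
  moreover have "(y, z) = chart (prod_atlas A B) (p, q) (ichart A p y, ichart B q z)"
    by (simp add: chart_prod chart_ichart[OF A y] chart_ichart[OF B z])
  ultimately show ?thesis
    unfolding ichart_def[of "prod_atlas A B"] cdom_prod
    using ichart_mem[OF A y] ichart_mem[OF B z] by (simp add: inv_into_f_f)
qed

lemma finite_spanning_prod:
  fixes E :: "'a::real_vector set" and F :: "'b::real_vector set"
  assumes "finite E" "span E = UNIV" "finite F" "span F = UNIV"
  shows "\<exists>S::('a \<times> 'b) set. finite S \<and> span S = UNIV"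
proof -
  let ?i = "\<lambda>x. (x, 0 :: 'b)" and ?j = "\<lambda>y. (0 :: 'a, y)"
  have i: "linear ?i" and j: "linear ?j" by (auto intro!: linearI)
  let ?S = "?i ` E \<union> ?j ` F"
  have "(x, y) \<in> span ?S" for x y
  proof -
    have "?i x \<in> span (?i ` E)"
      by (metis UNIV_I assms(2) i image_eqI linear_span_image)
    moreover have "?j y \<in> span (?j ` F)"
      by (metis UNIV_I assms(4) j image_eqI linear_span_image)
    ultimately have "?i x + ?j y \<in> span ?S"
      by (intro span_add) (meson span_mono subsetD sup_ge1 sup_ge2)+
    then show ?thesis by simp
  qed
  then have "span ?S = UNIV" by auto
  then show ?thesis using assms by (intro exI[of _ ?S]) auto
qed

lemma smooth_atlas_prod:
  fixes A :: "('m::topological_space, 'e::real_inner) atlas" and B :: "('n::topological_space, 'f::real_inner) atlas"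
  assumes A: "smooth_atlas A" and B: "smooth_atlas B"
  shows "smooth_atlas (prod_atlas A B)"
  unfolding smooth_atlas_def
proof (intro conjI allI)
  show "\<exists>E::('e \<times> 'f) set. finite E \<and> span E = UNIV"
    using A B finite_spanning_prod unfolding smooth_atlas_def by blast
  fix r :: "'m \<times> 'n"
  obtain p q where r: "r = (p, q)" by (cases r)
  let ?P = "prod_atlas A B"
  show "r \<in> cdom ?P r" by (simp add: r cdom_prod atlas_mem[OF A] atlas_mem[OF B])
  show "open (cdom ?P r)" by (simp add: r cdom_prod open_Times atlas_open[OF A] atlas_open[OF B])
  show "open (chart ?P r ` cdom ?P r)"
    by (simp add: r cdom_prod chart_prod_image open_Times atlas_open_image[OF A] atlas_open_image[OF B])
  have c1: "continuous_on (cdom A p) (chart A p)" and c2: "continuous_on (cdom B q) (chart B q)"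
    using homeomorphism_cont1[OF atlas_homeo[OF A]] homeomorphism_cont1[OF atlas_homeo[OF B]] by auto
  have d1: "continuous_on (chart A p ` cdom A p) (ichart A p)" and d2: "continuous_on (chart B q ` cdom B q) (ichart B q)"
    using homeomorphism_cont2[OF atlas_homeo[OF A]] homeomorphism_cont2[OF atlas_homeo[OF B]] by auto
  show "homeomorphism (cdom ?P r) (chart ?P r ` cdom ?P r) (chart ?P r) (ichart ?P r)"
    unfolding r cdom_prod chart_prod_image
  proof (rule homeomorphismI)
    have "continuous_on (cdom A p \<times> cdom B q) (\<lambda>x. (chart A p (fst x), chart B q (snd x)))"
      by (intro continuous_on_Pair continuous_on_compose2[OF c1] continuous_on_compose2[OF c2] continuous_intros) auto
    then show "continuous_on (cdom A p \<times> cdom B q) (chart ?P (p, q))"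
      by (rule continuous_on_eq) (auto simp: chart_prod)
    have "continuous_on (chart A p ` cdom A p \<times> chart B q ` cdom B q) (\<lambda>x. (ichart A p (fst x), ichart B q (snd x)))"
      by (intro continuous_on_Pair continuous_on_compose2[OF d1] continuous_on_compose2[OF d2] continuous_intros) auto
    then show "continuous_on (chart A p ` cdom A p \<times> chart B q ` cdom B q) (ichart ?P (p, q))"
      by (rule continuous_on_eq) (auto simp: ichart_prod[OF A B])
  qed (auto simp: chart_prod ichart_prod[OF A B] ichart_chart[OF A] ichart_chart[OF B])
next
  fix r r' :: "'m \<times> 'n"
  obtain p q p' q' where r: "r = (p, q)" "r' = (p', q')" by (cases r, cases r')
  let ?P = "prod_atlas A B"
  let ?U = "chart A p ` (cdom A p \<inter> cdom A p')" and ?V = "chart B q ` (cdom B q \<inter> cdom B q')"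
  have UV: "open ?U" "open ?V"
    by (auto intro!: open_chart_image A B atlas_open[OF A] atlas_open[OF B])
  have s: "smooth_on ?U (chart A p' \<circ> ichart A p)" "smooth_on ?V (chart B q' \<circ> ichart B q)"
    using A B unfolding smooth_atlas_def by auto
  have "smooth_on (?U \<times> ?V) (\<lambda>x. ((chart A p' \<circ> ichart A p) (fst x), (chart B q' \<circ> ichart B q) (snd x)))"
    by (intro smooth_on_Pair open_Times UV smooth_on_compose[OF atlas_fin_dim[OF A] _ UV(1) _ _ s(1)]
        smooth_on_compose[OF atlas_fin_dim[OF B] _ UV(2) _ _ s(2)] smooth_on_bounded_linear[OF bounded_linear_fst]
        smooth_on_bounded_linear[OF bounded_linear_snd] smooth_on_ident) auto
  then have "smooth_on (?U \<times> ?V) (chart ?P r' \<circ> ichart ?P r)"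
    by (rule smooth_on_cong[OF open_Times[OF UV], rotated])
      (auto simp: r chart_prod ichart_prod[OF A B] ichart_chart[OF A] ichart_chart[OF B])
  moreover have "cdom ?P r \<inter> cdom ?P r' = (cdom A p \<inter> cdom A p') \<times> (cdom B q \<inter> cdom B q')"
    by (auto simp: r cdom_prod)
  ultimately show "smooth_on (chart ?P r ` (cdom ?P r \<inter> cdom ?P r')) (chart ?P r' \<circ> ichart ?P r)"
    by (simp add: r(1) chart_prod_image)
qed

lemma smooth_map_fst:
  fixes A :: "('m::topological_space, 'e::real_inner) atlas" and B :: "('n::topological_space, 'f::real_inner) atlas"
  assumes A: "smooth_atlas A" and B: "smooth_atlas B"
  shows "smooth_map_on (prod_atlas A B) A UNIV fst"
  unfolding smooth_map_on_def
proof (intro conjI allI)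
  fix r :: "'m \<times> 'n" and p'
  obtain p q where r: "r = (p, q)" by (cases r)
  let ?U = "chart A p ` (cdom A p \<inter> cdom A p')" and ?V = "chart B q ` cdom B q"
  have UV: "open ?U" "open ?V"
    by (auto intro!: open_chart_image A B atlas_open[OF A] atlas_open[OF B])
  have s: "smooth_on ?U (chart A p' \<circ> ichart A p)"
    using A unfolding smooth_atlas_def by auto
  have "smooth_on (?U \<times> ?V) (\<lambda>x. (chart A p' \<circ> ichart A p) (fst x))"
    by (intro open_Times UV smooth_on_compose[OF atlas_fin_dim[OF A] _ UV(1) _ _ s] smooth_on_bounded_linear[OF bounded_linear_fst]
        smooth_on_ident) auto
  then have "smooth_on (?U \<times> ?V) (chart A p' \<circ> fst \<circ> ichart (prod_atlas A B) r)"
    by (rule smooth_on_cong[OF open_Times[OF UV], rotated])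
      (auto simp: r chart_prod ichart_prod[OF A B] ichart_chart[OF A] ichart_chart[OF B])
  moreover have "cdom (prod_atlas A B) r \<inter> UNIV \<inter> fst -` cdom A p' = (cdom A p \<inter> cdom A p') \<times> cdom B q"
    by (auto simp: r cdom_prod)
  ultimately show "smooth_on (chart (prod_atlas A B) r ` (cdom (prod_atlas A B) r \<inter> UNIV \<inter> fst -` cdom A p'))
      (chart A p' \<circ> fst \<circ> ichart (prod_atlas A B) r)"
    by (simp add: r chart_prod_image)
qed (auto intro: continuous_intros)

lemma smooth_map_snd:
  fixes A :: "('m::topological_space, 'e::real_inner) atlas" and B :: "('n::topological_space, 'f::real_inner) atlas"
  assumes A: "smooth_atlas A" and B: "smooth_atlas B"
  shows "smooth_map_on (prod_atlas A B) B UNIV snd"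
  unfolding smooth_map_on_def
proof (intro conjI allI)
  fix r :: "'m \<times> 'n" and q'
  obtain p q where r: "r = (p, q)" by (cases r)
  let ?V = "chart B q ` (cdom B q \<inter> cdom B q')" and ?U = "chart A p ` cdom A p"
  have UV: "open ?U" "open ?V"
    by (auto intro!: open_chart_image A B atlas_open[OF A] atlas_open[OF B])
  have s: "smooth_on ?V (chart B q' \<circ> ichart B q)"
    using B unfolding smooth_atlas_def by auto
  have "smooth_on (?U \<times> ?V) (\<lambda>x. (chart B q' \<circ> ichart B q) (snd x))"
    by (intro open_Times UV smooth_on_compose[OF atlas_fin_dim[OF B] _ UV(2) _ _ s] smooth_on_bounded_linear[OF bounded_linear_snd]
        smooth_on_ident) auto
  then have "smooth_on (?U \<times> ?V) (chart B q' \<circ> snd \<circ> ichart (prod_atlas A B) r)"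
    by (rule smooth_on_cong[OF open_Times[OF UV], rotated])
      (auto simp: r chart_prod ichart_prod[OF A B] ichart_chart[OF A] ichart_chart[OF B])
  moreover have "cdom (prod_atlas A B) r \<inter> UNIV \<inter> snd -` cdom B q' = cdom A p \<times> (cdom B q \<inter> cdom B q')"
    by (auto simp: r cdom_prod)
  ultimately show "smooth_on (chart (prod_atlas A B) r ` (cdom (prod_atlas A B) r \<inter> UNIV \<inter> snd -` cdom B q'))
      (chart B q' \<circ> snd \<circ> ichart (prod_atlas A B) r)"
    by (simp add: r chart_prod_image)
qed (auto intro: continuous_intros)

lemma smooth_map_Pair:
  fixes A :: "('m::topological_space, 'e::real_inner) atlas" and B :: "('n::topological_space, 'f::real_inner) atlas"
    and C :: "('q::topological_space, 'h::real_inner) atlas"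
  assumes A: "smooth_atlas A" and B: "smooth_atlas B" and C: "smooth_atlas C"
    and f: "smooth_map_on A B W f" and g: "smooth_map_on A C W g"
  shows "smooth_map_on A (prod_atlas B C) W (\<lambda>x. (f x, g x))"
  unfolding smooth_map_on_def
proof (intro conjI allI)
  show "open W" "continuous_on W (\<lambda>x. (f x, g x))"
    using f g unfolding smooth_map_on_def by (auto intro: continuous_intros)
  fix p and r :: "'n \<times> 'q"
  obtain q q' where r: "r = (q, q')" by (cases r)
  let ?U = "chart A p ` (cdom A p \<inter> W \<inter> f -` cdom B q)" and ?V = "chart A p ` (cdom A p \<inter> W \<inter> g -` cdom C q')"
  let ?S = "chart A p ` (cdom A p \<inter> W \<inter> (\<lambda>x. (f x, g x)) -` cdom (prod_atlas B C) r)"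
  have "cdom A p \<inter> W \<inter> (\<lambda>x. (f x, g x)) -` cdom (prod_atlas B C) r = (cdom A p \<inter> W \<inter> f -` cdom B q) \<inter> (cdom A p \<inter> W \<inter> g -` cdom C q')"
    by (auto simp: r cdom_prod)
  then have S: "?S = ?U \<inter> ?V"
    using inj_on_image_Int[OF chart_inj[OF A, of p], of "cdom A p \<inter> W \<inter> f -` cdom B q" "cdom A p \<inter> W \<inter> g -` cdom C q'"] by auto
  have oS: "open ?S" unfolding S by (intro open_Int smooth_map_open[OF A B f] smooth_map_open[OF A C g])
  have "smooth_on ?S (\<lambda>y. ((chart B q \<circ> f \<circ> ichart A p) y, (chart C q' \<circ> g \<circ> ichart A p) y))"
    by (intro smooth_on_Pair oS smooth_on_subset[OF smooth_map_rep[OF f]] smooth_on_subset[OF smooth_map_rep[OF g]])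
      (auto simp: S)
  then show "smooth_on ?S (chart (prod_atlas B C) r \<circ> (\<lambda>x. (f x, g x)) \<circ> ichart A p)"
    by (rule smooth_on_cong[OF oS, rotated]) (simp add: r chart_prod)
qed

lemma Drep_fst:
  fixes A :: "('m::topological_space, 'e::real_inner) atlas" and B :: "('n::topological_space, 'f::real_inner) atlas"
  assumes A: "smooth_atlas A" and B: "smooth_atlas B" and x: "x \<in> cdom A p" and y: "y \<in> cdom B q"
  shows "Drep (prod_atlas A B) A fst (p, q) p (x, y) = fst"
proof (rule Drep_eqI)
  show "(chart A p \<circ> fst \<circ> ichart (prod_atlas A B) (p, q) has_derivative fst) (at (chart (prod_atlas A B) (p, q) (x, y)))"
    by (rule has_derivative_transform_within_open[OF has_derivative_fst[OF has_derivative_ident] open_Times[OF atlas_open_image[OF A, of p] atlas_open_image[OF B, of q]]])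
      (auto simp: x y chart_prod ichart_prod[OF A B] ichart_chart[OF A])
qed

lemma Drep_snd:
  fixes A :: "('m::topological_space, 'e::real_inner) atlas" and B :: "('n::topological_space, 'f::real_inner) atlas"
  assumes A: "smooth_atlas A" and B: "smooth_atlas B" and x: "x \<in> cdom A p" and y: "y \<in> cdom B q"
  shows "Drep (prod_atlas A B) B snd (p, q) q (x, y) = snd"
proof (rule Drep_eqI)
  show "(chart B q \<circ> snd \<circ> ichart (prod_atlas A B) (p, q) has_derivative snd) (at (chart (prod_atlas A B) (p, q) (x, y)))"
    by (rule has_derivative_transform_within_open[OF has_derivative_snd[OF has_derivative_ident] open_Times[OF atlas_open_image[OF A, of p] atlas_open_image[OF B, of q]]])
      (auto simp: x y chart_prod ichart_prod[OF A B] ichart_chart[OF B])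
qed

lemma tangent_map_fst:
  fixes A :: "('m::topological_space, 'e::real_inner) atlas" and B :: "('n::topological_space, 'f::real_inner) atlas"
  assumes A: "smooth_atlas A" and B: "smooth_atlas B"
  shows "tangent_map (prod_atlas A B) A fst (p, q) (v, w) = v"
  using Drep_fst[OF A B atlas_mem[OF A] atlas_mem[OF B]] by (simp add: tangent_map_eq_Drep)

lemma tangent_map_snd:
  fixes A :: "('m::topological_space, 'e::real_inner) atlas" and B :: "('n::topological_space, 'f::real_inner) atlas"
  assumes A: "smooth_atlas A" and B: "smooth_atlas B"
  shows "tangent_map (prod_atlas A B) B snd (p, q) (v, w) = w"
  using Drep_snd[OF A B atlas_mem[OF A] atlas_mem[OF B]] by (simp add: tangent_map_eq_Drep)

text \<open>Composing with the projections recovers the components, so the chain rule suffices and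
  the product charts need not be opened.\<close>

lemma tangent_map_Pair:
  fixes A :: "('m::topological_space, 'e::real_inner) atlas" and B :: "('n::topological_space, 'f::real_inner) atlas"
    and C :: "('q::topological_space, 'h::real_inner) atlas"
  assumes A: "smooth_atlas A" and B: "smooth_atlas B" and C: "smooth_atlas C"
    and f: "smooth_map_on A B W f" and g: "smooth_map_on A C W g" and x: "x \<in> W"
  shows "tangent_map A (prod_atlas B C) (\<lambda>x. (f x, g x)) x v = (tangent_map A B f x v, tangent_map A C g x v)"
proof -
  let ?P = "prod_atlas B C"
  note BC = smooth_atlas_prod[OF B C]
  have md: "mdiff A ?P (\<lambda>x. (f x, g x)) x"
    by (rule smooth_map_mdiff[OF smooth_map_Pair[OF A B C f g] x])
  obtain a b where ab: "tangent_map A ?P (\<lambda>x. (f x, g x)) x v = (a, b)" by fastforce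
  have "tangent_map A B f x v = a"
    using tangent_map_compose[OF A BC B md, of fst v] smooth_map_mdiff[OF smooth_map_fst[OF B C]]
    by (simp add: ab tangent_map_fst[OF B C])
  moreover have "tangent_map A C g x v = b"
    using tangent_map_compose[OF A BC C md, of snd v] smooth_map_mdiff[OF smooth_map_snd[OF B C]]
    by (simp add: ab tangent_map_snd[OF B C])
  ultimately show ?thesis using ab by simp
qed

text \<open>Naturality of chart changes under the two projections, whose derivatives in product
  charts are \<open>fst\<close> and \<open>snd\<close>.\<close>

lemma to_chart_prod:
  fixes A :: "('m::topological_space, 'e::real_inner) atlas" and B :: "('n::topological_space, 'f::real_inner) atlas"
  assumes A: "smooth_atlas A" and B: "smooth_atlas B" and x: "x \<in> cdom A p" and y: "y \<in> cdom B q"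
  shows "to_chart (prod_atlas A B) (p, q) (x, y) (v, w) = (to_chart A p x v, to_chart B q y w)"
proof -
  let ?P = "prod_atlas A B"
  note P = smooth_atlas_prod[OF A B]
  have xy: "(x, y) \<in> cdom ?P (p, q)" using x y by (simp add: cdom_prod)
  obtain a b where ab: "to_chart ?P (p, q) (x, y) (v, w) = (a, b)" by fastforce
  have "to_chart A p x v = Drep ?P A fst (p, q) p (x, y) (a, b)"
    using to_chart_tangent_map[OF P A smooth_map_mdiff[OF smooth_map_fst[OF A B]] xy, of p "(v, w)"] x
    by (simp add: ab tangent_map_fst[OF A B])
  moreover have "to_chart B q y w = Drep ?P B snd (p, q) q (x, y) (a, b)"
    using to_chart_tangent_map[OF P B smooth_map_mdiff[OF smooth_map_snd[OF A B]] xy, of q "(v, w)"] y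
    by (simp add: ab tangent_map_snd[OF A B])
  ultimately show ?thesis using ab by (simp add: Drep_fst[OF A B x y] Drep_snd[OF A B x y])
qed

section \<open>Lie groupoids\<close>

context
  fixes M :: "('m::{t2_space,second_countable_topology}, 'e::real_inner) atlas"
    and C :: "('g::topological_space, 'f::real_inner) atlas"
    and G :: "('g, 'm) groupoid"
  assumes lie: "lie_groupoid M C G"
begin

abbreviation Ts where "Ts \<equiv> tangent_map C M (src G)"
abbreviation Tt where "Tt \<equiv> tangent_map C M (tgt G)"
abbreviation Te where "Te \<equiv> tangent_map M C (ident G)"
abbreviation Tm where
  "Tm g h \<equiv> tangent_map_on (prod_atlas C C) C (composable G) (\<lambda>(g, h). mult G g h) (g, h)"

section \<open>Structure maps of a Lie groupoid and the tangent of multiplication\<close>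

lemma lie_groupoid_atlases: "smooth_atlas M" "smooth_atlas C" "smooth_atlas (prod_atlas C C)"
  using lie smooth_atlas_prod unfolding lie_groupoid_def by auto

lemma lie_groupoid_smooth:
  "smooth_map_on C M UNIV (src G)" "smooth_map_on C M UNIV (tgt G)" "smooth_map_on M C UNIV (ident G)"
  using lie unfolding lie_groupoid_def by auto

lemma lie_groupoid_mdiff: "mdiff C M (src G) g" "mdiff C M (tgt G) g" "mdiff M C (ident G) x"
  using lie_groupoid_smooth smooth_map_mdiff by blast+

lemma groupoid_rules:
  "src G (ident G x) = x" "tgt G (ident G x) = x"
  "tgt G h = src G g \<Longrightarrow> src G (mult G g h) = src G h"
  "tgt G h = src G g \<Longrightarrow> tgt G (mult G g h) = tgt G g"
  "mult G g (ident G (src G g)) = g" "mult G (ident G (tgt G g)) g = g"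
  using lie unfolding lie_groupoid_def groupoid_def composable_def by auto

lemma Ts_linear: "linear (Ts g)" and Tt_linear: "linear (Tt g)" and Te_linear: "linear (Te x)"
  by (intro tangent_map_linear lie_groupoid_atlases lie_groupoid_mdiff)+

lemma Ts_surj: "surj (Ts g)" and Tt_surj: "surj (Tt g)"
  using lie unfolding lie_groupoid_def by auto

lemma Ts_Te: "Ts (ident G x) (Te x v) = v"
  using tangent_map_compose[OF lie_groupoid_atlases(1,2,1) lie_groupoid_mdiff(3,1), of x v]
  by (simp add: groupoid_rules tangent_map_ident[OF lie_groupoid_atlases(1)])

lemma Tt_Te: "Tt (ident G x) (Te x v) = v"
  using tangent_map_compose[OF lie_groupoid_atlases(1,2,1) lie_groupoid_mdiff(3,2), of x v]
  by (simp add: groupoid_rules tangent_map_ident[OF lie_groupoid_atlases(1)])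

text \<open>Opens the \<open>SOME\<close> in \<open>tangent_map_on\<close>: the extension it selects
  is a genuine smooth extension of the multiplication near \<open>(g, h)\<close>, and
  \<open>Tm\<close> is its tangent map.\<close>

lemma mult_extension:
  assumes "tgt G h = src G g"
  obtains F W where "(g, h) \<in> W" "smooth_map_on (prod_atlas C C) C W F"
    "\<And>a b. (a, b) \<in> W \<Longrightarrow> tgt G b = src G a \<Longrightarrow> F (a, b) = mult G a b"
    "Tm g h = tangent_map (prod_atlas C C) C F (g, h)"
proof -
  let ?P = "smooth_extension (prod_atlas C C) C (composable G) (\<lambda>(g, h). mult G g h) (g, h)"
  have "\<exists>F. ?P F" using lie assms unfolding lie_groupoid_def smooth_map_on_sub_def composable_def by auto
  then have "?P (SOME F. ?P F)" by (rule someI_ex)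
  then obtain W where "(g, h) \<in> W" "smooth_map_on (prod_atlas C C) C W (SOME F. ?P F)"
    "\<And>q. q \<in> W \<inter> composable G \<Longrightarrow> (SOME F. ?P F) q = (case q of (g, h) \<Rightarrow> mult G g h)"
    unfolding smooth_extension_def[of _ _ _ _ _ "SOME F. ?P F"] by blast
  then show ?thesis using that[of W "SOME F. ?P F"] by (auto simp: tangent_map_on_def composable_def)
qed

lemma smooth_fst_snd_C: "smooth_map_on (prod_atlas C C) C UNIV fst" "smooth_map_on (prod_atlas C C) C UNIV snd"
  using smooth_map_fst smooth_map_snd lie_groupoid_atlases by blast+

text \<open>Composable pairs are the equalizer of source-of-first and target-of-second, cut out
  transversally because the source map is a submersion. Identities that hold on them can therefore
  be differentiated along their tangent vectors.\<close>

lemma tangent_composable: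
  assumes gh: "tgt G h = src G g" and vw: "Ts g v = Tt h w"
    and F: "mdiff (prod_atlas C C) M F (g, h)" and K: "mdiff (prod_atlas C C) M K (g, h)"
    and W: "open W" "(g, h) \<in> W" "\<And>a b. (a, b) \<in> W \<Longrightarrow> tgt G b = src G a \<Longrightarrow> F (a, b) = K (a, b)"
  shows "tangent_map (prod_atlas C C) M F (g, h) (v, w) = tangent_map (prod_atlas C C) M K (g, h) (v, w)"
proof (rule tangent_map_eq_on_equalizer[where W=UNIV and f="\<lambda>q. src G (fst q)" and g="\<lambda>q. tgt G (snd q)"])
  let ?P = "prod_atlas C C"
  note at = lie_groupoid_atlases
  show "smooth_map_on ?P M UNIV (\<lambda>q. src G (fst q))"
    using smooth_map_compose[OF at(3,2,1) smooth_fst_snd_C(1) lie_groupoid_smooth(1)] by simp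
  show "smooth_map_on ?P M UNIV (\<lambda>q. tgt G (snd q))"
    using smooth_map_compose[OF at(3,2,1) smooth_fst_snd_C(2) lie_groupoid_smooth(2)] by simp
  have 1: "tangent_map ?P M (\<lambda>q. src G (fst q)) (g, h) (a, b) = Ts g a" for a b
    using tangent_map_compose[OF at(3,2,1) smooth_map_mdiff[OF smooth_fst_snd_C(1)] lie_groupoid_mdiff(1), of "(g, h)" "(a, b)"]
    by (simp add: tangent_map_fst at)
  have 2: "tangent_map ?P M (\<lambda>q. tgt G (snd q)) (g, h) (a, b) = Tt h b" for a b
    using tangent_map_compose[OF at(3,2,1) smooth_map_mdiff[OF smooth_fst_snd_C(2)] lie_groupoid_mdiff(2), of "(g, h)" "(a, b)"]
    by (simp add: tangent_map_snd at)
  show "surj (\<lambda>v. tangent_map ?P M (\<lambda>q. src G (fst q)) (g, h) v - tangent_map ?P M (\<lambda>q. tgt G (snd q)) (g, h) v)"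
    unfolding surj_def
  proof
    fix y
    obtain a where "y = Ts g a" using Ts_surj by (metis surjD)
    then show "\<exists>x. y = tangent_map ?P M (\<lambda>q. src G (fst q)) (g, h) x - tangent_map ?P M (\<lambda>q. tgt G (snd q)) (g, h) x"
      by (intro exI[of _ "(a, 0)"]) (simp add: 1 2 linear_0[OF Tt_linear])
  qed
  show "tangent_map ?P M (\<lambda>q. src G (fst q)) (g, h) (v, w) = tangent_map ?P M (\<lambda>q. tgt G (snd q)) (g, h) (v, w)"
    by (simp add: 1 2 vw)
  show "\<forall>\<^sub>F z in nhds (g, h). src G (fst z) = tgt G (snd z) \<longrightarrow> F z = K z"
    by (rule eventually_mono[OF eventually_nhds_in_open[OF W(1,2)]]) (auto simp: W(3))
qed (use assms lie_groupoid_atlases in auto)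

text \<open>The tool for differentiating identities such as \<open>src (g h) = src h\<close>, valid
  for composable pairs only.\<close>

lemma tangent_map_Tm:
  assumes gh: "tgt G h = src G g" and vw: "Ts g v = Tt h w" and f: "\<And>g. mdiff C M f g"
    and K: "mdiff (prod_atlas C C) M K (g, h)" "\<And>a b. tgt G b = src G a \<Longrightarrow> f (mult G a b) = K (a, b)"
  shows "tangent_map C M f (mult G g h) (Tm g h (v, w)) = tangent_map (prod_atlas C C) M K (g, h) (v, w)"
proof -
  let ?P = "prod_atlas C C"
  note at = lie_groupoid_atlases
  obtain F W where F: "(g, h) \<in> W" "smooth_map_on ?P C W F"
    "\<And>a b. (a, b) \<in> W \<Longrightarrow> tgt G b = src G a \<Longrightarrow> F (a, b) = mult G a b" "Tm g h = tangent_map ?P C F (g, h)"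
    by (rule mult_extension[OF gh]) (rule that)
  have Fgh: "F (g, h) = mult G g h" using F(1,3) gh by blast
  have W: "open W" using F(2) unfolding smooth_map_on_def by blast
  note md = smooth_map_mdiff[OF F(2,1)]
  have "tangent_map C M f (mult G g h) (Tm g h (v, w)) = tangent_map ?P M (\<lambda>q. f (F q)) (g, h) (v, w)"
    using tangent_map_compose[OF at(3,2,1) md f] by (simp add: F(4) Fgh)
  also have "\<dots> = tangent_map ?P M K (g, h) (v, w)"
    by (rule tangent_composable[OF gh vw mdiff_compose[OF at(3,2) md f] K(1) W F(1)]) (simp add: F(3) K(2))
  finally show ?thesis .
qed

lemma Ts_Tm:
  assumes gh: "tgt G h = src G g" and vw: "Ts g v = Tt h w"
  shows "Ts (mult G g h) (Tm g h (v, w)) = Ts h w"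
proof -
  note at = lie_groupoid_atlases and md = smooth_map_mdiff[OF smooth_fst_snd_C(2) UNIV_I, of "(g, h)"]
  have "Ts (mult G g h) (Tm g h (v, w)) = tangent_map (prod_atlas C C) M (\<lambda>q. src G (snd q)) (g, h) (v, w)"
    by (rule tangent_map_Tm[OF gh vw lie_groupoid_mdiff(1) mdiff_compose[OF at(3,2) md lie_groupoid_mdiff(1)]])
      (simp add: groupoid_rules)
  then show ?thesis
    using tangent_map_compose[OF at(3,2,1) md lie_groupoid_mdiff(1), of "(v, w)"] by (simp add: tangent_map_snd at)
qed

lemma Tt_Tm:
  assumes gh: "tgt G h = src G g" and vw: "Ts g v = Tt h w"
  shows "Tt (mult G g h) (Tm g h (v, w)) = Tt g v"
proof -
  note at = lie_groupoid_atlases and md = smooth_map_mdiff[OF smooth_fst_snd_C(1) UNIV_I, of "(g, h)"]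
  have "Tt (mult G g h) (Tm g h (v, w)) = tangent_map (prod_atlas C C) M (\<lambda>q. tgt G (fst q)) (g, h) (v, w)"
    by (rule tangent_map_Tm[OF gh vw lie_groupoid_mdiff(2) mdiff_compose[OF at(3,2) md lie_groupoid_mdiff(2)]])
      (simp add: groupoid_rules)
  then show ?thesis
    using tangent_map_compose[OF at(3,2,1) md lie_groupoid_mdiff(2), of "(v, w)"] by (simp add: tangent_map_fst at)
qed

text \<open>The pair (\<phi>, \<psi>) takes values in the composable pairs, so near \<open>x\<close>
  the product is the chosen extension evaluated on this pair, and the ordinary chain rule
  applies.\<close>

lemma tangent_map_mult:
  fixes K :: "('k::topological_space, 'h::real_inner) atlas"
  assumes K: "smooth_atlas K" and \<phi>: "smooth_map_on K C UNIV \<phi>" and \<psi>: "smooth_map_on K C UNIV \<psi>"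
    and comp: "\<And>z. tgt G (\<psi> z) = src G (\<phi> z)"
  shows "tangent_map K C (\<lambda>z. mult G (\<phi> z) (\<psi> z)) x u =
    Tm (\<phi> x) (\<psi> x) (tangent_map K C \<phi> x u, tangent_map K C \<psi> x u)"
proof -
  let ?P = "prod_atlas C C"
  note at = lie_groupoid_atlases
  obtain F W where F: "(\<phi> x, \<psi> x) \<in> W" "smooth_map_on ?P C W F"
    "\<And>a b. (a, b) \<in> W \<Longrightarrow> tgt G b = src G a \<Longrightarrow> F (a, b) = mult G a b" "Tm (\<phi> x) (\<psi> x) = tangent_map ?P C F (\<phi> x, \<psi> x)"
    by (rule mult_extension[OF comp]) (rule that)
  note p = smooth_map_Pair[OF K at(2,2) \<phi> \<psi>]
  have W: "open W" using F(2) unfolding smooth_map_on_def by blast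
  have "open ((\<lambda>z. (\<phi> z, \<psi> z)) -` W)"
    using p W unfolding smooth_map_on_def by (metis open_vimage)
  then have ev: "\<forall>\<^sub>F z in nhds x. mult G (\<phi> z) (\<psi> z) = F (\<phi> z, \<psi> z)"
    by (rule eventually_mono[OF eventually_nhds_in_open]) (use F comp in auto)
  have "tangent_map K C (\<lambda>z. mult G (\<phi> z) (\<psi> z)) x u = tangent_map K C (\<lambda>z. F (\<phi> z, \<psi> z)) x u"
    using tangent_map_cong[OF K ev, of C] by simp
  also have "\<dots> = tangent_map ?P C F (\<phi> x, \<psi> x) (tangent_map K C \<phi> x u, tangent_map K C \<psi> x u)"
    using tangent_map_compose[OF K at(3,2) smooth_map_mdiff[OF p UNIV_I] smooth_map_mdiff[OF F(2,1)]]
    by (simp add: tangent_map_Pair[OF K at(2,2) \<phi> \<psi>])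
  finally show ?thesis by (simp add: F(4))
qed

text \<open>Derivative of the unit law, read as the product of the families
  \<open>g \<mapsto> ident G (tgt G g)\<close> and \<open>g \<mapsto> g\<close>.\<close>

lemma Tm_unit_left: "Tm (ident G (tgt G g)) g (Te (tgt G g) (Tt g w), w) = w"
proof -
  note at = lie_groupoid_atlases
  have s: "smooth_map_on C C UNIV (\<lambda>g. ident G (tgt G g))"
    using smooth_map_compose[OF at(2,1,2) lie_groupoid_smooth(2,3)] by simp
  have "Tm (ident G (tgt G g)) g (tangent_map C C (\<lambda>g. ident G (tgt G g)) g w, tangent_map C C (\<lambda>g. g) g w) =
      tangent_map C C (\<lambda>g. g) g w"
    using tangent_map_mult[OF at(2) s smooth_map_ident[OF at(2)], of g w] by (simp add: groupoid_rules)
  then show ?thesis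
    by (simp add: tangent_map_ident[OF at(2)] tangent_map_compose[OF at(2,1,2) lie_groupoid_mdiff(2,3)])
qed

lemma Tm_unit_right: "Tm g (ident G (src G g)) (w, Te (src G g) (Ts g w)) = w"
proof -
  note at = lie_groupoid_atlases
  have s: "smooth_map_on C C UNIV (\<lambda>g. ident G (src G g))"
    using smooth_map_compose[OF at(2,1,2) lie_groupoid_smooth(1,3)] by simp
  have "Tm g (ident G (src G g)) (tangent_map C C (\<lambda>g. g) g w, tangent_map C C (\<lambda>g. ident G (src G g)) g w) =
      tangent_map C C (\<lambda>g. g) g w"
    using tangent_map_mult[OF at(2) smooth_map_ident[OF at(2)] s, of g w] by (simp add: groupoid_rules)
  then show ?thesis
    by (simp add: tangent_map_ident[OF at(2)] tangent_map_compose[OF at(2,1,2) lie_groupoid_mdiff(1,3)])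
qed

section \<open>Multiplicative two-forms\<close>

lemma multiplicativeD:
  assumes "multiplicative_form M C G \<omega>" "tgt G h = src G g" "Ts g v = Tt h w" "Ts g v' = Tt h w'"
  shows "\<omega> (mult G g h) (Tm g h (v, w)) (Tm g h (v', w')) = \<omega> g v v' + \<omega> h w w'"
  using assms unfolding multiplicative_form_def composable_def by (simp add: Let_def)

text \<open>The added form is the groupoid coboundary of \<open>B\<close>: on a composable pair with
  compatible vectors, the source term of the first factor and the target term of the second are
  equal and cancel.\<close>

lemma multiplicative_boundary:
  assumes "multiplicative_form M C G \<omega>"
  shows "multiplicative_form M C G
    (\<lambda>g v w. \<omega> g v w + (pullback2 C M (tgt G) B g v w - pullback2 C M (src G) B g v w))"
  unfolding multiplicative_form_def Let_def
proof (intro allI impI, elim conjE)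
  fix g h v w v' w'
  assume "(g, h) \<in> composable G" and v: "Ts g v = Tt h w" "Ts g v' = Tt h w'"
  then have gh: "tgt G h = src G g" by (simp add: composable_def)
  show "\<omega> (mult G g h) (Tm g h (v, w)) (Tm g h (v', w')) +
      (pullback2 C M (tgt G) B (mult G g h) (Tm g h (v, w)) (Tm g h (v', w')) -
       pullback2 C M (src G) B (mult G g h) (Tm g h (v, w)) (Tm g h (v', w'))) =
      \<omega> g v v' + (pullback2 C M (tgt G) B g v v' - pullback2 C M (src G) B g v v') +
      (\<omega> h w w' + (pullback2 C M (tgt G) B h w w' - pullback2 C M (src G) B h w w'))"
    by (simp add: multiplicativeD[OF assms gh] pullback2_def Ts_Tm[OF gh] Tt_Tm[OF gh] groupoid_rules(3,4)[OF gh] gh v)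
qed

context
  fixes \<omega> :: "'g \<Rightarrow> 'f \<Rightarrow> 'f \<Rightarrow> real"
  assumes form: "two_form C \<omega>" and mult: "multiplicative_form M C G \<omega>"
begin

text \<open>A vector tangent to the units multiplied with itself is itself, so multiplicativity
  reads \<open>\<omega>(u, v) = 2 \<omega>(u, v)\<close>.\<close>

lemma unit_isotropic: "\<omega> (ident G x) (Te x u) (Te x v) = 0"
proof -
  let ?e = "ident G x"
  have e: "Tm ?e ?e (Te x w, Te x w) = Te x w" for w
    using Tm_unit_left[of ?e "Te x w"] by (simp add: groupoid_rules Tt_Te)
  have "\<omega> ?e (Te x u) (Te x v) = \<omega> ?e (Te x u) (Te x v) + \<omega> ?e (Te x u) (Te x v)"
    using multiplicativeD[OF mult, of ?e ?e "Te x u" "Te x u" "Te x v" "Te x v"]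
      groupoid_rules(5)[of ?e]
    by (simp add: e groupoid_rules Tt_Te Ts_Te)
  then show ?thesis by simp
qed

text \<open>Multiplicativity for the tangent pairs \<open>(a, 0)\<close> and
  \<open>(Te (Tt w), w)\<close>: the second pair multiplies to \<open>w\<close> by the unit law, and
  the term containing 0 drops out.\<close>

lemma form_right_translate:
  assumes a: "Ts (ident G (tgt G g)) a = 0"
  shows "\<omega> g (Tm (ident G (tgt G g)) g (a, 0)) w = \<omega> (ident G (tgt G g)) a (Te (tgt G g) (Tt g w))"
proof -
  interpret b: bounded_bilinear "\<omega> g" by (rule two_form_bilinear[OF form])
  show ?thesis
    using multiplicativeD[OF mult, of g "ident G (tgt G g)" a 0 "Te (tgt G g) (Tt g w)" w] a
    by (simp add: groupoid_rules Ts_Te linear_0[OF Tt_linear] Tm_unit_left b.zero_left)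
qed

lemma form_left_translate:
  assumes c: "Tt (ident G (src G g)) c = 0"
  shows "\<omega> g (Tm g (ident G (src G g)) (0, c)) w = \<omega> (ident G (src G g)) c (Te (src G g) (Ts g w))"
proof -
  interpret b: bounded_bilinear "\<omega> g" by (rule two_form_bilinear[OF form])
  show ?thesis
    using multiplicativeD[OF mult, of "ident G (src G g)" g 0 c w "Te (src G g) (Ts g w)"] c
    by (simp add: groupoid_rules Tt_Te linear_0[OF Ts_linear] Tm_unit_right b.zero_left)
qed

lemma form_to_IM_apply: "blinfun_apply (form_to_IM M C G \<omega> x a) v = \<omega> (ident G x) a (Te x v)"
proof -
  interpret b: bounded_bilinear "\<omega> (ident G x)" by (rule two_form_bilinear[OF form])
  have "bounded_linear (\<lambda>v. \<omega> (ident G x) a (Te x v))"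
    by (rule bounded_linear_compose[OF b.bounded_linear_right])
      (rule linear_bounded_linear[OF atlas_fin_dim[OF lie_groupoid_atlases(1)] Te_linear])
  then show ?thesis by (simp add: form_to_IM_def bounded_linear_Blinfun_apply)
qed

text \<open>\<open>inj\<close> is injectivity of \<open>Id + \<pi>\<^sup>\<sharp> \<circ> B\<^sup>\<sharp>\<close>; \<open>X\<close> and \<open>Y\<close> in the proof represent
  \<open>t\<^sup>*(B\<^sup>\<sharp> Tt v)\<close> and \<open>s\<^sup>*(B\<^sup>\<sharp> Ts v)\<close>.\<close>

lemma nondegenerate_gauge:
  fixes \<pi> :: "'m \<Rightarrow> 'e covector \<Rightarrow> 'e covector \<Rightarrow> real"
  assumes nd: "nondegenerate \<omega>" and B: "two_form M B"
    and onto: "\<And>x \<beta>. \<exists>a. Ts (ident G x) a = 0 \<and> form_to_IM M C G \<omega> x a = \<beta> \<and> Tt (ident G x) a = sharp \<pi> x \<beta>"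
    and inj: "\<And>x u. u = - sharp \<pi> x (form_sharp B x u) \<Longrightarrow> u = 0"
  shows "nondegenerate (\<lambda>g v w. \<omega> g v w + (pullback2 C M (tgt G) B g v w - pullback2 C M (src G) B g v w))"
  unfolding nondegenerate_def
proof (intro allI impI)
  fix g v
  assume "\<forall>w. \<omega> g v w + (pullback2 C M (tgt G) B g v w - pullback2 C M (src G) B g v w) = 0"
  then have ker: "\<omega> g v w + (B (tgt G g) (Tt g v) (Tt g w) - B (src G g) (Ts g v) (Ts g w)) = 0" for w
    unfolding pullback2_def by blast
  interpret b: bounded_bilinear "\<omega> g" by (rule two_form_bilinear[OF form])
  interpret Bt: bounded_bilinear "B (tgt G g)" by (rule two_form_bilinear[OF B])
  interpret Bs: bounded_bilinear "B (src G g)" by (rule two_form_bilinear[OF B])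
  let ?\<beta> = "form_sharp B (tgt G g) (Tt g v)" and ?\<gamma> = "form_sharp B (src G g) (Ts g v)"
  let ?t = "ident G (tgt G g)" and ?s = "ident G (src G g)"
  have \<beta>: "blinfun_apply ?\<beta> w = B (tgt G g) (Tt g v) w" for w
    by (simp add: form_sharp_def bounded_linear_Blinfun_apply Bt.bounded_linear_right)
  have \<gamma>: "blinfun_apply ?\<gamma> w = B (src G g) (Ts g v) w" for w
    by (simp add: form_sharp_def bounded_linear_Blinfun_apply Bs.bounded_linear_right)
  obtain a where a: "Ts ?t a = 0" "form_to_IM M C G \<omega> (tgt G g) a = ?\<beta>" "Tt ?t a = sharp \<pi> (tgt G g) ?\<beta>"
    using onto by blast
  obtain a' where a': "Ts ?s a' = 0" "form_to_IM M C G \<omega> (src G g) a' = ?\<gamma>" "Tt ?s a' = sharp \<pi> (src G g) ?\<gamma>"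
    using onto by blast
  \<comment> \<open>Moves \<open>a'\<close> from \<open>ker Ts\<close> to \<open>ker Tt\<close>, as
    left translation requires, by subtracting a vector tangent to the units. Isotropy of the units
    keeps its pairing with unit vectors unchanged.\<close>
  define c where "c = a' - Te (src G g) (Tt ?s a')"
  have c: "Tt ?s c = 0" "Ts ?s c = - Tt ?s a'"
    by (simp_all add: c_def linear_diff[OF Tt_linear] linear_diff[OF Ts_linear] Tt_Te Ts_Te a')
  define X where "X = Tm ?t g (a, 0)"
  define Y where "Y = Tm g ?s (0, c)"
  have X: "\<omega> g X w = B (tgt G g) (Tt g v) (Tt g w)" for w
    unfolding X_def form_right_translate[OF a(1)] form_to_IM_apply[symmetric] a(2) \<beta> ..
  have Y: "\<omega> g Y w = B (src G g) (Ts g v) (Ts g w)" for w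
  proof -
    interpret e: bounded_bilinear "\<omega> ?s" by (rule two_form_bilinear[OF form])
    have "\<omega> g Y w = \<omega> ?s a' (Te (src G g) (Ts g w))"
      unfolding Y_def form_left_translate[OF c(1)] by (simp add: c_def e.diff_left unit_isotropic)
    then show ?thesis unfolding form_to_IM_apply[symmetric] a'(2) \<gamma> .
  qed
  \<comment> \<open>Nondegeneracy now writes \<open>v\<close> as a difference of two explicit
    translates. \<open>Ts\<close> kills \<open>X\<close> and \<open>Tt\<close> kills
    \<open>Y\<close>, so each of \<open>Tt v\<close> and \<open>Ts v\<close> sees only one of
    them.\<close>
  have "\<omega> g (v + X - Y) w = 0" for w
    using ker[of w] by (simp add: b.add_left b.diff_left X Y)
  then have "v + X - Y = 0" using nd unfolding nondegenerate_def by blast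
  then have v: "v = Y - X" by (simp add: algebra_simps)
  have "Tt g X = Tt ?t a" "Ts g X = 0"
    using Tt_Tm[of g ?t a 0] Ts_Tm[of g ?t a 0] a
    by (simp_all add: X_def groupoid_rules linear_0[OF Tt_linear] linear_0[OF Ts_linear])
  moreover have "Tt g Y = 0" "Ts g Y = Ts ?s c"
    using Tt_Tm[of ?s g 0 c] Ts_Tm[of ?s g 0 c] c
    by (simp_all add: Y_def groupoid_rules linear_0[OF Tt_linear] linear_0[OF Ts_linear])
  ultimately have "Tt g v = - sharp \<pi> (tgt G g) ?\<beta>" "Ts g v = - sharp \<pi> (src G g) ?\<gamma>"
    by (simp_all add: v linear_diff[OF Tt_linear] linear_diff[OF Ts_linear] a a' c)
  then have "Tt g v = 0" "Ts g v = 0" using inj by blast+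
  then have "\<omega> g v w = 0" for w using ker[of w] by (simp add: Bt.zero_left Bs.zero_left)
  then show "v = 0" using nd unfolding nondegenerate_def by blast
qed

text \<open>On \<open>ker Ts\<close> the source pullback vanishes, and \<open>Tt\<close> is a left
  inverse of \<open>Te\<close>; what remains of the added form on \<open>(a, Te v)\<close> is
  \<open>B (Tt a, v)\<close>.\<close>

lemma form_to_IM_gauge:
  assumes B: "two_form M B" and a: "Ts (ident G x) a = 0"
  shows "form_to_IM M C G (\<lambda>g v w. \<omega> g v w + (pullback2 C M (tgt G) B g v w - pullback2 C M (src G) B g v w)) x a =
    form_to_IM M C G \<omega> x a + form_sharp B x (Tt (ident G x) a)"
proof -
  interpret Bx: bounded_bilinear "B x" by (rule two_form_bilinear[OF B])
  have "(\<lambda>v. \<omega> (ident G x) a (Te x v) + (pullback2 C M (tgt G) B (ident G x) a (Te x v) - pullback2 C M (src G) B (ident G x) a (Te x v)))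
      = blinfun_apply (form_to_IM M C G \<omega> x a + form_sharp B x (Tt (ident G x) a))"
    by (auto simp: fun_eq_iff pullback2_def groupoid_rules Ts_Te Tt_Te a Bx.zero_left blinfun.add_left form_to_IM_apply
        form_sharp_def bounded_linear_Blinfun_apply Bx.bounded_linear_right)
  then show ?thesis unfolding form_to_IM_def[of _ _ _ "\<lambda>g v w. \<omega> g v w + _ g v w"]
    by (simp add: blinfun_apply_inverse)
qed

end

section \<open>Right-invariant vector fields and the Lie algebroid of the groupoid\<close>

lemma right_invariant_eq_extension:
  assumes F: "(ident G (tgt G g), g) \<in> W" "smooth_map_on (prod_atlas C C) C W F"
    "\<And>a b. (a, b) \<in> W \<Longrightarrow> tgt G b = src G a \<Longrightarrow> F (a, b) = mult G a b"
    and a: "Ts (ident G (tgt G g)) (a (tgt G g)) = 0"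
  shows "right_invariant C G a g = tangent_map (prod_atlas C C) C F (ident G (tgt G g), g) (a (tgt G g), 0)"
proof -
  note at = lie_groupoid_atlases
  define e where "e = ident G (tgt G g)"
  define v where "v = a (tgt G g)"
  let ?S = "{h. src G h = tgt G g}"
  let ?P = "smooth_extension C C ?S (\<lambda>h. mult G h g) e"
  have j: "smooth_map_on C (prod_atlas C C) UNIV (\<lambda>h. (h, g))"
    by (rule smooth_map_Pair[OF at(2,2,2) smooth_map_ident[OF at(2)] smooth_map_const])
  have F0: "smooth_map_on C C ((\<lambda>h. (h, g)) -` W) (\<lambda>h. F (h, g))"
    using smooth_map_compose[OF at(2,3,2) j F(2)] by simp
  have eW: "e \<in> (\<lambda>h. (h, g)) -` W" using F(1) by (simp add: e_def)
  have "?P (\<lambda>h. F (h, g))" unfolding smooth_extension_def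
    by (rule exI[of _ "(\<lambda>h. (h, g)) -` W"]) (use F0 eW F(3) in auto)
  then have "\<exists>F. ?P F" by blast
  then have "?P (SOME F. ?P F)" by (rule someI_ex)
  then obtain V where V: "e \<in> V" "smooth_map_on C C V (SOME F. ?P F)"
    "\<And>h. h \<in> V \<inter> ?S \<Longrightarrow> (SOME F. ?P F) h = mult G h g"
    unfolding smooth_extension_def[of _ _ _ _ _ "SOME F. ?P F"] by blast
  have open_V: "open (V \<inter> (\<lambda>h. (h, g)) -` W)" using V(2) F0 unfolding smooth_map_on_def by blast
  have "right_invariant C G a g = tangent_map C C (SOME F. ?P F) e v"
    by (simp add: right_invariant_def tangent_map_on_def e_def v_def)
  also have "\<dots> = tangent_map C C (\<lambda>h. F (h, g)) e v"
  \<comment> \<open>\<open>right_invariant\<close> selects its own extension of right translation.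
    The source fibre is a level set of the submersion \<open>src G\<close> and the vector is tangent
    to it, so the slice of \<open>F\<close> has the same derivative there.\<close>
  proof (rule tangent_map_eq_on_equalizer[OF at(2,1,2) lie_groupoid_smooth(1) smooth_map_const[of _ _ "tgt G g"]])
    show "surj (\<lambda>v. Ts e v - tangent_map C M (\<lambda>x. tgt G g) e v)"
      using Ts_surj by (simp add: tangent_map_const)
    show "Ts e v = tangent_map C M (\<lambda>x. tgt G g) e v"
      using a by (simp add: tangent_map_const e_def v_def)
    show "\<forall>\<^sub>F z in nhds e. src G z = tgt G g \<longrightarrow> (SOME F. ?P F) z = F (z, g)"
      by (rule eventually_mono[OF eventually_nhds_in_open[OF open_V]]) (use V eW F(3) in auto)
  qed (use V F0 eW in \<open>auto simp: e_def groupoid_rules intro: smooth_map_mdiff\<close>)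
  also have "\<dots> = tangent_map (prod_atlas C C) C F (e, g) (v, 0)"
    using tangent_map_compose[OF at(2,3,2) smooth_map_mdiff[OF j UNIV_I] smooth_map_mdiff[OF F(2,1)], folded e_def]
    by (simp add: e_def tangent_map_Pair[OF at(2,2,2) smooth_map_ident[OF at(2)] smooth_map_const] tangent_map_ident[OF at(2)] tangent_map_const)
  finally show ?thesis by (simp add: e_def v_def)
qed

lemma right_invariant_eq_Tm:
  assumes a: "Ts (ident G (tgt G g)) (a (tgt G g)) = 0"
  shows "right_invariant C G a g = Tm (ident G (tgt G g)) g (a (tgt G g), 0)"
proof -
  have gh: "tgt G g = src G (ident G (tgt G g))" by (simp add: groupoid_rules)
  obtain F W where F: "(ident G (tgt G g), g) \<in> W" "smooth_map_on (prod_atlas C C) C W F"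
    "\<And>a b. (a, b) \<in> W \<Longrightarrow> tgt G b = src G a \<Longrightarrow> F (a, b) = mult G a b"
    "Tm (ident G (tgt G g)) g = tangent_map (prod_atlas C C) C F (ident G (tgt G g), g)"
    by (rule mult_extension[OF gh]) (rule that)
  show ?thesis using right_invariant_eq_extension[of g W F a, OF F(1-3) a] by (simp add: F(4))
qed

text \<open>The source of a product is that of its second factor, and the second tangent component
  is 0.\<close>

lemma Ts_right_invariant:
  assumes a: "Ts (ident G (tgt G g)) (a (tgt G g)) = 0"
  shows "Ts g (right_invariant C G a g) = 0"
  using Ts_Tm[of g "ident G (tgt G g)" "a (tgt G g)" 0] a
  by (simp add: right_invariant_eq_Tm[of g a, OF a] groupoid_rules linear_0[OF Tt_linear] linear_0[OF Ts_linear])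

text \<open>A single extension of the multiplication around the pair of units \<open>(e, e)\<close>
  computes the field at all arrows \<open>g\<close> near \<open>e\<close>: the value is its
  derivative at \<open>(ident G (tgt G g), g)\<close> on \<open>(a (tgt G g), 0)\<close>, and
  everything in this expression varies smoothly.\<close>

lemma right_invariant_smooth:
  assumes a: "smooth_along M C (ident G) a" "\<And>x. Ts (ident G x) (a x) = 0"
  shows "\<exists>U. open U \<and> chart C (ident G x) (ident G x) \<in> U \<and> U \<subseteq> chart C (ident G x) ` cdom C (ident G x) \<and>
    smooth_on U (field_in_chart C (right_invariant C G a) (ident G x))"
proof -
  note at = lie_groupoid_atlases
  let ?P = "prod_atlas C C"
  define e where "e = ident G x"
  define E where "E g = ident G (tgt G g)" for g
  have Ee: "E e = e" by (simp add: E_def e_def groupoid_rules)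
  have ee: "tgt G e = src G e" by (simp add: e_def groupoid_rules)
  obtain F W where F: "(e, e) \<in> W" "smooth_map_on ?P C W F"
    "\<And>a b. (a, b) \<in> W \<Longrightarrow> tgt G b = src G a \<Longrightarrow> F (a, b) = mult G a b"
    by (rule mult_extension[OF ee]) (rule that)
  have E: "smooth_map_on C C UNIV E"
    using smooth_map_compose[OF at(2,1,2) lie_groupoid_smooth(2,3)] by (simp add: E_def[abs_def])
  have EI: "smooth_map_on C ?P UNIV (\<lambda>g. (E g, g))"
    by (rule smooth_map_Pair[OF at(2,2,2) E smooth_map_ident[OF at(2)]])
  have FE: "F (E g, g) = g" if "(E g, g) \<in> W" for g
    using F(3)[OF that] by (simp add: E_def groupoid_rules)
  define V where "V = cdom C e \<inter> tgt G -` cdom M x \<inter> E -` cdom C e \<inter> (\<lambda>g. (E g, g)) -` W"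
  have V: "open V" unfolding V_def
    using lie_groupoid_smooth(2) E EI F(2) atlas_open[OF at(1)] atlas_open[OF at(2)]
    unfolding smooth_map_on_def by (intro open_Int) (auto intro: open_vimage)
  have eV: "e \<in> V" using F(1) atlas_mem[OF at(1), of x] atlas_mem[OF at(2), of e] Ee
    by (simp add: V_def) (simp add: e_def groupoid_rules)
  define U where "U = chart C e ` V"
  have U: "open U" unfolding U_def by (rule open_chart_image[OF at(2) V]) (auto simp: V_def)
  have Uc: "U \<subseteq> chart C e ` cdom C e" by (auto simp: U_def V_def)
  have UV: "ichart C e y \<in> V" if "y \<in> U" for y
    using ichart_image_mem[OF at(2), of y e V] that by (auto simp: U_def V_def)
  \<comment> \<open>Local representatives: \<Phi> of \<open>F\<close>, \<theta> of
    \<open>g \<mapsto> (E g, g)\<close>, \<alpha> of the section \<open>a\<close>, and \<tau> of the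
    target map.\<close>
  define \<Phi> where "\<Phi> = chart C e \<circ> F \<circ> ichart ?P (e, e)"
  define T where "T = chart ?P (e, e) ` (cdom ?P (e, e) \<inter> W \<inter> F -` cdom C e)"
  define \<theta> where "\<theta> y = ((chart C e \<circ> E \<circ> ichart C e) y, y)" for y
  define A where "A = chart M x ` (cdom M x \<inter> ident G -` cdom C e)"
  define \<alpha> where "\<alpha> z = to_chart C e (ident G (ichart M x z)) (a (ichart M x z))" for z
  define \<tau> where "\<tau> = chart M x \<circ> tgt G \<circ> ichart C e"
  have T: "open T" unfolding T_def by (rule smooth_map_open[OF at(3,2) F(2)])
  have \<Phi>: "smooth_on T \<Phi>" unfolding T_def \<Phi>_def by (rule smooth_map_rep[OF F(2)])
  have \<theta>: "smooth_on U \<theta>" unfolding \<theta>_def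
    by (intro smooth_on_Pair U smooth_on_ident smooth_on_subset[OF smooth_map_rep[OF E]]) (auto simp: U_def V_def)
  have \<theta>eq: "\<theta> y = chart ?P (e, e) (E (ichart C e y), ichart C e y)" if "y \<in> U" for y
    using subsetD[OF Uc that] by (simp add: \<theta>_def chart_prod chart_ichart[OF at(2)])
  have \<theta>T: "\<theta> y \<in> T" if "y \<in> U" for y
    unfolding \<theta>eq[OF that] T_def using UV[OF that] FE[of "ichart C e y"] by (intro imageI) (auto simp: V_def cdom_prod)
  have oA: "open A" unfolding A_def
    using smooth_map_open[OF at(1,2) lie_groupoid_smooth(3), of x e] by simp
  have \<alpha>: "smooth_on A \<alpha>" using a(1) unfolding smooth_along_def A_def \<alpha>_def by (simp add: Let_def)
  have \<tau>: "smooth_on U \<tau>" unfolding \<tau>_def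
    by (rule smooth_on_subset[OF smooth_map_rep[OF lie_groupoid_smooth(2)]]) (auto simp: U_def V_def)
  have \<tau>A: "\<tau> y \<in> A" if "y \<in> U" for y
    using UV[OF that] by (auto simp: \<tau>_def A_def V_def E_def)
  have fdf: "fin_dim TYPE('f)" and fdff: "fin_dim TYPE('f \<times> 'f)" and fde: "fin_dim TYPE('e)"
    using atlas_fin_dim at by blast+
  have \<alpha>\<tau>: "smooth_on U (\<lambda>y. (\<alpha> (\<tau> y), 0 :: 'f))"
    by (intro smooth_on_Pair U smooth_on_const smooth_on_compose[OF fde U oA \<tau>A \<tau> \<alpha>])
  have "smooth_on U (\<lambda>y. frechet_derivative \<Phi> (at (\<theta> y)) w)" for w
    by (rule smooth_on_compose[OF fdff U T \<theta>T \<theta> smooth_on_frechet[OF \<Phi>]])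
  then have "smooth_on U (\<lambda>y. frechet_derivative \<Phi> (at (\<theta> y)) (\<alpha> (\<tau> y), 0))"
    by (rule smooth_on_apply[where F="\<lambda>y. frechet_derivative \<Phi> (at (\<theta> y))", OF fdff U _ _ \<alpha>\<tau>, rotated])
      (rule has_derivative_linear[OF smooth_on_has_derivative[OF \<Phi> \<theta>T]])
  then have "smooth_on U (field_in_chart C (right_invariant C G a) e)"
  proof (rule smooth_on_cong[OF U, rotated])
    fix y assume y: "y \<in> U"
    define g where "g = ichart C e y"
    have g: "g \<in> cdom C e" "tgt G g \<in> cdom M x" "E g \<in> cdom C e" "(E g, g) \<in> W"
      using UV[OF y] by (auto simp: g_def V_def)
    have Eg: "ident G (tgt G g) = E g" by (simp add: E_def)
    have \<alpha>g: "\<alpha> (\<tau> y) = to_chart C e (E g) (a (tgt G g))"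
      using g(2) by (simp add: \<alpha>_def \<tau>_def g_def[symmetric] ichart_chart[OF at(1)] E_def)
    have m: "(E g, g) \<in> cdom ?P (e, e)" using g by (simp add: cdom_prod)
    have "field_in_chart C (right_invariant C G a) e y = to_chart C e g (tangent_map ?P C F (E g, g) (a (tgt G g), 0))"
      using right_invariant_eq_extension[of g W F a, unfolded Eg, OF g(4) F(2,3)] a(2)[of "tgt G g"]
      by (simp add: field_in_chart_def Let_def g_def[symmetric] Eg)
    also have "\<dots> = Drep ?P C F (e, e) e (E g, g) (to_chart ?P (e, e) (E g, g) (a (tgt G g), 0))"
      using to_chart_tangent_map[OF at(3,2) smooth_map_mdiff[OF F(2) g(4)] m, of e] FE[OF g(4)] g(1) by simp
    also have "to_chart ?P (e, e) (E g, g) (a (tgt G g), 0) = (\<alpha> (\<tau> y), 0)"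
      by (simp add: to_chart_prod[OF at(2,2) g(3,1)] \<alpha>g linear_0[OF to_chart_linear[OF at(2) g(1)]])
    also have "Drep ?P C F (e, e) e (E g, g) = frechet_derivative \<Phi> (at (\<theta> y))"
      by (simp add: Drep_def \<Phi>_def \<theta>eq[OF y] g_def)
    finally show "frechet_derivative \<Phi> (at (\<theta> y)) (\<alpha> (\<tau> y), 0) = field_in_chart C (right_invariant C G a) e y" by simp
  qed
  moreover have "chart C e e \<in> U" using eV by (simp add: U_def)
  ultimately show ?thesis using U Uc unfolding e_def by blast
qed

lemma groupoid_algebroid_simps:
  "fibre (groupoid_algebroid M C G) x = {v. Ts (ident G x) v = 0}"
  "sections (groupoid_algebroid M C G) = {a. smooth_along M C (ident G) a \<and> (\<forall>x. Ts (ident G x) (a x) = 0)}"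
  "anchor (groupoid_algebroid M C G) x = Tt (ident G x)"
  "bracket (groupoid_algebroid M C G) a b x = lie_bracket C (right_invariant C G a) (right_invariant C G b) (ident G x)"
  by (simp_all add: groupoid_algebroid_def Let_def)

text \<open>Right-invariant fields are tangent to the source fibres near the unit, and brackets of
  such fields are again tangent. The statement is what allows the IM-forms to be compared on a
  bracket of sections.\<close>

lemma bracket_in_fibre:
  assumes a: "a \<in> sections (groupoid_algebroid M C G)" and b: "b \<in> sections (groupoid_algebroid M C G)"
  shows "bracket (groupoid_algebroid M C G) a b x \<in> fibre (groupoid_algebroid M C G) x"
proof -
  note at = lie_groupoid_atlases
  note fdf = atlas_fin_dim[OF at(2)] and fde = atlas_fin_dim[OF at(1)]
  define e where "e = ident G x"
  define y where "y = chart C e e"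
  define S where "S = chart M x \<circ> src G \<circ> ichart C e"
  define D where "D = chart C e ` (cdom C e \<inter> UNIV \<inter> src G -` cdom M x)"
  have D: "open D" unfolding D_def by (rule smooth_map_open[OF at(2,1) lie_groupoid_smooth(1)])
  have S: "smooth_on D S" unfolding D_def S_def by (rule smooth_map_rep[OF lie_groupoid_smooth(1)])
  have yD: "y \<in> D" using atlas_mem[OF at(1), of x] atlas_mem[OF at(2), of e]
    by (auto simp: D_def y_def e_def groupoid_rules intro!: imageI)
  have SD: "frechet_derivative S (at z) (field_in_chart C (right_invariant C G c) e z) = 0"
    if c: "\<And>x. Ts (ident G x) (c x) = 0" and z: "z \<in> D" for c z
  proof -
    define g where "g = ichart C e z"
    have g: "g \<in> cdom C e" "src G g \<in> cdom M x"
      using ichart_image_mem[OF at(2), of z e "cdom C e \<inter> UNIV \<inter> src G -` cdom M x"] z by (auto simp: g_def D_def)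
    have zi: "chart C e g = z" using z by (auto simp: g_def D_def ichart_chart[OF at(2)])
    have "frechet_derivative S (at z) (field_in_chart C (right_invariant C G c) e z) =
        Drep C M (src G) e x g (to_chart C e g (right_invariant C G c g))"
      unfolding field_in_chart_def Let_def Drep_def S_def zi g_def[symmetric] ..
    also have "\<dots> = to_chart M x (src G g) (Ts g (right_invariant C G c g))"
      using to_chart_tangent_map[OF at(2,1) lie_groupoid_mdiff(1) g] by simp
    also have "\<dots> = 0" by (simp add: Ts_right_invariant[of g c, OF c] linear_0[OF to_chart_linear[OF at(1) g(2)]])
    finally show ?thesis .
  qed
  \<comment> \<open>The derivative in direction \<open>u\<close> of the identity that the derivative
    of \<open>S\<close> annihilates the field. Subtracting two instances leaves the Lie bracket,
    since the second derivatives of \<open>S\<close> are symmetric.\<close>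
  have key: "frechet_derivative (\<lambda>z. frechet_derivative S (at z) (right_invariant C G c e)) (at y) u +
      frechet_derivative S (at y) (frechet_derivative (field_in_chart C (right_invariant C G c) e) (at y) u) = 0"
    if c: "c \<in> sections (groupoid_algebroid M C G)" for c u
  proof -
    have c': "smooth_along M C (ident G) c" "\<And>x. Ts (ident G x) (c x) = 0"
      using c by (auto simp: groupoid_algebroid_simps)
    let ?X = "field_in_chart C (right_invariant C G c) e"
    obtain U where U: "open U" "y \<in> U" "smooth_on U ?X"
      using right_invariant_smooth[OF c', of x] unfolding e_def y_def by blast
    have Xy: "?X y = right_invariant C G c e"
      by (simp add: field_in_chart_def y_def ichart_chart[OF at(2)] atlas_mem[OF at(2)] to_chart_self[OF at(2)])
    have 1: "((\<lambda>z. frechet_derivative S (at z) (?X z)) has_derivative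
        (\<lambda>u. frechet_derivative (\<lambda>z. frechet_derivative S (at z) (?X y)) (at y) u +
          frechet_derivative S (at y) (frechet_derivative ?X (at y) u))) (at y)"
      by (rule has_derivative_apply[OF fdf D yD _ smooth_on_has_derivative[OF smooth_on_frechet[OF S] yD]
            smooth_on_has_derivative[OF U(3,2)]])
        (rule has_derivative_linear[OF smooth_on_has_derivative[OF S]])
    have 2: "((\<lambda>z. frechet_derivative S (at z) (?X z)) has_derivative (\<lambda>u. 0)) (at y)"
      by (rule has_derivative_transform_within_open[OF has_derivative_const D yD, of 0]) (simp add: SD[OF c'(2)])
    show ?thesis using fun_cong[OF has_derivative_unique[OF 1 2], of u] unfolding Xy by simp
  qed
  have lin: "linear (frechet_derivative S (at y))"
    by (rule has_derivative_linear[OF smooth_on_has_derivative[OF S yD]])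
  let ?a = "right_invariant C G a e" and ?b = "right_invariant C G b e"
  have "frechet_derivative S (at y) (lie_bracket C (right_invariant C G a) (right_invariant C G b) e) = 0"
    using key[OF a, of ?b] key[OF b, of ?a] symmetric_second_derivative[OF fde D yD S, of ?a ?b]
    by (simp add: lie_bracket_def y_def[symmetric] linear_diff[OF lin] add_eq_0_iff)
  moreover have "Ts e = frechet_derivative S (at y)"
    by (simp add: tangent_map_def S_def y_def e_def groupoid_rules)
  ultimately show ?thesis by (simp add: groupoid_algebroid_simps e_def)
qed

end

section \<open>Poisson structures and gauge transformations\<close>

lemma covector_separate:
  fixes X Y :: "'a::real_normed_vector"
  assumes fd: "fin_dim TYPE('a)" and eq: "\<And>\<beta> :: 'a covector. blinfun_apply \<beta> X = blinfun_apply \<beta> Y"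
  shows "X = Y"
proof -
  obtain n :: nat and b c where c: "\<And>i. bounded_linear (c i)" "\<And>x::'a. x = (\<Sum>i<n. c i x *\<^sub>R b i)"
    by (rule fin_dimE[OF fd]) (rule that)
  have "c i X = c i Y" for i using eq[of "Blinfun (c i)"] by (simp add: bounded_linear_Blinfun_apply c(1))
  then show ?thesis by (subst (1 2) c(2)) simp
qed

lemma smooth_on_covectors:
  fixes X :: "'a::real_normed_vector \<Rightarrow> 'b::real_normed_vector"
  assumes fd: "fin_dim TYPE('b)" and S: "open S" and X: "\<And>\<beta> :: 'b covector. smooth_on S (\<lambda>y. blinfun_apply \<beta> (X y))"
  shows "smooth_on S X"
proof -
  obtain n :: nat and b c where c: "\<And>i. bounded_linear (c i)" "\<And>x::'b. x = (\<Sum>i<n. c i x *\<^sub>R b i)"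
    by (rule fin_dimE[OF fd]) (rule that)
  have "smooth_on S (\<lambda>y. c i (X y))" for i using X[of "Blinfun (c i)"] by (simp add: bounded_linear_Blinfun_apply c(1))
  then have "smooth_on S (\<lambda>y. \<Sum>i<n. c i (X y) *\<^sub>R b i)"
    by (intro smooth_on_sum[OF S] smooth_on_bilinear[OF bounded_bilinear_scaleR S] smooth_on_const)
  then show ?thesis by (simp add: c(2)[symmetric])
qed

text \<open>\<open>sharp\<close> is a definite description. Finite dimension gives existence, with
  coefficients \<open>\<pi> x \<alpha> (Blinfun (c i))\<close> along the \<open>b i\<close>, and
  covectors separating points gives uniqueness.\<close>

lemma sharp_apply:
  fixes \<pi> :: "'m \<Rightarrow> 'e::real_normed_vector covector \<Rightarrow> 'e covector \<Rightarrow> real"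
  assumes fd: "fin_dim TYPE('e)" and \<pi>: "bounded_bilinear (\<pi> x)"
  shows "blinfun_apply \<beta> (sharp \<pi> x \<alpha>) = \<pi> x \<alpha> \<beta>"
proof -
  interpret bounded_bilinear "\<pi> x" by (rule \<pi>)
  obtain n :: nat and b c where c: "\<And>i. bounded_linear (c i)" "\<And>x::'e. x = (\<Sum>i<n. c i x *\<^sub>R b i)"
    by (rule fin_dimE[OF fd]) (rule that)
  define X where "X = (\<Sum>i<n. \<pi> x \<alpha> (Blinfun (c i)) *\<^sub>R b i)"
  have "blinfun_apply \<beta> X = \<pi> x \<alpha> \<beta>" for \<beta>
  proof -
    have "\<pi> x \<alpha> \<beta> = (\<Sum>i<n. blinfun_apply \<beta> (b i) * \<pi> x \<alpha> (Blinfun (c i)))"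
      using arg_cong[OF covector_expansion[OF c, of \<beta>], of "\<pi> x \<alpha>"] by (simp only: sum_right scaleR_right real_scaleR_def)
    then show ?thesis by (simp add: X_def blinfun.bilinear_simps mult.commute)
  qed
  note X = this
  then have "sharp \<pi> x \<alpha> = X"
    unfolding sharp_def by (intro the_equality covector_separate[OF fd]) auto
  then show ?thesis by (simp add: X)
qed

section \<open>One-forms, functions and Lie derivatives in coordinates\<close>

lemma linear_covector_derivative:
  fixes B :: "'a::real_normed_vector \<Rightarrow> 'b::real_normed_vector covector"
  assumes "(B has_derivative B') (at y)"
  shows "((\<lambda>z. blinfun_apply (B z) v) has_derivative (\<lambda>u. blinfun_apply (B' u) v)) (at y)"
  by (rule bounded_linear.has_derivative[OF blinfun.bounded_linear_left assms])

text \<open>Packs the components into one covector-valued function, so that a one-form can be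
  differentiated as a whole instead of vector by vector.\<close>

definition lform :: "('m, 'e::real_normed_vector) atlas \<Rightarrow> ('m \<Rightarrow> 'e covector) \<Rightarrow> 'm \<Rightarrow> 'e \<Rightarrow> 'e covector" where
  "lform A \<alpha> p y = Blinfun (form1_in_chart A \<alpha> p y)"

definition vector_field :: "('m, 'e::real_normed_vector) atlas \<Rightarrow> ('m \<Rightarrow> 'e) \<Rightarrow> bool" where
  "vector_field A X \<longleftrightarrow> (\<forall>p. smooth_on (chart A p ` cdom A p) (field_in_chart A X p))"

lemma d_fun_apply:
  assumes "(f \<circ> ichart A p has_derivative D) (at (chart A p p))"
  shows "blinfun_apply (d_fun A f p) v = D v"
  unfolding d_fun_def frechet_derivative_at[OF assms, symmetric]
  using has_derivative_bounded_linear[OF assms] by (simp add: bounded_linear_Blinfun_apply)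

context
  fixes M :: "('m::t2_space, 'e::real_inner) atlas"
  assumes M: "smooth_atlas M"
begin

lemma cotangent_fin_dims: "fin_dim TYPE('e)" "fin_dim TYPE('e covector)"
  using atlas_fin_dim[OF M] fin_dim_covector by auto

lemma chart_center: "chart M p p \<in> chart M p ` cdom M p"
  using atlas_mem[OF M] by blast

lemma ichart_center: "ichart M p (chart M p p) = p"
  by (simp add: ichart_chart[OF M] atlas_mem[OF M])

lemma lform_apply:
  assumes y: "y \<in> chart M p ` cdom M p"
  shows "blinfun_apply (lform M \<alpha> p y) v = form1_in_chart M \<alpha> p y v"
proof -
  have "bounded_linear (form1_in_chart M \<alpha> p y)"
    unfolding form1_in_chart_def[abs_def] Let_def
    by (intro bounded_linear_compose[OF blinfun.bounded_linear_right from_chart_bounded[OF M ichart_mem[OF M y]]])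
  then show ?thesis by (simp add: lform_def bounded_linear_Blinfun_apply)
qed

lemma lform_center: "lform M \<alpha> p (chart M p p) = \<alpha> p"
  by (rule blinfun_eqI) (simp add: lform_apply[OF chart_center] form1_in_chart_def ichart_center from_chart_self[OF M])

lemma smooth_lform: "one_form M \<alpha> \<Longrightarrow> smooth_on (chart M p ` cdom M p) (lform M \<alpha> p)"
proof (rule smooth_on_blinfun[OF cotangent_fin_dims(1) atlas_open_image[OF M]])
  fix v assume "one_form M \<alpha>"
  then have "smooth_on (chart M p ` cdom M p) (\<lambda>y. form1_in_chart M \<alpha> p y v)" unfolding one_form_def by blast
  then show "smooth_on (chart M p ` cdom M p) (\<lambda>y. blinfun_apply (lform M \<alpha> p y) v)"
    by (rule smooth_on_cong[OF atlas_open_image[OF M], rotated]) (simp add: lform_apply)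
qed

lemma field_center: "field_in_chart M X p (chart M p p) = X p"
  by (simp add: field_in_chart_def ichart_center to_chart_self[OF M])

lemma from_chart_field: "y \<in> chart M p ` cdom M p \<Longrightarrow> from_chart M p (ichart M p y) (field_in_chart M X p y) = X (ichart M p y)"
  by (simp add: field_in_chart_def Let_def from_chart_to_chart[OF M ichart_mem[OF M]])

lemma one_form_add:
  assumes "one_form M \<alpha>" "one_form M \<beta>" shows "one_form M (\<lambda>x. \<alpha> x + \<beta> x)"
  using assms smooth_on_add[OF atlas_open_image[OF M]]
  unfolding one_form_def form1_in_chart_def Let_def blinfun.add_left by blast

lemma smooth_fun_minus: "smooth_fun M f \<Longrightarrow> smooth_fun M (\<lambda>x. - f x)"
  using smooth_on_minus[OF atlas_open_image[OF M]] unfolding smooth_fun_def comp_def by blast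

lemma smooth_fun_derivative:
  "smooth_fun M f \<Longrightarrow> (f \<circ> ichart M p has_derivative frechet_derivative (f \<circ> ichart M p) (at (chart M p p))) (at (chart M p p))"
  unfolding smooth_fun_def using smooth_on_has_derivative chart_center by blast

lemma d_fun_add:
  assumes "smooth_fun M f" "smooth_fun M g"
  shows "d_fun M (\<lambda>x. f x + g x) p = d_fun M f p + d_fun M g p"
proof (rule blinfun_eqI)
  fix v
  note d = smooth_fun_derivative[OF assms(1), of p] smooth_fun_derivative[OF assms(2), of p]
  have "((\<lambda>x. f x + g x) \<circ> ichart M p has_derivative (\<lambda>v. blinfun_apply (d_fun M f p) v + blinfun_apply (d_fun M g p) v)) (at (chart M p p))"
    unfolding d_fun_apply[OF d(1)] d_fun_apply[OF d(2)] using has_derivative_add[OF d] by (simp add: comp_def)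
  from d_fun_apply[OF this] show "blinfun_apply (d_fun M (\<lambda>x. f x + g x) p) v = blinfun_apply (d_fun M f p + d_fun M g p) v"
    by (simp add: blinfun.add_left)
qed

lemma d_fun_minus:
  assumes "smooth_fun M f" shows "d_fun M (\<lambda>x. - f x) p = - d_fun M f p"
proof (rule blinfun_eqI)
  fix v
  note d = smooth_fun_derivative[OF assms(1), of p]
  have "((\<lambda>x. - f x) \<circ> ichart M p has_derivative (\<lambda>v. - blinfun_apply (d_fun M f p) v)) (at (chart M p p))"
    unfolding d_fun_apply[OF d] using has_derivative_minus[OF d] by (simp add: comp_def)
  from d_fun_apply[OF this] show "blinfun_apply (d_fun M (\<lambda>x. - f x) p) v = blinfun_apply (- d_fun M f p) v"
    by (simp add: blinfun.minus_left)
qed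

text \<open>The map inside \<open>Blinfun\<close> is bounded linear once the derivative of the
  components at a fixed vector is recognised as the derivative of \<open>lform\<close> evaluated
  there.\<close>

lemma lie_deriv_apply:
  assumes \<beta>: "one_form M \<beta>" and X: "vector_field M X"
  shows "blinfun_apply (lie_deriv M X \<beta> p) v =
    blinfun_apply (frechet_derivative (lform M \<beta> p) (at (chart M p p)) (X p)) v
     + blinfun_apply (\<beta> p) (frechet_derivative (field_in_chart M X p) (at (chart M p p)) v)"
proof -
  let ?y = "chart M p p"
  have "((\<lambda>y. form1_in_chart M \<beta> p y v) has_derivative
      (\<lambda>u. blinfun_apply (frechet_derivative (lform M \<beta> p) (at ?y) u) v)) (at ?y)" for v
    by (rule has_derivative_transform_within_open[OF
          linear_covector_derivative[OF smooth_on_has_derivative[OF smooth_lform[OF \<beta>] chart_center]]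
          atlas_open_image[OF M] chart_center])
      (simp add: lform_apply)
  from frechet_derivative_at[OF this, symmetric]
  have e: "frechet_derivative (\<lambda>y. form1_in_chart M \<beta> p y v) (at ?y) u =
      blinfun_apply (frechet_derivative (lform M \<beta> p) (at ?y) u) v" for u v by simp
  have "bounded_linear (frechet_derivative (field_in_chart M X p) (at ?y))"
    using X smooth_on_has_derivative[OF _ chart_center] has_derivative_bounded_linear unfolding vector_field_def by blast
  then have "bounded_linear (\<lambda>v. blinfun_apply (frechet_derivative (lform M \<beta> p) (at ?y) (X p)) v
     + blinfun_apply (\<beta> p) (frechet_derivative (field_in_chart M X p) (at ?y) v))"
    by (intro bounded_linear_add blinfun.bounded_linear_right bounded_linear_compose[OF blinfun.bounded_linear_right])
  then show ?thesis unfolding lie_deriv_def e by (simp add: bounded_linear_Blinfun_apply)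
qed

lemma lie_deriv_add:
  assumes \<alpha>: "one_form M \<alpha>" and \<beta>: "one_form M \<beta>" and X: "vector_field M X"
  shows "lie_deriv M X (\<lambda>x. \<alpha> x + \<beta> x) p = lie_deriv M X \<alpha> p + lie_deriv M X \<beta> p"
proof (rule blinfun_eqI)
  fix v
  let ?y = "chart M p p"
  have "(lform M (\<lambda>x. \<alpha> x + \<beta> x) p has_derivative (\<lambda>u. frechet_derivative (lform M \<alpha> p) (at ?y) u + frechet_derivative (lform M \<beta> p) (at ?y) u)) (at ?y)"
    by (rule has_derivative_transform_within_open[OF
          has_derivative_add[OF smooth_on_has_derivative[OF smooth_lform[OF \<alpha>] chart_center] smooth_on_has_derivative[OF smooth_lform[OF \<beta>] chart_center]]
          atlas_open_image[OF M] chart_center])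
       (rule blinfun_eqI, simp add: lform_apply form1_in_chart_def Let_def blinfun.add_left)
  from frechet_derivative_at[OF this, symmetric]
  show "blinfun_apply (lie_deriv M X (\<lambda>x. \<alpha> x + \<beta> x) p) v = blinfun_apply (lie_deriv M X \<alpha> p + lie_deriv M X \<beta> p) v"
    by (simp add: lie_deriv_apply[OF _ X] one_form_add \<alpha> \<beta> blinfun.add_left)
qed

section \<open>Contraction of two-forms with vector fields\<close>

lemma form_sharp_apply: "two_form M B \<Longrightarrow> blinfun_apply (form_sharp B x X) v = B x X v"
  by (simp add: form_sharp_def bounded_linear_Blinfun_apply bounded_bilinear.bounded_linear_right[OF two_form_bilinear])

lemma form2_fields:
  "y \<in> chart M p ` cdom M p \<Longrightarrow>
    form2_in_chart M B p y (field_in_chart M X p y) (field_in_chart M Y p y) = B (ichart M p y) (X (ichart M p y)) (Y (ichart M p y))"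
  by (simp add: form2_in_chart_def Let_def from_chart_field)

lemma form1_contract:
  "two_form M B \<Longrightarrow> y \<in> chart M p ` cdom M p \<Longrightarrow>
    form1_in_chart M (\<lambda>x. form_sharp B x (X x)) p y v = form2_in_chart M B p y (field_in_chart M X p y) v"
  by (simp add: form1_in_chart_def form2_in_chart_def Let_def form_sharp_apply from_chart_field)

lemma one_form_contract:
  assumes B: "two_form M B" and X: "vector_field M X"
  shows "one_form M (\<lambda>x. form_sharp B x (X x))"
  unfolding one_form_def
proof (intro allI)
  fix p v
  have "smooth_on (chart M p ` cdom M p) (\<lambda>y. form2_in_chart M B p y (field_in_chart M X p y) v)"
    using X unfolding vector_field_def
    by (intro smooth_form2_apply[OF M B atlas_open_image[OF M] smooth_on_ident] smooth_on_const) auto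
  then show "smooth_on (chart M p ` cdom M p) (\<lambda>y. form1_in_chart M (\<lambda>x. form_sharp B x (X x)) p y v)"
    by (rule smooth_on_cong[OF atlas_open_image[OF M], rotated]) (simp add: form1_contract[OF B])
qed

lemma smooth_fun_form2:
  assumes B: "two_form M B" and X: "vector_field M X" and Y: "vector_field M Y"
  shows "smooth_fun M (\<lambda>x. B x (X x) (Y x))"
  unfolding smooth_fun_def
proof
  fix p
  have "smooth_on (chart M p ` cdom M p) (\<lambda>y. form2_in_chart M B p y (field_in_chart M X p y) (field_in_chart M Y p y))"
    using X Y unfolding vector_field_def
    by (intro smooth_form2_apply[OF M B atlas_open_image[OF M] smooth_on_ident]) auto
  then show "smooth_on (chart M p ` cdom M p) ((\<lambda>x. B x (X x) (Y x)) \<circ> ichart M p)"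
    by (rule smooth_on_cong[OF atlas_open_image[OF M], rotated]) (simp add: form2_fields)
qed

text \<open>In coordinates the derivatives of \<open>B\<close> assemble into \<open>d_form2\<close>
  on \<open>X\<close>, \<open>Y\<close>, \<open>v\<close>, which is zero. Derivatives of one field
  along the other give the Lie bracket, and the derivatives of the fields in direction
  \<open>v\<close> cancel.\<close>

lemma cartan_contract_bracket:
  assumes B: "two_form M B" and closed: "closed_form M B" and X: "vector_field M X" and Y: "vector_field M Y"
  shows "lie_deriv M X (\<lambda>x. form_sharp B x (Y x)) p - lie_deriv M Y (\<lambda>x. form_sharp B x (X x)) p
    + d_fun M (\<lambda>x. B x (X x) (Y x)) p = form_sharp B p (lie_bracket M X Y p)"
proof (rule blinfun_eqI)
  fix v
  let ?y = "chart M p p" and ?S = "chart M p ` cdom M p"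
  let ?W = "form2_in_chart M B p"
  let ?X = "field_in_chart M X p" and ?Y = "field_in_chart M Y p"
  let ?W' = "\<lambda>a b. frechet_derivative (\<lambda>y. ?W y a b) (at ?y)"
  let ?X' = "frechet_derivative ?X (at ?y)" and ?Y' = "frechet_derivative ?Y (at ?y)"
  note fd = cotangent_fin_dims(1) and oS = atlas_open_image[OF M, of p] and c = chart_center[of p]
  interpret b: bounded_bilinear "B p" by (rule two_form_bilinear[OF B])
  have X': "(?X has_derivative ?X') (at ?y)" and Y': "(?Y has_derivative ?Y') (at ?y)"
    using X Y smooth_on_has_derivative[OF _ c] unfolding vector_field_def by blast+
  have W': "((\<lambda>y. ?W y a b) has_derivative ?W' a b) (at ?y)" for a b
    by (rule smooth_on_has_derivative[OF smooth_form2[OF B] c])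
  have d1: "((\<lambda>y. ?W y (Z y) w) has_derivative (\<lambda>u. ?W' (Z ?y) w u + B p (Z' u) w)) (at ?y)"
    if "(Z has_derivative Z') (at ?y)" for Z Z' w
    using has_derivative_apply[where F="\<lambda>y a. ?W y a w", OF fd oS c _ W' that] form2_linear_left[OF M B]
    by (simp add: form2_in_chart_self[OF M])
  have d2: "((\<lambda>y. ?W y (?X y) (?Y y)) has_derivative (\<lambda>u. (?W' (X p) (Y p) u + B p (?X' u) (Y p)) + B p (X p) (?Y' u))) (at ?y)"
    using has_derivative_apply[where F="\<lambda>y b. ?W y (?X y) b", OF fd oS c _ d1[OF X'] Y'] form2_linear_right[OF M B]
    by (simp add: form2_in_chart_self[OF M] field_center)
  have l: "blinfun_apply (frechet_derivative (lform M (\<lambda>x. form_sharp B x (Z x)) p) (at ?y) u) v = ?W' (Z p) v u + B p (frechet_derivative (field_in_chart M Z p) (at ?y) u) v"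
    if Z: "vector_field M Z" for Z u
  proof -
    have "(field_in_chart M Z p has_derivative frechet_derivative (field_in_chart M Z p) (at ?y)) (at ?y)"
      using Z smooth_on_has_derivative[OF _ c] unfolding vector_field_def by blast
    note d1[OF this, of v]
    then have 1: "((\<lambda>y. ?W y (field_in_chart M Z p y) v) has_derivative (\<lambda>u. ?W' (Z p) v u + B p (frechet_derivative (field_in_chart M Z p) (at ?y) u) v)) (at ?y)"
      by (simp add: field_center)
    have 2: "((\<lambda>y. ?W y (field_in_chart M Z p y) v) has_derivative (\<lambda>u. blinfun_apply (frechet_derivative (lform M (\<lambda>x. form_sharp B x (Z x)) p) (at ?y) u) v)) (at ?y)"
      by (rule has_derivative_transform_within_open[OF
          linear_covector_derivative[OF smooth_on_has_derivative[OF smooth_lform[OF one_form_contract[OF B Z]] c]] oS c])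
        (simp add: lform_apply form1_contract[OF B])
    from fun_cong[OF has_derivative_unique[OF 2 1], of u] show ?thesis .
  qed
  have "((\<lambda>x. B x (X x) (Y x)) \<circ> ichart M p has_derivative (\<lambda>u. (?W' (X p) (Y p) u + B p (?X' u) (Y p)) + B p (X p) (?Y' u))) (at ?y)"
    by (rule has_derivative_transform_within_open[OF d2 oS c]) (simp add: form2_fields)
  note d = d_fun_apply[OF this]
  have "d_form2 M B p (X p) (Y p) v = 0" using closed unfolding closed_form_def by blast
  then have dB: "?W' (Y p) v (X p) - ?W' (X p) v (Y p) + ?W' (X p) (Y p) v = 0" unfolding d_form2_def .
  have "B p (Y p) (?X' v) = - B p (?X' v) (Y p)" by (rule two_form_antisym[OF B])
  then show "blinfun_apply (lie_deriv M X (\<lambda>x. form_sharp B x (Y x)) p - lie_deriv M Y (\<lambda>x. form_sharp B x (X x)) p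
    + d_fun M (\<lambda>x. B x (X x) (Y x)) p) v = blinfun_apply (form_sharp B p (lie_bracket M X Y p)) v"
    using dB
    by (simp add: blinfun.add_left blinfun.diff_left lie_deriv_apply one_form_contract B X Y l d form_sharp_apply lie_bracket_def b.diff_left)
qed

end

context
  fixes M :: "('m::t2_space, 'e::real_inner) atlas"
  assumes M: "smooth_atlas M"
begin

text \<open>The Jacobi identity in \<open>poisson\<close> only speaks of globally defined functions; applied to functions that
  are affine near \<open>p\<close> it becomes an identity for the components of the bivector at \<open>p\<close>.\<close>

lemma locally_affine_function:
  fixes a :: "'e covector"
  obtains f where "smooth_fun M f"
    "\<forall>\<^sub>F y in nhds (chart M p p). f (ichart M p y) = blinfun_apply a (y - chart M p p)"
proof -
  let ?y = "chart M p p"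
  note fd = atlas_fin_dim[OF M]
  obtain r where r: "r > 0" "cball ?y r \<subseteq> chart M p ` cdom M p"
    using open_contains_cball[of "chart M p ` cdom M p"] atlas_open_image[OF M] chart_center[OF M, of p] by blast
  \<comment> \<open>The cutoff is composed with the squared norm, which unlike the norm is smooth at
    the centre.\<close>
  obtain \<theta> :: "real \<Rightarrow> real" where \<theta>: "smooth_on UNIV \<theta>" "\<And>t. t \<le> (r/2)^2 \<Longrightarrow> \<theta> t = 1" "\<And>t. t \<ge> r^2 \<Longrightarrow> \<theta> t = 0"
    using bump_exists[of "(r/2)^2" "r^2"] r(1) by (auto simp: power_divide)
  define h where "h y = \<theta> ((y - ?y) \<bullet> (y - ?y)) * blinfun_apply a (y - ?y)" for y
  define f where "f q = (if q \<in> cdom M p then h (chart M p q) else 0)" for q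
  define K where "K = ichart M p ` cball ?y r"
  have h: "smooth_on UNIV h" unfolding h_def
    by (intro smooth_on_bilinear[OF bounded_bilinear_mult] smooth_on_bounded_linear[OF blinfun.bounded_linear_right]
        smooth_on_compose[OF fin_dim_real open_UNIV open_UNIV _ _ \<theta>(1)] smooth_on_bilinear[OF bounded_bilinear_inner]
        smooth_on_diff smooth_on_ident smooth_on_const) auto
  have "compact K" unfolding K_def
    by (intro compact_continuous_image fin_dim_compact_cball[OF fd] continuous_on_subset[OF homeomorphism_cont2[OF atlas_homeo[OF M]] r(2)])
  \<comment> \<open>Here the Hausdorff property of the base enters: a compact set is closed, so
    outside the chart domain \<open>f\<close> vanishes on a whole neighbourhood.\<close>
  then have K: "closed K" by (rule compact_imp_closed)
  have K0: "f q = 0" if "q \<notin> K" for q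
  proof (cases "q \<in> cdom M p")
    case True
    then have "chart M p q \<notin> cball ?y r" using that ichart_chart[OF M True] by (force simp: K_def)
    then have "norm (chart M p q - ?y) > r" by (simp add: dist_norm norm_minus_commute)
    then have "(chart M p q - ?y) \<bullet> (chart M p q - ?y) \<ge> r^2"
      using r(1) unfolding power2_norm_eq_inner[symmetric] by (intro power_mono) auto
    then show ?thesis using True \<theta>(3) by (simp add: f_def h_def)
  qed (simp add: f_def)
  have "smooth_fun M f" unfolding smooth_fun_def
  proof (intro allI smooth_on_local)
    fix p' y assume y: "y \<in> chart M p' ` cdom M p'"
    define q where "q = ichart M p' y"
    have q: "q \<in> cdom M p'" "chart M p' q = y" using y by (auto simp: q_def ichart_chart[OF M])
    show "\<exists>T. open T \<and> y \<in> T \<and> smooth_on T (f \<circ> ichart M p')"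
    proof (cases "q \<in> cdom M p")
      case True
      let ?U = "chart M p' ` (cdom M p' \<inter> cdom M p)"
      have U: "open ?U" by (auto intro!: open_chart_image[OF M] atlas_open[OF M])
      have "smooth_on ?U (chart M p \<circ> ichart M p')" using M unfolding smooth_atlas_def by blast
      then have "smooth_on ?U (\<lambda>y. h ((chart M p \<circ> ichart M p') y))"
        by (rule smooth_on_compose[OF fd U open_UNIV UNIV_I _ h])
      then have "smooth_on ?U (f \<circ> ichart M p')"
        by (rule smooth_on_cong[OF U, rotated]) (auto simp: f_def ichart_chart[OF M])
      then show ?thesis using U q True by blast
    next
      case False
      have "K \<subseteq> cdom M p" unfolding K_def using r(2) ichart_mem[OF M] by blast
      then have "q \<notin> K" using False by blast
      let ?U = "chart M p' ` (cdom M p' \<inter> - K)"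
      have U: "open ?U" using K by (auto intro!: open_chart_image[OF M] atlas_open[OF M])
      have "smooth_on ?U (f \<circ> ichart M p')"
        by (rule smooth_on_cong[OF U _ smooth_on_const[of _ 0]]) (auto simp: K0 ichart_chart[OF M])
      then show ?thesis using U q \<open>q \<notin> K\<close> by blast
    qed
  qed
  moreover have "\<forall>\<^sub>F y in nhds ?y. f (ichart M p y) = blinfun_apply a (y - ?y)"
  proof (rule eventually_mono[OF eventually_nhds_in_open[OF open_ball, of ?y ?y "r/2"]])
    fix y assume y: "y \<in> ball ?y (r/2)"
    then have "y \<in> cball ?y r" using r(1) by auto
    then have "ichart M p y \<in> cdom M p" "chart M p (ichart M p y) = y"
      using r(2) ichart_mem[OF M] chart_ichart[OF M] by blast+
    moreover have "(y - ?y) \<bullet> (y - ?y) \<le> (r/2)^2"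
      using y r(1) unfolding power2_norm_eq_inner[symmetric] by (intro power_mono) (auto simp: dist_norm norm_minus_commute)
    ultimately show "f (ichart M p y) = blinfun_apply a (y - ?y)" by (simp add: f_def h_def \<theta>(2))
  qed (use r in auto)
  ultimately show ?thesis by (rule that)
qed

section \<open>Bivector fields, the Jacobi identity in coordinates and the anchor\<close>

context
  fixes \<pi> :: "'m \<Rightarrow> 'e covector \<Rightarrow> 'e covector \<Rightarrow> real"
  assumes \<pi>: "bivector_field M \<pi>"
begin

lemma bivector_bilinear: "bounded_bilinear (\<pi> x)"
  using \<pi> unfolding bivector_field_def by blast

lemma bivector_antisym: "\<pi> x a b = - \<pi> x b a"
proof -
  interpret bounded_bilinear "\<pi> x" by (rule bivector_bilinear)
  have "\<pi> x (a + b) (a + b) = 0" "\<pi> x a a = 0" "\<pi> x b b = 0" using \<pi> unfolding bivector_field_def by auto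
  then show ?thesis by (simp add: add_left add_right)
qed

lemma bivector_sharp: "blinfun_apply b (sharp \<pi> x a) = \<pi> x a b"
  by (rule sharp_apply[OF atlas_fin_dim[OF M] bivector_bilinear])

lemma sharp_linear: "linear (sharp \<pi> x)"
proof -
  interpret bounded_bilinear "\<pi> x" by (rule bivector_bilinear)
  show ?thesis
    by (rule linearI; rule covector_separate[OF atlas_fin_dim[OF M]])
      (simp_all add: bivector_sharp blinfun.add_right blinfun.scaleR_right add_left scaleR_left)
qed

lemma bivector_chart_antisym: "bivector_in_chart M \<pi> p y a b = - bivector_in_chart M \<pi> p y b a"
  unfolding bivector_in_chart_def Let_def by (rule bivector_antisym)

lemma bivector_chart_linear_left: "linear (\<lambda>a. bivector_in_chart M \<pi> p y a b)"
proof -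
  interpret bounded_bilinear "\<pi> (ichart M p y)" by (rule bivector_bilinear)
  have "(a + a') o\<^sub>L T = (a o\<^sub>L T) + (a' o\<^sub>L T)" "(r *\<^sub>R a) o\<^sub>L T = r *\<^sub>R (a o\<^sub>L T)"
    for a a' :: "'e covector" and T :: "'e \<Rightarrow>\<^sub>L 'e" and r
    by (auto intro!: blinfun_eqI simp: blinfun.add_left blinfun.scaleR_left)
  then show ?thesis unfolding bivector_in_chart_def Let_def
    by (intro linearI) (simp_all add: add_left scaleR_left)
qed

lemma bivector_chart_linear_right: "linear (\<lambda>b. bivector_in_chart M \<pi> p y a b)"
  unfolding bivector_chart_antisym[of _ _ a] by (rule linear_compose_neg[OF bivector_chart_linear_left])

lemma bivector_chart_center: "bivector_in_chart M \<pi> p (chart M p p) a b = \<pi> p a b"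
proof -
  have "bounded_linear (to_chart M p p)" by (rule to_chart_bounded[OF M atlas_mem[OF M]])
  then have "c o\<^sub>L Blinfun (to_chart M p p) = c" for c :: "'e covector"
    by (intro blinfun_eqI) (simp add: bounded_linear_Blinfun_apply to_chart_self[OF M])
  then show ?thesis by (simp add: bivector_in_chart_def Let_def ichart_center[OF M])
qed

lemma smooth_bivector_chart: "smooth_on (chart M p ` cdom M p) (\<lambda>y. bivector_in_chart M \<pi> p y a b)"
  using \<pi> unfolding bivector_field_def by blast

lemma lform_pullback:
  assumes y: "y \<in> chart M p ` cdom M p"
  shows "lform M \<alpha> p y o\<^sub>L Blinfun (to_chart M p (ichart M p y)) = \<alpha> (ichart M p y)"
  by (rule blinfun_eqI)
    (simp add: bounded_linear_Blinfun_apply[OF to_chart_bounded[OF M ichart_mem[OF M y]]] lform_apply[OF M y]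
      form1_in_chart_def Let_def from_chart_to_chart[OF M ichart_mem[OF M y]])

lemma bivector_chart_forms:
  "y \<in> chart M p ` cdom M p \<Longrightarrow>
    bivector_in_chart M \<pi> p y (lform M \<alpha> p y) (lform M \<beta> p y) = \<pi> (ichart M p y) (\<alpha> (ichart M p y)) (\<beta> (ichart M p y))"
  by (simp add: bivector_in_chart_def Let_def lform_pullback)

lemma sharp_field_chart:
  assumes y: "y \<in> chart M p ` cdom M p"
  shows "blinfun_apply c (field_in_chart M (\<lambda>x. sharp \<pi> x (\<alpha> x)) p y) = bivector_in_chart M \<pi> p y (lform M \<alpha> p y) c"
proof -
  let ?q = "ichart M p y"
  have "blinfun_apply c (to_chart M p ?q (sharp \<pi> ?q (\<alpha> ?q))) = blinfun_apply (c o\<^sub>L Blinfun (to_chart M p ?q)) (sharp \<pi> ?q (\<alpha> ?q))"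
    by (simp add: bounded_linear_Blinfun_apply[OF to_chart_bounded[OF M ichart_mem[OF M y]]])
  then show ?thesis
    by (simp add: field_in_chart_def bivector_in_chart_def Let_def bivector_sharp lform_pullback[OF y])
qed

lemma smooth_bivector_apply:
  assumes "smooth_on (chart M p ` cdom M p) \<alpha>" "smooth_on (chart M p ` cdom M p) \<beta>"
  shows "smooth_on (chart M p ` cdom M p) (\<lambda>y. bivector_in_chart M \<pi> p y (\<alpha> y) (\<beta> y))"
proof -
  note fd = fin_dim_covector[OF atlas_fin_dim[OF M]] and oS = atlas_open_image[OF M, of p]
  have "smooth_on (chart M p ` cdom M p) (\<lambda>y. bivector_in_chart M \<pi> p y (\<alpha> y) b)" for b
    by (rule smooth_on_apply[where F="\<lambda>y a. bivector_in_chart M \<pi> p y a b", OF fd oS _ smooth_bivector_chart assms(1)])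
      (rule bivector_chart_linear_left)
  then show ?thesis
    by (rule smooth_on_apply[where F="\<lambda>y b. bivector_in_chart M \<pi> p y (\<alpha> y) b", OF fd oS _ _ assms(2), rotated])
      (rule bivector_chart_linear_right)
qed

lemma vector_field_sharp:
  assumes "one_form M \<alpha>" shows "vector_field M (\<lambda>x. sharp \<pi> x (\<alpha> x))"
  unfolding vector_field_def
proof
  fix p
  note oS = atlas_open_image[OF M, of p]
  show "smooth_on (chart M p ` cdom M p) (field_in_chart M (\<lambda>x. sharp \<pi> x (\<alpha> x)) p)"
  proof (rule smooth_on_covectors[OF atlas_fin_dim[OF M] oS])
    fix b :: "'e covector"
    have "smooth_on (chart M p ` cdom M p) (\<lambda>y. bivector_in_chart M \<pi> p y (lform M \<alpha> p y) b)"
      by (rule smooth_bivector_apply[OF smooth_lform[OF M assms] smooth_on_const])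
    then show "smooth_on (chart M p ` cdom M p) (\<lambda>y. blinfun_apply b (field_in_chart M (\<lambda>x. sharp \<pi> x (\<alpha> x)) p y))"
      by (rule smooth_on_cong[OF oS, rotated]) (simp add: sharp_field_chart)
  qed
qed

lemma smooth_fun_bivector:
  assumes "one_form M \<alpha>" "one_form M \<beta>" shows "smooth_fun M (\<lambda>x. \<pi> x (\<alpha> x) (\<beta> x))"
  unfolding smooth_fun_def
proof
  fix p
  show "smooth_on (chart M p ` cdom M p) ((\<lambda>x. \<pi> x (\<alpha> x) (\<beta> x)) \<circ> ichart M p)"
    by (rule smooth_on_cong[OF atlas_open_image[OF M] _ smooth_bivector_apply[OF smooth_lform[OF M assms(1)] smooth_lform[OF M assms(2)]]])
      (simp add: bivector_chart_forms)
qed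

text \<open>Near \<open>p\<close> the three functions have constant differentials \<open>a\<close>,
  \<open>b\<close>, \<open>c\<close> in the chart, so an inner bracket is a component of \<pi> and
  the outer bracket differentiates it along \<open>sharp\<close>. Being affine, the functions
  contribute no second derivatives.\<close>

lemma poisson_jacobi_chart:
  fixes p
  defines "P' \<equiv> \<lambda>a b. frechet_derivative (\<lambda>y. bivector_in_chart M \<pi> p y a b) (at (chart M p p))"
  assumes pois: "poisson M \<pi>"
  shows "P' b c (sharp \<pi> p a) + P' c a (sharp \<pi> p b) + P' a b (sharp \<pi> p c) = 0"
proof -
  let ?y = "chart M p p"
  define good where "good a f \<longleftrightarrow> smooth_fun M f \<and> (\<forall>\<^sub>F y in nhds ?y. f (ichart M p y) = blinfun_apply a (y - ?y))" for a f
  \<comment> \<open>The differential at a nearby point is expressed in the chart attached to that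
    point, hence the composition with \<open>to_chart\<close>.\<close>
  have df: "\<exists>U. open U \<and> ?y \<in> U \<and> (\<forall>y\<in>U. y \<in> chart M p ` cdom M p \<and> d_fun M f (ichart M p y) = a o\<^sub>L Blinfun (to_chart M p (ichart M p y)))"
    if "good a f" for a f
  proof -
    have "\<forall>\<^sub>F y in nhds ?y. f (ichart M p y) = blinfun_apply a (y - ?y)"
      using that unfolding good_def by (rule conjunct2)
    then obtain V where V: "open V" "?y \<in> V" "\<And>y. y \<in> V \<Longrightarrow> f (ichart M p y) = blinfun_apply a (y - ?y)"
      unfolding eventually_nhds by (elim exE conjE) (rule that, auto)
    define U where "U = V \<inter> chart M p ` cdom M p"
    have "d_fun M f (ichart M p y) = a o\<^sub>L Blinfun (to_chart M p (ichart M p y))" if y: "y \<in> U" for y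
    proof (rule blinfun_eqI)
      fix v
      define q where "q = ichart M p y"
      have yi: "y \<in> chart M p ` cdom M p" using y by (simp add: U_def)
      have q: "q \<in> cdom M p" "chart M p q = y" using ichart_mem[OF M yi] chart_ichart[OF M yi] by (auto simp: q_def)
      have md: "(chart M p \<circ> ichart M q has_derivative to_chart M p q) (at (chart M q q))"
        using mdiff_has_derivative[OF mdiff_ident[OF M] atlas_mem[OF M, of q], of p] q(1)
        by (simp add: to_chart_eq_Drep comp_def)
      have "((\<lambda>z. blinfun_apply a ((chart M p \<circ> ichart M q) z - ?y)) has_derivative (\<lambda>v. blinfun_apply a (to_chart M p q v))) (at (chart M q q))"
        using bounded_linear.has_derivative[OF blinfun.bounded_linear_right has_derivative_diff[OF md has_derivative_const], of a ?y] by simp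
      then have "(f \<circ> ichart M q has_derivative (\<lambda>v. blinfun_apply a (to_chart M p q v))) (at (chart M q q))"
      proof (rule has_derivative_transform_nhds)
        have oU: "open (ichart M p ` U)"
        proof -
          have "ichart M p ` U = cdom M p \<inter> chart M p -` V"
            using ichart_mem[OF M] chart_ichart[OF M] ichart_chart[OF M]
            by (auto simp: U_def intro!: image_eqI[of _ "ichart M p"])
          then show ?thesis
            using continuous_open_preimage[OF homeomorphism_cont1[OF atlas_homeo[OF M]] atlas_open[OF M] V(1)] by simp
        qed
        have "\<forall>\<^sub>F z in nhds q. z \<in> ichart M p ` U"
          by (rule eventually_nhds_in_open[OF oU]) (use y in \<open>auto simp: q_def\<close>)
        from eventually_ichart[OF M atlas_mem[OF M, of q] this]
        show "\<forall>\<^sub>F z in nhds (chart M q q). blinfun_apply a ((chart M p \<circ> ichart M q) z - ?y) = (f \<circ> ichart M q) z"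
        proof (rule eventually_mono)
          fix z assume "z \<in> chart M q ` cdom M q \<and> ichart M q z \<in> ichart M p ` U"
          then obtain w where w: "w \<in> U" "ichart M q z = ichart M p w" by blast
          then show "blinfun_apply a ((chart M p \<circ> ichart M q) z - ?y) = (f \<circ> ichart M q) z"
            using V(3)[of w] by (simp add: U_def chart_ichart[OF M])
        qed
      qed
      from d_fun_apply[OF this]
      show "blinfun_apply (d_fun M f (ichart M p y)) v = blinfun_apply (a o\<^sub>L Blinfun (to_chart M p (ichart M p y))) v"
        by (simp add: bounded_linear_Blinfun_apply[OF to_chart_bounded[OF M q(1)]] q_def[symmetric])
    qed
    then show ?thesis using V chart_center[OF M] atlas_open_image[OF M, of p]
      by (intro exI[of _ U]) (auto simp: U_def)
  qed
  have dc: "d_fun M f p = a" if good: "good a f" for a f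
  proof -
    obtain U where "?y \<in> U" "\<forall>y\<in>U. y \<in> chart M p ` cdom M p \<and> d_fun M f (ichart M p y) = a o\<^sub>L Blinfun (to_chart M p (ichart M p y))"
      using df[OF good] by blast
    then have "d_fun M f (ichart M p ?y) = a o\<^sub>L Blinfun (to_chart M p (ichart M p ?y))" by blast
    then have "d_fun M f p = a o\<^sub>L Blinfun (to_chart M p p)" by (simp add: ichart_center[OF M])
    then show ?thesis
      by (intro blinfun_eqI) (simp add: bounded_linear_Blinfun_apply[OF to_chart_bounded[OF M atlas_mem[OF M]]] to_chart_self[OF M])
  qed
  have br: "\<pi> p (d_fun M f p) (d_fun M (\<lambda>x. \<pi> x (d_fun M g x) (d_fun M h x)) p) = P' b c (sharp \<pi> p a)"
    if f: "good a f" and g: "good b g" and h: "good c h" for a b c f g h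
  proof -
    obtain U where U: "open U" "?y \<in> U" "\<And>y. y \<in> U \<Longrightarrow> y \<in> chart M p ` cdom M p \<and> d_fun M g (ichart M p y) = b o\<^sub>L Blinfun (to_chart M p (ichart M p y))"
      using df[OF g] by blast
    obtain V where V: "open V" "?y \<in> V" "\<And>y. y \<in> V \<Longrightarrow> d_fun M h (ichart M p y) = c o\<^sub>L Blinfun (to_chart M p (ichart M p y))"
      using df[OF h] by blast
    have "((\<lambda>y. bivector_in_chart M \<pi> p y b c) has_derivative P' b c) (at ?y)"
      unfolding P'_def by (rule smooth_on_has_derivative[OF smooth_bivector_chart chart_center[OF M]])
    then have "((\<lambda>x. \<pi> x (d_fun M g x) (d_fun M h x)) \<circ> ichart M p has_derivative P' b c) (at ?y)"
      by (rule has_derivative_transform_within_open[of _ _ _ _ "U \<inter> V"])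
        (use U V in \<open>auto simp: bivector_in_chart_def Let_def\<close>)
    from d_fun_apply[OF this, of "sharp \<pi> p a"] show ?thesis by (simp add: dc[OF f] bivector_sharp)
  qed
  obtain f where f: "good a f" using locally_affine_function[of p a] unfolding good_def by blast
  obtain g where g: "good b g" using locally_affine_function[of p b] unfolding good_def by blast
  obtain h where h: "good c h" using locally_affine_function[of p c] unfolding good_def by blast
  have "\<pi> p (d_fun M f p) (d_fun M (\<lambda>x. \<pi> x (d_fun M g x) (d_fun M h x)) p) +
      \<pi> p (d_fun M g p) (d_fun M (\<lambda>x. \<pi> x (d_fun M h x) (d_fun M f x)) p) +
      \<pi> p (d_fun M h p) (d_fun M (\<lambda>x. \<pi> x (d_fun M f x) (d_fun M g x)) p) = 0"
    using pois f g h unfolding poisson_def Let_def good_def by blast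
  then show ?thesis by (simp only: br[OF f g h] br[OF g h f] br[OF h f g])
qed

text \<open>Both sides are paired with a covector \<open>c\<close> and expanded at \<open>p\<close>.
  The derivatives of \<alpha> and \<beta> match term by term; those of the components of \<pi> match
  by the coordinate Jacobi identity.\<close>

lemma sharp_bracket:
  assumes pois: "poisson M \<pi>" and \<alpha>: "one_form M \<alpha>" and \<beta>: "one_form M \<beta>"
  shows "sharp \<pi> p (bracket (cotangent_algebroid M \<pi>) \<alpha> \<beta> p) =
    lie_bracket M (\<lambda>x. sharp \<pi> x (\<alpha> x)) (\<lambda>x. sharp \<pi> x (\<beta> x)) p"
proof (rule covector_separate[OF atlas_fin_dim[OF M]])
  fix c :: "'e covector"
  let ?y = "chart M p p" and ?S = "chart M p ` cdom M p"
  let ?P = "bivector_in_chart M \<pi> p"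
  let ?X = "field_in_chart M (\<lambda>x. sharp \<pi> x (\<alpha> x)) p" and ?Y = "field_in_chart M (\<lambda>x. sharp \<pi> x (\<beta> x)) p"
  define P' where "P' a b = frechet_derivative (\<lambda>y. ?P y a b) (at ?y)" for a b
  define A' where "A' = frechet_derivative (lform M \<alpha> p) (at ?y)"
  define B' where "B' = frechet_derivative (lform M \<beta> p) (at ?y)"
  define X' where "X' = frechet_derivative ?X (at ?y)"
  define Y' where "Y' = frechet_derivative ?Y (at ?y)"
  define X0 where "X0 = sharp \<pi> p (\<alpha> p)"
  define Y0 where "Y0 = sharp \<pi> p (\<beta> p)"
  note fd = fin_dim_covector[OF atlas_fin_dim[OF M]] and oS = atlas_open_image[OF M, of p] and c = chart_center[OF M, of p]
  interpret b: bounded_bilinear "\<pi> p" by (rule bivector_bilinear)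
  have hA: "(lform M \<alpha> p has_derivative A') (at ?y)" unfolding A'_def by (rule smooth_on_has_derivative[OF smooth_lform[OF M \<alpha>] c])
  have hB: "(lform M \<beta> p has_derivative B') (at ?y)" unfolding B'_def by (rule smooth_on_has_derivative[OF smooth_lform[OF M \<beta>] c])
  have hX: "(?X has_derivative X') (at ?y)" unfolding X'_def
    using vector_field_sharp[OF \<alpha>] smooth_on_has_derivative[OF _ c] unfolding vector_field_def by blast
  have hY: "(?Y has_derivative Y') (at ?y)" unfolding Y'_def
    using vector_field_sharp[OF \<beta>] smooth_on_has_derivative[OF _ c] unfolding vector_field_def by blast
  have P': "((\<lambda>y. ?P y a b) has_derivative P' a b) (at ?y)" for a b
    unfolding P'_def by (rule smooth_on_has_derivative[OF smooth_bivector_chart c])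
  have P1: "((\<lambda>y. ?P y (lform M \<gamma> p y) k) has_derivative (\<lambda>u. P' (\<gamma> p) k u + \<pi> p (D u) k)) (at ?y)"
    if "(lform M \<gamma> p has_derivative D) (at ?y)" for \<gamma> D k
    using has_derivative_apply[where F="\<lambda>y a. ?P y a k", OF fd oS c bivector_chart_linear_left P' that]
    by (simp add: bivector_chart_center lform_center[OF M])
  have P2: "((\<lambda>y. ?P y (lform M \<alpha> p y) (lform M \<beta> p y)) has_derivative
      (\<lambda>u. (P' (\<alpha> p) (\<beta> p) u + \<pi> p (A' u) (\<beta> p)) + \<pi> p (\<alpha> p) (B' u))) (at ?y)"
    using has_derivative_apply[where F="\<lambda>y b. ?P y (lform M \<alpha> p y) b", OF fd oS c bivector_chart_linear_right P1[OF hA] hB]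
    by (simp add: bivector_chart_center lform_center[OF M])
  have kX: "blinfun_apply k (X' u) = P' (\<alpha> p) k u + \<pi> p (A' u) k" for k u
  proof -
    have "((\<lambda>y. ?P y (lform M \<alpha> p y) k) has_derivative (\<lambda>u. blinfun_apply k (X' u))) (at ?y)"
      by (rule has_derivative_transform_within_open[OF bounded_linear.has_derivative[OF blinfun.bounded_linear_right hX] oS c])
        (simp add: sharp_field_chart)
    from fun_cong[OF has_derivative_unique[OF this P1[OF hA]]] show ?thesis .
  qed
  have kY: "blinfun_apply k (Y' u) = P' (\<beta> p) k u + \<pi> p (B' u) k" for k u
  proof -
    have "((\<lambda>y. ?P y (lform M \<beta> p y) k) has_derivative (\<lambda>u. blinfun_apply k (Y' u))) (at ?y)"
      by (rule has_derivative_transform_within_open[OF bounded_linear.has_derivative[OF blinfun.bounded_linear_right hY] oS c])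
        (simp add: sharp_field_chart)
    from fun_cong[OF has_derivative_unique[OF this P1[OF hB]]] show ?thesis .
  qed
  have P'anti: "P' a b u = - P' b a u" for a b u
    using fun_cong[OF has_derivative_unique[OF P'[of a b] has_derivative_minus[OF P'[of b a], folded bivector_chart_antisym]], of u]
    by simp
  have "((\<lambda>x. \<pi> x (\<alpha> x) (\<beta> x)) \<circ> ichart M p has_derivative (\<lambda>u. (P' (\<alpha> p) (\<beta> p) u + \<pi> p (A' u) (\<beta> p)) + \<pi> p (\<alpha> p) (B' u))) (at ?y)"
    by (rule has_derivative_transform_within_open[OF P2 oS c]) (simp add: bivector_chart_forms)
  note d = d_fun_apply[OF this]
  \<comment> \<open>The derivatives of \<alpha> and \<beta> in direction \<open>v\<close> cancel
    between the Lie derivatives and the differential of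
    \<open>\<pi>(\<alpha>, \<beta>)\<close>.\<close>
  have br: "blinfun_apply (bracket (cotangent_algebroid M \<pi>) \<alpha> \<beta> p) v =
      blinfun_apply (B' X0 - A' Y0) v + P' (\<alpha> p) (\<beta> p) v" for v
    using P'anti[of "\<beta> p" "\<alpha> p" v] bivector_antisym[of p "B' v" "\<alpha> p"]
    by (simp add: cotangent_algebroid_def blinfun.diff_left lie_deriv_apply[OF M] \<alpha> \<beta> vector_field_sharp d
        A'_def[symmetric] B'_def[symmetric] X'_def[symmetric] Y'_def[symmetric] X0_def[symmetric] Y0_def[symmetric] kX kY)
  have "\<pi> p (bracket (cotangent_algebroid M \<pi>) \<alpha> \<beta> p) c = - blinfun_apply (bracket (cotangent_algebroid M \<pi>) \<alpha> \<beta> p) (sharp \<pi> p c)"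
    by (simp add: bivector_sharp) (rule bivector_antisym)
  also have "\<dots> = \<pi> p (B' X0 - A' Y0) c - P' (\<alpha> p) (\<beta> p) (sharp \<pi> p c)"
    unfolding br using bivector_antisym[of p c "B' X0 - A' Y0"] by (simp add: bivector_sharp)
  \<comment> \<open>The Jacobi identity trades the derivative of \<pi> along
    \<open>sharp \<pi> p c\<close> for derivatives along \<open>X0\<close> and
    \<open>Y0\<close>.\<close>
  also have "\<dots> = \<pi> p (B' X0) c - \<pi> p (A' Y0) c + P' (\<beta> p) c X0 - P' (\<alpha> p) c Y0"
    using poisson_jacobi_chart[OF pois, of p "\<beta> p" c "\<alpha> p", folded P'_def X0_def Y0_def] P'anti[of c "\<alpha> p" Y0]
    by (simp add: b.diff_left)
  also have "\<dots> = blinfun_apply c (Y' X0 - X' Y0)"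
    by (simp add: kX kY blinfun.diff_right)
  finally show "blinfun_apply c (sharp \<pi> p (bracket (cotangent_algebroid M \<pi>) \<alpha> \<beta> p)) =
      blinfun_apply c (lie_bracket M (\<lambda>x. sharp \<pi> x (\<alpha> x)) (\<lambda>x. sharp \<pi> x (\<beta> x)) p)"
    by (simp add: bivector_sharp lie_bracket_def X'_def Y'_def X0_def Y0_def)
qed

end

end

section \<open>Composition of bundle maps and of algebroid isomorphisms\<close>

lemma bundle_map_comp:
  assumes "bundle_map P Q \<sigma>" "bundle_map Q R \<Phi>"
  shows "bundle_map P R (\<lambda>x a. \<Phi> x (\<sigma> x a))"
proof -
  have "\<forall>q\<in>sections Q. (\<lambda>x. \<Phi> x (q x)) \<in> sections R" "\<forall>p\<in>sections P. (\<lambda>x. \<sigma> x (p x)) \<in> sections Q"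
    using assms unfolding bundle_map_def by blast+
  then have "(\<lambda>x. \<Phi> x (\<sigma> x (p x))) \<in> sections R" if "p \<in> sections P" for p
    using bspec[of "sections Q" _ "\<lambda>x. \<sigma> x (p x)"] that by simp
  then show ?thesis using assms unfolding bundle_map_def by simp
qed

text \<open>\<open>bundle_map\<close> evaluates its argument on fibres only; the subspace condition
  keeps sums and multiples inside the region where the two maps agree.\<close>

lemma bundle_map_cong:
  assumes "bundle_map P Q \<sigma>" and eq: "\<And>x a. a \<in> fibre P x \<Longrightarrow> \<tau> x a = \<sigma> x a"
    and sub: "\<And>x. subspace (fibre P x)" and sec: "\<And>a x. a \<in> sections P \<Longrightarrow> a x \<in> fibre P x"
  shows "bundle_map P Q \<tau>"
proof -
  have "(\<lambda>x. \<tau> x (a x)) = (\<lambda>x. \<sigma> x (a x))" if "a \<in> sections P" for a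
    using eq sec[OF that] by blast
  then show ?thesis
    using assms(1) eq subspace_add[OF sub] subspace_scale[OF sub] unfolding bundle_map_def by simp
qed

text \<open>Agreement of \<tau> with the composite is asked on fibres only, because the IM-form of
  the gauged form is not controlled off \<open>ker Ts\<close>. The price is \<open>br\<close>, which
  places brackets of sections in the fibres.\<close>

lemma algebroid_iso_compose:
  assumes \<sigma>: "algebroid_iso P Q \<sigma>" and \<Phi>: "algebroid_iso Q R \<Phi>"
    and \<tau>: "\<And>x a. a \<in> fibre P x \<Longrightarrow> \<tau> x a = \<Phi> x (\<sigma> x a)"
    and br: "\<And>a b x. a \<in> sections P \<Longrightarrow> b \<in> sections P \<Longrightarrow> bracket P a b x \<in> fibre P x"
    and subP: "\<And>x. subspace (fibre P x)" and secP: "\<And>a x. a \<in> sections P \<Longrightarrow> a x \<in> fibre P x"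
    and subR: "\<And>x. subspace (fibre R x)" and secR: "\<And>a x. a \<in> sections R \<Longrightarrow> a x \<in> fibre R x"
  shows "algebroid_iso P R \<tau>"
proof -
  have \<sigma>b: "bij_betw (\<sigma> x) (fibre P x) (fibre Q x)" and \<Phi>b: "bij_betw (\<Phi> x) (fibre Q x) (fibre R x)" for x
    using \<sigma> \<Phi> unfolding algebroid_iso_def bundle_iso_def by blast+
  have \<sigma>m: "bundle_map P Q \<sigma>" and \<Phi>m: "bundle_map Q R \<Phi>" and \<sigma>i: "bundle_map Q P (\<lambda>x. inv_into (fibre P x) (\<sigma> x))"
    and \<Phi>i: "bundle_map R Q (\<lambda>x. inv_into (fibre Q x) (\<Phi> x))"
    using \<sigma> \<Phi> unfolding algebroid_iso_def bundle_iso_def by blast+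
  have \<tau>sec: "(\<lambda>x. \<tau> x (a x)) = (\<lambda>x. \<Phi> x (\<sigma> x (a x)))" if "a \<in> sections P" for a
    using \<tau> secP[OF that] by blast
  have \<sigma>sec: "(\<lambda>x. \<sigma> x (a x)) \<in> sections Q" if "a \<in> sections P" for a
    using \<sigma>m that unfolding bundle_map_def by blast
  have \<sigma>f: "\<sigma> x a \<in> fibre Q x" if "a \<in> fibre P x" for x a
    using \<sigma>m that unfolding bundle_map_def by blast
  have m: "bundle_map P R \<tau>"
    by (rule bundle_map_cong[OF bundle_map_comp[OF \<sigma>m \<Phi>m]]) (simp_all add: \<tau> subP secP)
  have b: "bij_betw (\<tau> x) (fibre P x) (fibre R x)" for x
    using bij_betw_trans[OF \<sigma>b \<Phi>b, of x] bij_betw_cong[of "fibre P x" "\<tau> x" "\<Phi> x \<circ> \<sigma> x"] \<tau> by simp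
  have inv: "inv_into (fibre P x) (\<tau> x) c = inv_into (fibre P x) (\<sigma> x) (inv_into (fibre Q x) (\<Phi> x) c)"
    if c: "c \<in> fibre R x" for x c
  proof -
    define q where "q = inv_into (fibre Q x) (\<Phi> x) c"
    have q: "q \<in> fibre Q x" "\<Phi> x q = c"
      using bij_betw_imp_surj_on[OF \<Phi>b, of x] c unfolding q_def by (auto intro: inv_into_into f_inv_into_f)
    define a where "a = inv_into (fibre P x) (\<sigma> x) q"
    have a: "a \<in> fibre P x" "\<sigma> x a = q"
      using bij_betw_imp_surj_on[OF \<sigma>b, of x] q unfolding a_def by (auto intro: inv_into_into f_inv_into_f)
    have "\<tau> x a = c" using a q \<tau> by simp
    then have "inv_into (fibre P x) (\<tau> x) c = a" using b[of x] a(1) by (metis bij_betw_inv_into_left)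
    then show ?thesis by (simp add: a_def q_def)
  qed
  have i: "bundle_map R P (\<lambda>x. inv_into (fibre P x) (\<tau> x))"
    by (rule bundle_map_cong[OF bundle_map_comp[OF \<Phi>i \<sigma>i]]) (simp_all add: inv subR secR)
  have anc: "anchor R x (\<tau> x a) = anchor P x a" if "a \<in> fibre P x" for x a
    using \<sigma> \<Phi> \<sigma>f[OF that] \<tau>[OF that] that unfolding algebroid_iso_def by simp
  have brk: "\<tau> x (bracket P a b x) = bracket R (\<lambda>x. \<tau> x (a x)) (\<lambda>x. \<tau> x (b x)) x"
    if "a \<in> sections P" "b \<in> sections P" for a b x
  proof -
    have "\<sigma> x (bracket P a b x) = bracket Q (\<lambda>x. \<sigma> x (a x)) (\<lambda>x. \<sigma> x (b x)) x"
      using \<sigma> that unfolding algebroid_iso_def by blast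
    moreover have "\<Phi> x (bracket Q (\<lambda>x. \<sigma> x (a x)) (\<lambda>x. \<sigma> x (b x)) x) =
        bracket R (\<lambda>x. \<Phi> x (\<sigma> x (a x))) (\<lambda>x. \<Phi> x (\<sigma> x (b x))) x"
      using \<Phi> \<sigma>sec[OF that(1)] \<sigma>sec[OF that(2)] unfolding algebroid_iso_def by blast
    ultimately show ?thesis unfolding \<tau>sec[OF that(1)] \<tau>sec[OF that(2)] \<tau>[OF br[OF that]] by simp
  qed
  show ?thesis unfolding algebroid_iso_def bundle_iso_def using m b i anc brk by blast
qed

section \<open>Linear combinations of closed two-forms\<close>

lemma bounded_bilinear_lincomb:
  fixes f g :: "'a::real_normed_vector \<Rightarrow> 'b::real_normed_vector \<Rightarrow> real"
  assumes "bounded_bilinear f" "bounded_bilinear g"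
  shows "bounded_bilinear (\<lambda>x y. r * f x y + s * g x y)"
proof -
  interpret f: bounded_bilinear f by fact
  interpret g: bounded_bilinear g by fact
  obtain K L where K: "\<And>x y. norm (f x y) \<le> norm x * norm y * K" and L: "\<And>x y. norm (g x y) \<le> norm x * norm y * L"
    using f.bounded g.bounded by blast
  show ?thesis
  proof
    show "\<exists>K. \<forall>x y. norm (r * f x y + s * g x y) \<le> norm x * norm y * K"
    proof (intro exI allI)
      fix x y
      have "norm (r * f x y + s * g x y) \<le> \<bar>r\<bar> * norm (f x y) + \<bar>s\<bar> * norm (g x y)"
        by (rule order_trans[OF norm_triangle_ineq]) (simp add: abs_mult)
      also have "\<dots> \<le> \<bar>r\<bar> * (norm x * norm y * K) + \<bar>s\<bar> * (norm x * norm y * L)"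
        by (intro add_mono mult_left_mono K L) auto
      also have "\<dots> = norm x * norm y * (\<bar>r\<bar> * K + \<bar>s\<bar> * L)" by (simp add: algebra_simps)
      finally show "norm (r * f x y + s * g x y) \<le> norm x * norm y * (\<bar>r\<bar> * K + \<bar>s\<bar> * L)" .
    qed
  qed (simp_all add: f.add_left f.add_right g.add_left g.add_right f.scaleR_left f.scaleR_right g.scaleR_left g.scaleR_right algebra_simps)
qed

text \<open>Two coefficients cover sums, differences and, with \<open>r = -1\<close> and
  \<open>s = 0\<close>, negatives.\<close>

lemma two_form_lincomb:
  fixes r s :: real
  assumes A: "smooth_atlas A" and \<omega>: "two_form A \<omega>" and \<eta>: "two_form A \<eta>"
  shows "two_form A (\<lambda>p v w. r * \<omega> p v w + s * \<eta> p v w)"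
  unfolding two_form_def
proof (intro conjI allI)
  fix p v w
  show "bounded_bilinear (\<lambda>v w. r * \<omega> p v w + s * \<eta> p v w)"
    by (intro bounded_bilinear_lincomb two_form_bilinear[OF \<omega>] two_form_bilinear[OF \<eta>])
  show "r * \<omega> p v v + s * \<eta> p v v = 0" using \<omega> \<eta> unfolding two_form_def by simp
  have "smooth_on (chart A p ` cdom A p) (\<lambda>y. r * form2_in_chart A \<omega> p y v w + s * form2_in_chart A \<eta> p y v w)"
    by (intro smooth_on_add atlas_open_image[OF A] smooth_on_bounded_linear[OF bounded_linear_mult_right] smooth_form2 \<omega> \<eta>)
  then show "smooth_on (chart A p ` cdom A p) (\<lambda>y. form2_in_chart A (\<lambda>p v w. r * \<omega> p v w + s * \<eta> p v w) p y v w)"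
    by (simp add: form2_in_chart_def Let_def)
qed

lemma closed_form_lincomb:
  fixes r s :: real
  assumes A: "smooth_atlas A" and \<omega>: "two_form A \<omega>" "closed_form A \<omega>" and \<eta>: "two_form A \<eta>" "closed_form A \<eta>"
  shows "closed_form A (\<lambda>p v w. r * \<omega> p v w + s * \<eta> p v w)"
  unfolding closed_form_def
proof (intro allI)
  fix p u v w
  let ?y = "chart A p p"
  let ?D = "\<lambda>\<omega> v w. frechet_derivative (\<lambda>y. form2_in_chart A \<omega> p y v w) (at ?y)"
  have y: "?y \<in> chart A p ` cdom A p" using atlas_mem[OF A] by blast
  have d: "((\<lambda>y. form2_in_chart A \<zeta> p y v w) has_derivative ?D \<zeta> v w) (at ?y)" if "two_form A \<zeta>" for \<zeta> v w
    by (rule smooth_on_has_derivative[OF smooth_form2[OF that] y])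
  have "((\<lambda>y. form2_in_chart A (\<lambda>p v w. r * \<omega> p v w + s * \<eta> p v w) p y v w) has_derivative (\<lambda>u. r * ?D \<omega> v w u + s * ?D \<eta> v w u)) (at ?y)" for v w
    using has_derivative_add[OF has_derivative_mult_right[OF d[OF \<omega>(1)]] has_derivative_mult_right[OF d[OF \<eta>(1)]]]
    by (simp add: form2_in_chart_def Let_def)
  from frechet_derivative_at[OF this, symmetric]
  have "d_form2 A (\<lambda>p v w. r * \<omega> p v w + s * \<eta> p v w) p u v w = r * d_form2 A \<omega> p u v w + s * d_form2 A \<eta> p u v w"
    by (simp add: d_form2_def algebra_simps)
  also have "\<dots> = 0" using \<omega>(2) \<eta>(2) unfolding closed_form_def by simp
  finally show "d_form2 A (\<lambda>p v w. r * \<omega> p v w + s * \<eta> p v w) p u v w = 0" .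
qed

lemma cotangent_algebroid_simps:
  "fibre (cotangent_algebroid M \<pi>) x = UNIV"
  "sections (cotangent_algebroid M \<pi>) = {\<alpha>. one_form M \<alpha>}"
  "anchor (cotangent_algebroid M \<pi>) = sharp \<pi>"
  by (simp_all add: cotangent_algebroid_def)

section \<open>The gauge map of a closed two-form\<close>

context
  fixes M :: "('m::t2_space, 'e::real_inner) atlas"
  assumes M: "smooth_atlas M"
begin

lemma gauge_map_linear:
  assumes \<pi>: "bivector_field M \<pi>" and B: "two_form M B"
  shows "linear (gauge_map \<pi> B x)"
proof -
  interpret b: bounded_bilinear "B x" by (rule two_form_bilinear[OF B])
  note l = sharp_linear[OF M \<pi>, of x]
  show ?thesis unfolding gauge_map_def
    by (rule linearI; rule blinfun_eqI)
      (simp_all add: blinfun.add_left blinfun.scaleR_left form_sharp_apply[OF M B] linear_add[OF l] linear_scale[OF l]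
        b.add_left b.scaleR_left algebra_simps)
qed

lemma one_form_gauge:
  assumes \<pi>: "bivector_field M \<pi>" and B: "two_form M B" and \<alpha>: "one_form M \<alpha>"
  shows "one_form M (\<lambda>x. gauge_map \<pi> B x (\<alpha> x))"
  unfolding gauge_map_def
  by (intro one_form_add[OF M] \<alpha> one_form_contract[OF M B] vector_field_sharp[OF M \<pi>])

text \<open>By \<open>sharp_bracket\<close> the gauge map adds the contraction of \<open>B\<close>
  with \<open>[X, Y]\<close> to the bracket, and Cartan's formula distributes it over the three
  terms. The result serves twice: as the bracket axiom of an IM-form and, once the last term is
  rewritten by \<open>\<pi>\<^sub>B\<close>, as compatibility with the gauged bracket.\<close>

lemma gauge_map_bracket:
  fixes p
  assumes pois: "poisson M \<pi>" and B: "two_form M B" and closed: "closed_form M B"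
    and \<alpha>: "one_form M \<alpha>" and \<beta>: "one_form M \<beta>"
  defines "X \<equiv> \<lambda>x. sharp \<pi> x (\<alpha> x)" and "Y \<equiv> \<lambda>x. sharp \<pi> x (\<beta> x)"
  shows "gauge_map \<pi> B p (bracket (cotangent_algebroid M \<pi>) \<alpha> \<beta> p) =
    lie_deriv M X (\<lambda>x. gauge_map \<pi> B x (\<beta> x)) p - lie_deriv M Y (\<lambda>x. gauge_map \<pi> B x (\<alpha> x)) p
    + d_fun M (\<lambda>x. blinfun_apply (gauge_map \<pi> B x (\<alpha> x)) (Y x)) p"
proof -
  have \<pi>: "bivector_field M \<pi>" using pois by (simp add: poisson_def)
  have X: "vector_field M X" and Y: "vector_field M Y"
    unfolding X_def Y_def using vector_field_sharp[OF M \<pi>] \<alpha> \<beta> by blast+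
  have d: "d_fun M (\<lambda>x. blinfun_apply (gauge_map \<pi> B x (\<alpha> x)) (Y x)) p =
      - d_fun M (\<lambda>x. \<pi> x (\<alpha> x) (\<beta> x)) p + d_fun M (\<lambda>x. B x (X x) (Y x)) p"
  proof -
    \<comment> \<open>The sign comes from \<open>sharp\<close>: pairing \<alpha> with
      \<open>Y\<close> gives \<open>\<pi>(\<beta>, \<alpha>)\<close>, the negative of the term in
      the bracket.\<close>
    have "blinfun_apply (gauge_map \<pi> B x (\<alpha> x)) (Y x) = - \<pi> x (\<alpha> x) (\<beta> x) + B x (X x) (Y x)" for x
      unfolding gauge_map_def blinfun.add_left form_sharp_apply[OF M B] X_def Y_def
      using bivector_antisym[OF M \<pi>, of x "\<beta> x" "\<alpha> x"] by (simp add: bivector_sharp[OF M \<pi>])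
    then show ?thesis
      using d_fun_add[OF M smooth_fun_minus[OF M smooth_fun_bivector[OF M \<pi> \<alpha> \<beta>]] smooth_fun_form2[OF M B X Y], of p]
        d_fun_minus[OF M smooth_fun_bivector[OF M \<pi> \<alpha> \<beta>], of p] by simp
  qed
  have L: "lie_deriv M X (\<lambda>x. gauge_map \<pi> B x (\<beta> x)) p = lie_deriv M X \<beta> p + lie_deriv M X (\<lambda>x. form_sharp B x (Y x)) p"
    "lie_deriv M Y (\<lambda>x. gauge_map \<pi> B x (\<alpha> x)) p = lie_deriv M Y \<alpha> p + lie_deriv M Y (\<lambda>x. form_sharp B x (X x)) p"
    using lie_deriv_add[OF M \<beta> one_form_contract[OF M B Y] X] lie_deriv_add[OF M \<alpha> one_form_contract[OF M B X] Y]
    by (simp_all add: gauge_map_def X_def Y_def)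
  have br: "bracket (cotangent_algebroid M \<pi>) \<alpha> \<beta> p = lie_deriv M X \<beta> p - lie_deriv M Y \<alpha> p - d_fun M (\<lambda>x. \<pi> x (\<alpha> x) (\<beta> x)) p"
    by (simp add: cotangent_algebroid_def X_def Y_def)
  have "gauge_map \<pi> B p (bracket (cotangent_algebroid M \<pi>) \<alpha> \<beta> p) =
      bracket (cotangent_algebroid M \<pi>) \<alpha> \<beta> p + form_sharp B p (lie_bracket M X Y p)"
    using sharp_bracket[OF M \<pi> pois \<alpha> \<beta>, of p] by (simp add: gauge_map_def X_def Y_def)
  then show ?thesis
    unfolding d L cartan_contract_bracket[OF M B closed X Y, of p, symmetric] br by (simp add: algebra_simps)
qed

lemma gauge_map_IM:
  assumes pois: "poisson M \<pi>" and B: "two_form M B" and closed: "closed_form M B"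
  shows "IM_2_form M (cotangent_algebroid M \<pi>) (gauge_map \<pi> B)"
proof -
  have \<pi>: "bivector_field M \<pi>" using pois by (simp add: poisson_def)
  note l = gauge_map_linear[OF \<pi> B]
  have bm: "bundle_map (cotangent_algebroid M \<pi>) (cotangent_bundle M) (gauge_map \<pi> B)"
    unfolding bundle_map_def
    by (auto simp: cotangent_algebroid_simps cotangent_bundle_def linear_add[OF l] linear_scale[OF l] one_form_gauge[OF \<pi> B])
  have anti: "blinfun_apply (gauge_map \<pi> B x a) (sharp \<pi> x b) = - blinfun_apply (gauge_map \<pi> B x b) (sharp \<pi> x a)" for x a b
    unfolding gauge_map_def blinfun.add_left form_sharp_apply[OF M B]
    using bivector_antisym[OF M \<pi>, of x b a] two_form_antisym[OF B, of x "sharp \<pi> x a" "sharp \<pi> x b"]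
    by (simp add: bivector_sharp[OF M \<pi>])
  show ?thesis
    unfolding IM_2_form_def cotangent_algebroid_simps mem_Collect_eq Ball_def
    by (intro conjI allI impI bm anti gauge_map_bracket[OF pois B closed])
qed

context
  fixes \<pi> \<pi>\<^sub>B B
  assumes pois: "poisson M \<pi>" and pois_B: "poisson M \<pi>\<^sub>B" and B: "two_form M B" and closed: "closed_form M B"
    and graph: "gauge_transf B ` poisson_graph \<pi> = poisson_graph \<pi>\<^sub>B"
begin

text \<open>A gauge transformation keeps the vector component, and the graph of a bivector has
  exactly one vector over each covector.\<close>

lemma sharp_gauge: "sharp \<pi>\<^sub>B x (gauge_map \<pi> B x \<alpha>) = sharp \<pi> x \<alpha>"
proof -
  have "gauge_transf B (x, sharp \<pi> x \<alpha>, \<alpha>) \<in> poisson_graph \<pi>\<^sub>B"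
    unfolding graph[symmetric] by (rule imageI) (auto simp: poisson_graph_def)
  then show ?thesis by (auto simp: gauge_transf_def poisson_graph_def gauge_map_def)
qed

text \<open>Since the anchors agree, the \<open>B\<close>-term in \<beta> can be computed from
  \<beta> itself and subtracted. Conversely the other inclusion of graphs supplies a \<gamma> whose
  gauge transform lies over \<beta>, and the same subtraction identifies it with \<alpha>.\<close>

lemma gauge_map_eq_iff: "gauge_map \<pi> B x \<alpha> = \<beta> \<longleftrightarrow> \<alpha> = gauge_map \<pi>\<^sub>B (\<lambda>x v w. - B x v w) x \<beta>"
proof -
  have neg: "form_sharp (\<lambda>x v w. - B x v w) x X = - form_sharp B x X" for X
  proof (rule blinfun_eqI)
    fix v
    have "bounded_linear (\<lambda>w. - B x X w)"
      by (intro bounded_linear_minus bounded_bilinear.bounded_linear_right[OF two_form_bilinear[OF B]])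
    then show "blinfun_apply (form_sharp (\<lambda>x v w. - B x v w) x X) v = blinfun_apply (- form_sharp B x X) v"
      by (simp add: blinfun.minus_left form_sharp_apply[OF M B]) (simp add: form_sharp_def bounded_linear_Blinfun_apply)
  qed
  show ?thesis
  proof
    assume "gauge_map \<pi> B x \<alpha> = \<beta>"
    moreover from this have "sharp \<pi>\<^sub>B x \<beta> = sharp \<pi> x \<alpha>" using sharp_gauge by blast
    ultimately show "\<alpha> = gauge_map \<pi>\<^sub>B (\<lambda>x v w. - B x v w) x \<beta>" by (auto simp: gauge_map_def neg)
  next
    assume \<alpha>: "\<alpha> = gauge_map \<pi>\<^sub>B (\<lambda>x v w. - B x v w) x \<beta>"
    have "(x, sharp \<pi>\<^sub>B x \<beta>, \<beta>) \<in> gauge_transf B ` poisson_graph \<pi>"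
      unfolding graph by (auto simp: poisson_graph_def)
    then obtain \<gamma> where "sharp \<pi>\<^sub>B x \<beta> = sharp \<pi> x \<gamma>" "\<beta> = \<gamma> + form_sharp B x (sharp \<pi> x \<gamma>)"
      by (auto simp: poisson_graph_def gauge_transf_def)
    moreover from this have "\<alpha> = \<gamma>" by (simp add: \<alpha> gauge_map_def neg)
    ultimately show "gauge_map \<pi> B x \<alpha> = \<beta>" by (simp add: gauge_map_def)
  qed
qed

text \<open>Transfers injectivity from Id + B# \<pi># to Id + \<pi># B#: the covector
  \<open>B# u\<close> lies in the kernel of the gauge map, hence vanishes, and \<open>u\<close> is
  minus its image under \<open>\<pi>#\<close>.\<close>

lemma gauge_fixed_vector:
  assumes "u = - sharp \<pi> x (form_sharp B x u)" shows "u = 0"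
proof -
  have \<pi>: "bivector_field M \<pi>" using pois by (simp add: poisson_def)
  interpret b: bounded_bilinear "B x" by (rule two_form_bilinear[OF B])
  let ?\<beta> = "form_sharp B x u"
  have s: "sharp \<pi> x ?\<beta> = - u"
    using arg_cong[OF assms, of uminus] unfolding minus_minus by (rule sym)
  have "gauge_map \<pi> B x ?\<beta> = 0"
    by (rule blinfun_eqI) (simp add: gauge_map_def s blinfun.add_left form_sharp_apply[OF M B] b.minus_left)
  then have "?\<beta> = gauge_map \<pi>\<^sub>B (\<lambda>x v w. - B x v w) x 0" by (simp add: gauge_map_eq_iff)
  moreover have "0 = gauge_map \<pi>\<^sub>B (\<lambda>x v w. - B x v w) x 0"
    using linear_0[OF gauge_map_linear[OF \<pi> B]] gauge_map_eq_iff by blast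
  ultimately have "?\<beta> = 0" by simp
  then show ?thesis using assms linear_0[OF sharp_linear[OF M \<pi>, of x]] by simp
qed

lemma gauge_map_algebroid_iso:
  "algebroid_iso (cotangent_algebroid M \<pi>) (cotangent_algebroid M \<pi>\<^sub>B) (gauge_map \<pi> B)"
proof -
  have \<pi>: "bivector_field M \<pi>" "bivector_field M \<pi>\<^sub>B" using pois pois_B by (simp_all add: poisson_def)
  let ?N = "\<lambda>x v w. - B x v w"
  have B': "two_form M ?N"
    using two_form_lincomb[OF M B B, of "-1" 0] by simp
  note l = gauge_map_linear[OF \<pi>(1) B] and l' = gauge_map_linear[OF \<pi>(2) B']
  have i1: "gauge_map \<pi>\<^sub>B ?N x (gauge_map \<pi> B x a) = a" for x a
    using gauge_map_eq_iff[of x a "gauge_map \<pi> B x a"] by simp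
  have i2: "gauge_map \<pi> B x (gauge_map \<pi>\<^sub>B ?N x b) = b" for x b
    using gauge_map_eq_iff[of x "gauge_map \<pi>\<^sub>B ?N x b" b] by simp
  have bij: "bij (gauge_map \<pi> B x)" for x
    by (rule o_bij[of "gauge_map \<pi>\<^sub>B ?N x"]) (auto simp: fun_eq_iff i1 i2)
  \<comment> \<open>The inverse is itself a gauge map, so it preserves smooth sections for the same
    reason as the original.\<close>
  have inv: "inv_into UNIV (gauge_map \<pi> B x) = gauge_map \<pi>\<^sub>B ?N x" for x
    using bij[of x] by (intro ext inv_f_eq) (auto simp: i2 bij_def)
  have brk: "gauge_map \<pi> B x (bracket (cotangent_algebroid M \<pi>) \<alpha> \<beta> x) =
      bracket (cotangent_algebroid M \<pi>\<^sub>B) (\<lambda>x. gauge_map \<pi> B x (\<alpha> x)) (\<lambda>x. gauge_map \<pi> B x (\<beta> x)) x"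
    if ab: "one_form M \<alpha>" "one_form M \<beta>" for \<alpha> \<beta> x
  proof -
    let ?a = "\<lambda>x. gauge_map \<pi> B x (\<alpha> x)" and ?b = "\<lambda>x. gauge_map \<pi> B x (\<beta> x)"
    \<comment> \<open>Evaluating \<open>\<pi>\<^sub>B\<close> on gauged forms through the anchor of
      \<pi> identifies the differential in \<open>gauge_map_bracket\<close> with the one in the
      bracket of \<open>\<pi>\<^sub>B\<close>.\<close>
    have "\<pi>\<^sub>B x (?a x) (?b x) = - blinfun_apply (?a x) (sharp \<pi> x (\<beta> x))" for x
      using bivector_antisym[OF M \<pi>(2), of x "?a x" "?b x"]
      by (simp add: bivector_sharp[OF M \<pi>(2), of "?a x", symmetric] sharp_gauge)
    moreover have "smooth_fun M (\<lambda>x. \<pi>\<^sub>B x (?a x) (?b x))"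
      by (intro smooth_fun_bivector[OF M \<pi>(2)] one_form_gauge[OF \<pi>(1) B] ab)
    ultimately have "d_fun M (\<lambda>x. blinfun_apply (?a x) (sharp \<pi> x (\<beta> x))) x = - d_fun M (\<lambda>x. \<pi>\<^sub>B x (?a x) (?b x)) x"
      using d_fun_minus[OF M, of "\<lambda>x. \<pi>\<^sub>B x (?a x) (?b x)" x] by simp
    then show ?thesis
      using gauge_map_bracket[OF pois B closed ab] by (simp add: cotangent_algebroid_def sharp_gauge)
  qed
  show ?thesis
    unfolding algebroid_iso_def bundle_iso_def bundle_map_def cotangent_algebroid_simps inv
    using one_form_gauge[OF \<pi>(1) B] one_form_gauge[OF \<pi>(2) B']
    by (auto simp: linear_add[OF l] linear_scale[OF l] linear_add[OF l'] linear_scale[OF l'] bij sharp_gauge brk)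
qed

end

end

section \<open>The gauge-transformed symplectic groupoid\<close>

theorem proposition4p8:
  fixes M :: "('m::{t2_space,second_countable_topology}, 'e::real_inner) atlas"
    and C :: "('g::topological_space, 'f::real_inner) atlas"
    and G :: "('g, 'm) groupoid"
    and \<pi> \<pi>\<^sub>B :: "'m \<Rightarrow> 'e covector \<Rightarrow> 'e covector \<Rightarrow> real"
    and \<omega>\<^sub>G :: "'g \<Rightarrow> 'f \<Rightarrow> 'f \<Rightarrow> real"
    and B :: "'m \<Rightarrow> 'e \<Rightarrow> 'e \<Rightarrow> real"
  assumes "smooth_atlas M" and "poisson M \<pi>"
    and "symplectic_groupoid M C G \<omega>\<^sub>G" and "integrates M C G \<omega>\<^sub>G \<pi>"
    and "\<And>x. connected {g. src G g = x}" and "\<And>x. simply_connected {g. src G g = x}"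
    and "two_form M B" and "closed_form M B" and "admissible M \<pi> B"
    and "poisson M \<pi>\<^sub>B" and "gauge_transf B ` poisson_graph \<pi> = poisson_graph \<pi>\<^sub>B"
  shows "let B\<^sub>G = (\<lambda>g v w. pullback2 C M (tgt G) B g v w - pullback2 C M (src G) B g v w);
             \<omega>\<^sub>B = (\<lambda>g v w. \<omega>\<^sub>G g v w + B\<^sub>G g v w);
             \<Phi>\<^sub>B = gauge_map \<pi> B
         in IM_2_form M (cotangent_algebroid M \<pi>) \<Phi>\<^sub>B
          \<and> two_form C \<omega>\<^sub>B \<and> closed_form C \<omega>\<^sub>B \<and> multiplicative_form M C G \<omega>\<^sub>B
          \<and> (\<forall>x. \<forall>a\<in>fibre (groupoid_algebroid M C G) x.
               form_to_IM M C G \<omega>\<^sub>B x a = \<Phi>\<^sub>B x (form_to_IM M C G \<omega>\<^sub>G x a))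
          \<and> algebroid_iso (cotangent_algebroid M \<pi>) (cotangent_algebroid M \<pi>\<^sub>B) \<Phi>\<^sub>B
          \<and> symplectic_groupoid M C G \<omega>\<^sub>B \<and> integrates M C G \<omega>\<^sub>B \<pi>\<^sub>B"
proof -
  note M = assms(1) and pois = assms(2) and B = assms(7) and closed = assms(8) and pois_B = assms(10) and graph = assms(11)
  let ?t = "pullback2 C M (tgt G) B" and ?s = "pullback2 C M (src G) B"
  define \<omega> where "\<omega> = (\<lambda>g v w. \<omega>\<^sub>G g v w + (?t g v w - ?s g v w))"
  have lie: "lie_groupoid M C G" and form: "two_form C \<omega>\<^sub>G" "closed_form C \<omega>\<^sub>G"
    and nd: "nondegenerate \<omega>\<^sub>G" and mult: "multiplicative_form M C G \<omega>\<^sub>G"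
    using assms(3) unfolding symplectic_groupoid_def by auto
  have \<sigma>: "algebroid_iso (groupoid_algebroid M C G) (cotangent_algebroid M \<pi>) (form_to_IM M C G \<omega>\<^sub>G)"
    using assms(4) unfolding integrates_def by blast
  have C: "smooth_atlas C" by (rule lie_groupoid_atlases(2)[OF lie])
  note smooth = lie_groupoid_smooth[OF lie]
  have t: "two_form C ?t" "closed_form C ?t" and s: "two_form C ?s" "closed_form C ?s"
    using two_form_pullback[OF C M _ B] closed_form_pullback[OF C M _ B closed] smooth(1,2) by blast+
  have ts: "two_form C (\<lambda>g v w. ?t g v w - ?s g v w)" "closed_form C (\<lambda>g v w. ?t g v w - ?s g v w)"
    using two_form_lincomb[OF C t(1) s(1), of 1 "-1"] closed_form_lincomb[OF C t s, of 1 "-1"] by simp_all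
  have \<omega>: "two_form C \<omega>" "closed_form C \<omega>"
    using two_form_lincomb[OF C form(1) ts(1), of 1 1] closed_form_lincomb[OF C form ts, of 1 1] by (simp_all add: \<omega>_def)
  have \<omega>_mult: "multiplicative_form M C G \<omega>" unfolding \<omega>_def by (rule multiplicative_boundary[OF lie mult])
  have anchor: "sharp \<pi> x (form_to_IM M C G \<omega>\<^sub>G x a) = tangent_map C M (tgt G) (ident G x) a"
    if "a \<in> fibre (groupoid_algebroid M C G) x" for x a
    using \<sigma> that unfolding algebroid_iso_def
    by (simp add: cotangent_algebroid_simps groupoid_algebroid_simps[OF lie])
  have IM: "form_to_IM M C G \<omega> x a = gauge_map \<pi> B x (form_to_IM M C G \<omega>\<^sub>G x a)"
    if "a \<in> fibre (groupoid_algebroid M C G) x" for x a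
    using form_to_IM_gauge[OF lie form(1) mult B, of x a] that
    by (simp add: \<omega>_def gauge_map_def anchor) (simp add: groupoid_algebroid_simps[OF lie])
  \<comment> \<open>Surjectivity of the IM-form of \<open>\<omega>\<^sub>G\<close> supplies, over
    each covector, the vector at the unit that is translated in the nondegeneracy argument;
    compatibility with anchors computes its image under \<open>Tt\<close>.\<close>
  have "\<exists>a. tangent_map C M (src G) (ident G x) a = 0 \<and> form_to_IM M C G \<omega>\<^sub>G x a = \<beta> \<and>
      tangent_map C M (tgt G) (ident G x) a = sharp \<pi> x \<beta>" for x \<beta>
  proof -
    have "bij_betw (form_to_IM M C G \<omega>\<^sub>G x) (fibre (groupoid_algebroid M C G) x) (fibre (cotangent_algebroid M \<pi>) x)"
      using \<sigma> unfolding algebroid_iso_def bundle_iso_def by blast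
    then obtain a where "a \<in> fibre (groupoid_algebroid M C G) x" "form_to_IM M C G \<omega>\<^sub>G x a = \<beta>"
      unfolding bij_betw_def cotangent_algebroid_simps by (metis UNIV_I imageE)
    then show ?thesis using anchor by (auto simp: groupoid_algebroid_simps[OF lie])
  qed
  then have "nondegenerate \<omega>" unfolding \<omega>_def
    by (rule nondegenerate_gauge[OF lie form(1) mult nd B _ gauge_fixed_vector[OF M pois pois_B B closed graph]])
  then have sympl: "symplectic_groupoid M C G \<omega>"
    unfolding symplectic_groupoid_def using lie \<omega> \<omega>_mult by blast
  have iso: "algebroid_iso (cotangent_algebroid M \<pi>) (cotangent_algebroid M \<pi>\<^sub>B) (gauge_map \<pi> B)"
    by (rule gauge_map_algebroid_iso[OF M pois pois_B B closed graph])
  \<comment> \<open>The equation \<open>IM\<close> is available on \<open>ker Ts\<close> only, so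
    the composition also uses that this kernel is a subspace and contains the brackets of
    sections.\<close>
  have "algebroid_iso (groupoid_algebroid M C G) (cotangent_algebroid M \<pi>\<^sub>B) (form_to_IM M C G \<omega>)"
    by (rule algebroid_iso_compose[OF \<sigma> iso IM bracket_in_fibre[OF lie]])
      (auto simp: cotangent_algebroid_simps groupoid_algebroid_simps(1,2)[OF lie] linear_subspace_kernel[OF Ts_linear[OF lie]])
  then have "integrates M C G \<omega> \<pi>\<^sub>B" using sympl unfolding integrates_def by blast
  then show ?thesis
    unfolding Let_def \<omega>_def[symmetric] using gauge_map_IM[OF M pois B closed] \<omega> \<omega>_mult IM iso sympl by blast
qed

end
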